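(* Let $W$ be a finite Coxeter group, $k$ a field whose characteristic does not divide $|W|$, $\mathcal F$ the face semigroup and $\mathcal L$ the intersection lattice of the reflection arrangement of $W$. For each $X\in\mathcal L$ let $\ell_X\in k\mathcal F$ be a linear combination of faces of support $X$ whose coefficients sum to $1$, such that $w(\ell_X)=\ell_{w(X)}$ for all $w\in W$, $X\in\mathcal L$, and let $e_X=\ell_X-\sum_{Y>X}\ell_Xe_Y$ (recursively), so that $\{e_X\}_{X\in\mathcal L}$ is a complete system of primitive orthogonal idempotents for $k\mathcal F$. Fix an orientation $\epsilon_X$ on each subspace $X\in\mathcal L$, and for pairs of faces $x\lessdot y$ define $$[x:y]=\epsilon_{\operatorname{supp}(x)}(\vec x_1,\ldots,\vec x_d)\,\epsilon_{\operatorname{supp}(y)}(\vec x_1,\ldots,\vec x_d,\vec y_1),$$ where $\vec x_1,\ldots,\vec x_d$ is a basis of $\operatorname{supp}(x)$ and $\vec y_1$ is a vector in $y$. Let $\mathcal Q$ be the directed graph on the vertex set $\mathcal L$ with exactly one arrow $X\to Y$ if and only if $Y\lessdot X$. Let $\varphi$ be the function defined on the vertices and arrows of $\mathcal Q$ by $$\varphi(X)=e_X,\qquad \varphi(X\to Y)=\ell_Y\big([y:x]\,x+[y:x']\,x'\big)e_X,$$ where $y$ is any face of support $Y$ and $x$ and $x'$ are the two faces of support $X$ having $y$ as a face. Then: 1. $\varphi$ extends uniquely to a surjection of $k$-algebras $\varphi:k\mathcal Q\twoheadrightarrow k\mathcal F$; 2. the kernel of $\varphi$ is generated as an ideal by the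 sum of all the paths of length two in $\mathcal Q$; 3. $\varphi$ is $W$-equivariant with respect to the following action of $W$ on $k\mathcal Q$: $$w(X_0\to\cdots\to X_t)=\sigma_{X_0}(w)\,\sigma_{X_t}(w)\,\big(w(X_0)\to\cdots\to w(X_t)\big),$$ where, for $X\in\mathcal L$ and $w\in W$, $\sigma_X(w)=\epsilon_X(\vec x_1,\ldots,\vec x_d)\,\epsilon_{w(X)}(w(\vec x_1),\ldots,w(\vec x_d))$ for a basis $\vec x_1,\ldots,\vec x_d$ of $X$.
   Context: $W$ is a finite group of orthogonal transformations of a finite dimensional real inner product space $V$ generated by reflections. Its reflection arrangement $\mathcal A$ is the set of hyperplanes of $V$ fixed by some reflection in $W$. For each $H\in\mathcal A$ let $H^+,H^-$ be the two open half spaces determined by $H$ (labels fixed arbitrarily) and $H^0=H$. A face is a non-empty intersection $x=\bigcap_{H\in\mathcal A}H^{\sigma_H(x)}$ with $\sigma_H(x)\in\{+,0,-\}$. The set $\mathcal F$ of faces is a semigroup with identity: $xy$ is the face with $\sigma_H(xy)=\sigma_H(x)$ if $\sigma_H(x)\ne 0$ and $\sigma_H(xy)=\sigma_H(y)$ if $\sigma_H(x)=0$. $k\mathcal F$ is its semigroup algebra over $k$. $\mathcal F$ is partially ordered by $x\le y$ iff $xy=y$ (equivalently $x\subseteq\overline y$); if $x\le y$ then $x$ is called a face of $y$. The support $\operatorname{supp}(x)$ of a face $x$ is the intersection of all hyperplanes of $\mathcal A$ containing $x$ (equivalently the linear span of $x$). The intersection lattice is $\mathcal L=\operatorname{supp}(\mathcal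 F)$, ordered by inclusion of subspaces. In either poset $a\lessdot b$ means $a<b$ with nothing strictly between. $W$ acts on $\mathcal F$, on $\mathcal L$ and (by algebra automorphisms) on $k\mathcal F$. An orientation $\epsilon_X$ of $X$ assigns $\pm1$ to each ordered basis of $X$ ($+1$ if positively oriented, $-1$ otherwise). When $Y\lessdot X$ and $y$ is a face of support $Y$, there are exactly two faces of support $X$ having $y$ as a face. The path algebra $k\mathcal Q$ has the paths of $\mathcal Q$ (including the vertices, as paths of length $0$) as basis; the product $p\cdot p'$ of two paths is the concatenation "first $p'$, then $p$" if $p'$ ends where $p$ begins, and is $0$ otherwise. A complete system of primitive orthogonal idempotents of an algebra is a set of pairwise orthogonal primitive idempotents summing to $1$. *)

theory Defs
  imports
    "HOL-Analysis.Linear_Algebra"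
    "Jordan_Normal_Form.Determinant"
    "HOL-Algebra.Generated_Groups"
    "HOL-Algebra.Group_Action"
    "HOL-Algebra.RingHom"
    "HOL-Algebra.Module"
begin

section \<open>Finite reflection groups and their arrangements\<close>

text \<open>
  The ambient space is a type of class \<open>real_inner\<close> that is spanned by a finite set;
  unlike \<open>euclidean_space\<close> this does not exclude the zero space.
\<close>

definition reflection :: "('v::real_inner \<Rightarrow> 'v) \<Rightarrow> bool" where
  "reflection s \<longleftrightarrow>
     (\<exists>a. a \<noteq> 0 \<and> s = (\<lambda>v. v - (2 * inner a v / inner a a) *\<^sub>R a))"

definition finite_reflection_group :: "('v::real_inner \<Rightarrow> 'v) set \<Rightarrow> bool" where
  "finite_reflection_group W \<longleftrightarrow>
     finite W \<and> subgroup W (BijGroup UNIV) \<and>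
     (\<forall>w\<in>W. orthogonal_transformation w) \<and>
     generate (BijGroup UNIV) {s \<in> W. reflection s} = W"

definition reflection_arrangement :: "('v::real_inner \<Rightarrow> 'v) set \<Rightarrow> 'v set set" where
  "reflection_arrangement W = {{v. s v = v} | s. s \<in> W \<and> reflection s}"

section \<open>Faces and the intersection lattice\<close>

text \<open>
  The labels of the two open half spaces of a hyperplane are fixed arbitrarily, by choosing
  a normal vector: \<open>side H 1\<close>, \<open>side H (- 1)\<close> are the half spaces, and \<open>side H 0 = H\<close>.
\<close>

definition normal_vector :: "'v::real_inner set \<Rightarrow> 'v" where
  "normal_vector H = (SOME a. a \<noteq> 0 \<and> H = {v. inner a v = 0})"

definition side :: "'v::real_inner set \<Rightarrow> real \<Rightarrow> 'v set" where
  "side H s = {v. sgn (inner (normal_vector H) v) = s}"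

definition faces :: "'v::real_inner set set \<Rightarrow> 'v set set" where
  "faces A = {x. x \<noteq> {} \<and>
     (\<exists>\<sigma>. (\<forall>H\<in>A. \<sigma> H \<in> {1, 0, -1}) \<and> x = (\<Inter>H\<in>A. side H (\<sigma> H)))}"

definition face_sign :: "'v::real_inner set \<Rightarrow> 'v set \<Rightarrow> real" where
  "face_sign x H = (THE s. x \<subseteq> side H s)"

definition face_mult :: "'v::real_inner set set \<Rightarrow> 'v set \<Rightarrow> 'v set \<Rightarrow> 'v set" where
  "face_mult A x y =
     (\<Inter>H\<in>A. side H (if face_sign x H \<noteq> 0 then face_sign x H else face_sign y H))"

definition face_le :: "'v::real_inner set set \<Rightarrow> 'v set \<Rightarrow> 'v set \<Rightarrow> bool" where
  "face_le A x y \<longleftrightarrow> face_mult A x y = y"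

definition supp :: "'v set set \<Rightarrow> 'v set \<Rightarrow> 'v set" where
  "supp A x = \<Inter>{H \<in> A. x \<subseteq> H}"

definition intersection_lattice :: "'v::real_inner set set \<Rightarrow> 'v set set" where
  "intersection_lattice A = supp A ` faces A"

definition covered_by :: "'v set set \<Rightarrow> 'v set \<Rightarrow> 'v set \<Rightarrow> bool" where
  "covered_by L Y X \<longleftrightarrow>
     Y \<in> L \<and> X \<in> L \<and> Y \<subset> X \<and> \<not> (\<exists>Z\<in>L. Y \<subset> Z \<and> Z \<subset> X)"

section \<open>Algebras with a distinguished basis\<close>

text \<open>
  The algebra with basis \<open>B\<close> in which the product of two basis elements \<open>a\<close>, \<open>b\<close> is the basis
  element \<open>c\<close> if \<open>m a b = Some c\<close>, and \<open>0\<close> if \<open>m a b = None\<close>; its unit is the sum of the basis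
  elements in the finite set \<open>U\<close>. Elements are finitely supported coefficient functions.
\<close>

definition basis_algebra ::
    "'b set \<Rightarrow> ('b \<Rightarrow> 'b \<Rightarrow> 'b option) \<Rightarrow> 'b set \<Rightarrow> ('k::field, 'b \<Rightarrow> 'k) module" where
  "basis_algebra B m U =
     \<lparr>carrier = {f. finite {b. f b \<noteq> 0} \<and> {b. f b \<noteq> 0} \<subseteq> B},
      monoid.mult = (\<lambda>f g c. \<Sum>(a, b)\<in>{a. f a \<noteq> 0} \<times> {b. g b \<noteq> 0}.
                 if m a b = Some c then f a * g b else 0),
      one = (\<lambda>b. if b \<in> U then 1 else 0),
      zero = (\<lambda>b. 0),
      add = (\<lambda>f g b. f b + g b),
      module.smult = (\<lambda>r f b. r * f b)\<rparr>"

definition basis_elem :: "'b \<Rightarrow> 'b \<Rightarrow> 'k::field" where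
  "basis_elem b = (\<lambda>c. if c = b then 1 else 0)"

definition linear_extension :: "('b \<Rightarrow> 'c \<Rightarrow> 'k::field) \<Rightarrow> ('b \<Rightarrow> 'k) \<Rightarrow> 'c \<Rightarrow> 'k" where
  "linear_extension g f = (\<lambda>c. \<Sum>b | f b \<noteq> 0. f b * g b c)"

definition algebra_hom ::
    "('k::field, 'a) module \<Rightarrow> ('k, 'b) module \<Rightarrow> ('a \<Rightarrow> 'b) set" where
  "algebra_hom R S =
     {h \<in> Ring.ring_hom R S. \<forall>r. \<forall>a\<in>carrier R. h (r \<odot>\<^bsub>R\<^esub> a) = r \<odot>\<^bsub>S\<^esub> h a}"

definition primitive_idempotent :: "('a, 'm) ring_scheme \<Rightarrow> 'a \<Rightarrow> bool" where
  "primitive_idempotent R e \<longleftrightarrow>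
     e \<in> carrier R \<and> e \<otimes>\<^bsub>R\<^esub> e = e \<and> e \<noteq> \<zero>\<^bsub>R\<^esub> \<and>
     \<not> (\<exists>f\<in>carrier R. \<exists>g\<in>carrier R.
          f \<noteq> \<zero>\<^bsub>R\<^esub> \<and> g \<noteq> \<zero>\<^bsub>R\<^esub> \<and> f \<otimes>\<^bsub>R\<^esub> f = f \<and> g \<otimes>\<^bsub>R\<^esub> g = g \<and>
          f \<otimes>\<^bsub>R\<^esub> g = \<zero>\<^bsub>R\<^esub> \<and> g \<otimes>\<^bsub>R\<^esub> f = \<zero>\<^bsub>R\<^esub> \<and> e = f \<oplus>\<^bsub>R\<^esub> g)"

definition complete_primitive_orthogonal_idempotents ::
    "('a, 'm) ring_scheme \<Rightarrow> 'i set \<Rightarrow> ('i \<Rightarrow> 'a) \<Rightarrow> bool" where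
  "complete_primitive_orthogonal_idempotents R I e \<longleftrightarrow>
     (\<forall>i\<in>I. primitive_idempotent R (e i)) \<and>
     (\<forall>i\<in>I. \<forall>j\<in>I. i \<noteq> j \<longrightarrow> e i \<otimes>\<^bsub>R\<^esub> e j = \<zero>\<^bsub>R\<^esub>) \<and>
     (\<Oplus>\<^bsub>R\<^esub>i\<in>I. e i) = \<one>\<^bsub>R\<^esub>"

section \<open>The face semigroup algebra\<close>

text \<open>The identity of the face semigroup is the face \<open>\<Inter>A\<close>, all of whose signs are \<open>0\<close>.\<close>

definition face_algebra ::
    "'v::real_inner set set \<Rightarrow> ('k::field, 'v set \<Rightarrow> 'k) module" where
  "face_algebra A = basis_algebra (faces A) (\<lambda>x y. Some (face_mult A x y)) {\<Inter>A}"

definition face_action :: "('v \<Rightarrow> 'v) \<Rightarrow> ('v set \<Rightarrow> 'k::field) \<Rightarrow> 'v set \<Rightarrow> 'k" where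
  "face_action w = linear_extension (\<lambda>x. basis_elem (w ` x))"

section \<open>Orientations\<close>

definition ordered_basis :: "'v::real_vector set \<Rightarrow> 'v list \<Rightarrow> bool" where
  "ordered_basis X bs \<longleftrightarrow> distinct bs \<and> independent (set bs) \<and> span (set bs) = X"

definition change_of_basis :: "'v::real_vector list \<Rightarrow> 'v list \<Rightarrow> real mat" where
  "change_of_basis bs cs =
     mat (length bs) (length bs) (\<lambda>(i, j). representation (set bs) (cs ! j) (bs ! i))"

definition orientation :: "'v::real_vector set \<Rightarrow> ('v list \<Rightarrow> int) \<Rightarrow> bool" where
  "orientation X \<omega> \<longleftrightarrow>
     (\<forall>bs. ordered_basis X bs \<longrightarrow> \<omega> bs \<in> {1, -1}) \<and>
     (\<forall>bs cs. ordered_basis X bs \<and> ordered_basis X cs \<longrightarrow>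
        (\<omega> bs = \<omega> cs \<longleftrightarrow> Determinant.det (change_of_basis bs cs) > 0))"

text \<open>
  The next two signs do not depend on the choice of the bases (nor, for the first, of the vector in \<open>y\<close>);
  they are defined as the common value for all choices. The sign \<open>incidence A \<epsilon> x y\<close> is
  \<open>[x : y]\<close>, which is meaningful for faces \<open>x\<close> covered by \<open>y\<close>.
\<close>

definition incidence ::
    "'v::real_inner set set \<Rightarrow> ('v set \<Rightarrow> 'v list \<Rightarrow> int) \<Rightarrow> 'v set \<Rightarrow> 'v set \<Rightarrow> int" where
  "incidence A \<epsilon> x y =
     (THE s. \<forall>bs v. ordered_basis (supp A x) bs \<and> v \<in> y \<longrightarrow>
        s = \<epsilon> (supp A x) bs * \<epsilon> (supp A y) (bs @ [v]))"

definition orientation_sign ::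
    "('v::real_inner set \<Rightarrow> 'v list \<Rightarrow> int) \<Rightarrow> 'v set \<Rightarrow> ('v \<Rightarrow> 'v) \<Rightarrow> int" where
  "orientation_sign \<epsilon> X w =
     (THE s. \<forall>bs. ordered_basis X bs \<longrightarrow> s = \<epsilon> X bs * \<epsilon> (w ` X) (map w bs))"

section \<open>The quiver and its path algebra\<close>

text \<open>
  The quiver on the vertex set \<open>L\<close> has exactly one arrow from \<open>X\<close> to \<open>Y\<close> if \<open>Y\<close> is covered by
  \<open>X\<close>, and none otherwise. As there are no parallel arrows, a path of length \<open>t\<close> is the list
  of its \<open>t + 1\<close> vertices.
\<close>

definition quiver_paths :: "'v set set \<Rightarrow> 'v set list set" where
  "quiver_paths L =
     {p. p \<noteq> [] \<and> set p \<subseteq> L \<and> successively (\<lambda>X Y. covered_by L Y X) p}"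

text \<open>The product of \<open>p\<close> and \<open>q\<close> is "first \<open>q\<close>, then \<open>p\<close>".\<close>

definition path_mult :: "'a list \<Rightarrow> 'a list \<Rightarrow> 'a list option" where
  "path_mult p q = (if last q = hd p then Some (q @ tl p) else None)"

definition path_algebra :: "'v set set \<Rightarrow> ('k::field, 'v set list \<Rightarrow> 'k) module" where
  "path_algebra L = basis_algebra (quiver_paths L) path_mult {[X] | X. X \<in> L}"

definition path_action ::
    "('v::real_inner set \<Rightarrow> 'v list \<Rightarrow> int) \<Rightarrow> ('v \<Rightarrow> 'v) \<Rightarrow>
      ('v set list \<Rightarrow> 'k::field) \<Rightarrow> 'v set list \<Rightarrow> 'k" where
  "path_action \<epsilon> w = linear_extension (\<lambda>p q.
     of_int (orientation_sign \<epsilon> (hd p) w * orientation_sign \<epsilon> (last p) w) *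
     basis_elem (map (\<lambda>X. w ` X) p) q)"

text \<open>
  \<open>\<phi>\<close> takes the prescribed values on vertices and arrows; the prescription for an arrow is
  required for every choice of the face \<open>y\<close> and every labelling of the two faces \<open>x\<close>, \<open>x'\<close>.
\<close>

definition prescribed_values ::
    "'v::real_inner set set \<Rightarrow> ('v set \<Rightarrow> 'v list \<Rightarrow> int) \<Rightarrow>
      ('v set \<Rightarrow> 'v set \<Rightarrow> 'k::field) \<Rightarrow> ('v set \<Rightarrow> 'v set \<Rightarrow> 'k) \<Rightarrow>
      (('v set list \<Rightarrow> 'k) \<Rightarrow> 'v set \<Rightarrow> 'k) \<Rightarrow> bool" where
  "prescribed_values A \<epsilon> l e \<phi> \<longleftrightarrow>
     (let L = intersection_lattice A; kF = face_algebra A in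
       (\<forall>X\<in>L. \<phi> (basis_elem [X]) = e X) \<and>
       (\<forall>X Y y x x'.
          covered_by L Y X \<and> y \<in> faces A \<and> supp A y = Y \<and> x \<noteq> x' \<and>
          {z \<in> faces A. supp A z = X \<and> face_le A y z} = {x, x'} \<longrightarrow>
          \<phi> (basis_elem [X, Y]) =
            l Y \<otimes>\<^bsub>kF\<^esub>
            (of_int (incidence A \<epsilon> y x) \<odot>\<^bsub>kF\<^esub> basis_elem x \<oplus>\<^bsub>kF\<^esub>
             of_int (incidence A \<epsilon> y x') \<odot>\<^bsub>kF\<^esub> basis_elem x') \<otimes>\<^bsub>kF\<^esub> e X))"

end

theory Submission
  imports Defs "HOL-Library.Function_Algebras"
begin

text \<open>
  The left ideal \<open>kF e\<^sub>X\<close> has the basis \<open>x e\<^sub>X\<close>, where \<open>x\<close> runs through the faces of support \<open>X\<close>,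
  and in this basis a path starting at \<open>X\<close> is mapped to an iterated boundary. Surjectivity of \<open>\<phi>\<close>
  and the description of its kernel therefore amount to the exactness of the tail of the cellular
  chain complex of the zonotope dual to the arrangement in \<open>X\<close>: faces of codimension 2, 1 and 0.
  In dual form: a function on the chambers of \<open>X\<close> without jumps across walls is constant, and
  a function on the walls whose oriented sum around each face of codimension 2 vanishes is
  the jump of a function on the chambers. Both follow by induction on the number of hyperplanes. To delete
  \<open>H\<close>, subtract a coboundary so that the cocycle vanishes on the walls inside \<open>H\<close>; by the cocycle condition
  it then takes the same value on the two parts into which \<open>H\<close> cuts a wall, so it descends.
  By induction on \<open>X\<close>, only the zero function on the faces of support \<open>X\<close> is orthogonal to all paths, and
  every functional on the paths that kills the relations is the pairing with such a function.
\<close>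

section \<open>Faces of a hyperplane arrangement\<close>

text \<open>Deletion changes the faces but not the ambient subspaces, so every notion that must
  survive it is expressed without faces. A face is handled through one of its points, since a point
  has a face in each arrangement. Codimension one is \<open>hsec\<close>, a condition on two
  subspaces. An incidence number is a function \<open>I W Z u\<close> of two subspaces and a vector
  of the larger one, and its laws restrict at once to a smaller lattice; the numbers
  \<open>[x : y]\<close> are one instance. Dual statements avoid every count of dimensions: a vector
  outside a subspace is detected by a functional that kills the subspace
  (\<open>separating_functional\<close>), and functionals are turned into functions on faces. The
  bridge between the algebra and these functions is triangularity: among the faces of support
  \<open>X\<close>, only \<open>x\<close> itself has a non-zero coefficient in \<open>x e_X\<close>,
  and that coefficient is 1 (\<open>act_e_top\<close>), so pairing with a function on these faces
  really reads off coordinates.\<close>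

definition hsgn :: "'v::real_inner set \<Rightarrow> 'v \<Rightarrow> real" where
  "hsgn H v = sgn (inner (normal_vector H) v)"

definition face_of :: "'v::real_inner set set \<Rightarrow> 'v \<Rightarrow> 'v set" where
  "face_of A v = {u. \<forall>H\<in>A. hsgn H u = hsgn H v}"

definition flat_of :: "'v set set \<Rightarrow> 'v \<Rightarrow> 'v set" where
  "flat_of A v = \<Inter>{H \<in> A. v \<in> H}"

definition pt_le :: "'v::real_inner set set \<Rightarrow> 'v \<Rightarrow> 'v \<Rightarrow> bool" where
  "pt_le A v u \<longleftrightarrow> (\<forall>H\<in>A. v \<notin> H \<longrightarrow> hsgn H u = hsgn H v)"

text \<open>A point of the ray from \<open>v\<close> in direction \<open>u\<close> that lies in the product of the faces of \<open>v\<close>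
  and \<open>u\<close>; such points exist close to \<open>v\<close>.\<close>

definition near :: "'v::real_inner set set \<Rightarrow> 'v \<Rightarrow> 'v \<Rightarrow> 'v" where
  "near A v u = v + (SOME t. 0 < t \<and> (\<forall>H\<in>A. hsgn H (v + t *\<^sub>R u) =
      (if hsgn H v \<noteq> 0 then hsgn H v else hsgn H u))) *\<^sub>R u"

text \<open>Codimension one, stated for subspaces alone. For flats it is the covering relation
  (\<open>covered_by_iff\<close>), yet it means the same in an arrangement and in its
  deletion.\<close>

definition hsec :: "'v::real_inner set \<Rightarrow> 'v set \<Rightarrow> bool" where
  "hsec W Z \<longleftrightarrow> subspace Z \<and> W \<noteq> Z \<and> (\<exists>a. W = {v \<in> Z. inner a v = 0})"

section \<open>Signs of points and hyperplane sections\<close>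

lemma hsgn_values: "hsgn H v \<in> {1, 0, -1}"
  by (auto simp: hsgn_def sgn_if)

lemma hsgn_scaleR: "hsgn H (c *\<^sub>R v) = sgn c * hsgn H v"
  by (simp add: hsgn_def sgn_mult)

lemma hsgn_minus: "hsgn H (- v) = - hsgn H v"
  by (simp add: hsgn_def sgn_minus)

lemma hsec_subset: "hsec W Z \<Longrightarrow> W \<subset> Z"
  by (auto simp: hsec_def)

lemma hsec_subspace: "hsec W Z \<Longrightarrow> subspace Z" "hsec W Z \<Longrightarrow> subspace W"
proof -
  show "hsec W Z \<Longrightarrow> subspace Z" by (simp add: hsec_def)
  assume "hsec W Z"
  then obtain a where "subspace Z" "W = {v \<in> Z. inner a v = 0}" by (auto simp: hsec_def)
  then show "subspace W" by (auto simp: subspace_def inner_right_distrib)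
qed

lemma hsec_decomp:
  assumes "hsec W Z" "u \<in> Z" "u \<notin> W" "x \<in> Z"
  obtains c w where "w \<in> W" "x = c *\<^sub>R u + w"
proof -
  obtain a where a: "subspace Z" "W = {v \<in> Z. inner a v = 0}" using assms(1) by (auto simp: hsec_def)
  have nz: "inner a u \<noteq> 0" using a assms by auto
  define c where "c = inner a x / inner a u"
  have "x - c *\<^sub>R u \<in> W"
    using a assms nz by (auto simp: c_def inner_diff_right subspace_diff subspace_scale)
  then show thesis by (rule that[where c=c]) simp
qed

lemma hsec_maximal:
  assumes "hsec W Z" "subspace V" "W \<subseteq> V" "V \<subseteq> Z"
  shows "V = W \<or> V = Z"
proof (cases "V = W")
  case False
  then obtain u where u: "u \<in> V" "u \<notin> W" using assms(3) by auto
  have "Z \<subseteq> V"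
  proof
    fix x assume "x \<in> Z"
    then obtain c w where "w \<in> W" "x = c *\<^sub>R u + w" using hsec_decomp[OF assms(1)] u assms by (metis subsetD)
    then show "x \<in> V" using assms(2,3) u by (auto intro!: subspace_add subspace_scale)
  qed
  then show ?thesis using assms by auto
qed simp

locale hyperplane_arrangement =
  fixes A :: "'v::real_inner set set"
  assumes fin: "finite A"
    and hyperplane: "\<And>H. H \<in> A \<Longrightarrow> \<exists>a. a \<noteq> 0 \<and> H = {v. inner a v = 0}"
begin

abbreviation "lat \<equiv> intersection_lattice A"

lemma normal: assumes "H \<in> A" shows "normal_vector H \<noteq> 0" "H = {v. inner (normal_vector H) v = 0}"
proof -
  have "normal_vector H \<noteq> 0 \<and> H = {v. inner (normal_vector H) v = 0}"
    unfolding normal_vector_def by (rule someI_ex) (rule hyperplane[OF assms])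
  then show "normal_vector H \<noteq> 0" "H = {v. inner (normal_vector H) v = 0}" by auto
qed

lemma hsgn_0_iff: "H \<in> A \<Longrightarrow> hsgn H v = 0 \<longleftrightarrow> v \<in> H"
  using normal(2)[of H] by (auto simp: hsgn_def sgn_0_0)

lemma subspace_hyp: "H \<in> A \<Longrightarrow> subspace H"
  by (subst normal(2)) (auto simp: subspace_def inner_right_distrib)

lemma hsgn_add: assumes "H \<in> A" "w \<in> H" shows "hsgn H (v + w) = hsgn H v"
proof -
  have "inner (normal_vector H) w = 0" using normal(2)[OF assms(1)] assms(2) by blast
  then show ?thesis by (simp add: hsgn_def inner_right_distrib)
qed

lemma hsgn_lin: "H \<in> A \<Longrightarrow> w \<in> H \<Longrightarrow> hsgn H (c *\<^sub>R v + w) = sgn c * hsgn H v"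
  by (simp add: hsgn_add hsgn_scaleR)

text \<open>The claim is made for all \<open>s\<close> up to \<open>t\<close>, which lets the
  induction take the minimum of two bounds. A hyperplane whose form vanishes at \<open>v\<close>
  imposes no bound; for the others the step must be so short that the value at \<open>v\<close>
  dominates.\<close>

lemma near_exists:
  assumes "finite S"
  shows "\<exists>t>0. \<forall>s. 0 < s \<and> s \<le> t \<longrightarrow> (\<forall>H\<in>S. hsgn H (v + s *\<^sub>R u) =
      (if hsgn H v \<noteq> 0 then hsgn H v else hsgn H u))"
  using assms
proof (induction S)
  case empty
  then show ?case by (auto intro: exI[of _ 1])
next
  case (insert K S)
  then obtain t where t: "t > 0" "\<And>s. 0 < s \<Longrightarrow> s \<le> t \<Longrightarrow> \<forall>H\<in>S. hsgn H (v + s *\<^sub>R u) =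
      (if hsgn H v \<noteq> 0 then hsgn H v else hsgn H u)" by blast
  define n where "n = normal_vector K"
  obtain t2 where t2: "t2 > 0" "\<And>s. 0 < s \<Longrightarrow> s \<le> t2 \<Longrightarrow> hsgn K (v + s *\<^sub>R u) =
      (if hsgn K v \<noteq> 0 then hsgn K v else hsgn K u)"
  proof (cases "inner n v = 0")
    case True
    then have "hsgn K (v + s *\<^sub>R u) = (if hsgn K v \<noteq> 0 then hsgn K v else hsgn K u)" if "s > 0" for s
      using that by (simp add: hsgn_def n_def inner_right_distrib sgn_mult)
    then show thesis using that[of 1] by simp
  next
    case False
    \<comment> \<open>With this bound the perturbation is at most half of the value at
      \<open>v\<close>; the \<open>+ 1\<close> covers the case \<open>inner n u = 0\<close>.\<close>
    define t2 where "t2 = \<bar>inner n v\<bar> / (2 * (\<bar>inner n u\<bar> + 1))"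
    have p: "t2 > 0" using False by (simp add: t2_def)
    have "sgn (inner n v + s * inner n u) = sgn (inner n v)" if s: "0 < s" "s \<le> t2" for s
    proof -
      have "\<bar>s * inner n u\<bar> = s * \<bar>inner n u\<bar>" using s by (simp add: abs_mult)
      also have "\<dots> \<le> t2 * (\<bar>inner n u\<bar> + 1)" using s by (intro mult_mono) auto
      also have "\<dots> = \<bar>inner n v\<bar> / 2" by (simp add: t2_def field_simps)
      also have "\<dots> < \<bar>inner n v\<bar>" using False by simp
      finally show ?thesis by (auto simp: sgn_if abs_if split: if_splits)
    qed
    then show thesis using that[OF p] False by (simp add: hsgn_def n_def inner_right_distrib sgn_0_0)
  qed
  show ?case
    by (rule exI[of _ "min t t2"]) (use t t2 in auto)
qed

lemma near_props:
  shows "\<exists>t>0. near A v u = v + t *\<^sub>R u"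
    and near_hsgn: "H \<in> A \<Longrightarrow> hsgn H (near A v u) = (if hsgn H v \<noteq> 0 then hsgn H v else hsgn H u)"
proof -
  let ?P = "\<lambda>t. 0 < t \<and> (\<forall>H\<in>A. hsgn H (v + t *\<^sub>R u) =
      (if hsgn H v \<noteq> 0 then hsgn H v else hsgn H u))"
  have "\<exists>t. ?P t" using near_exists[OF fin] by (metis order_refl)
  then have *: "?P (Eps ?P)" by (rule someI_ex)
  then show "\<exists>t>0. near A v u = v + t *\<^sub>R u" by (auto simp: near_def)
  show "H \<in> A \<Longrightarrow> hsgn H (near A v u) = (if hsgn H v \<noteq> 0 then hsgn H v else hsgn H u)"
    using * unfolding near_def by blast
qed

lemma near_in_hyp_iff: "H \<in> A \<Longrightarrow> near A v u \<in> H \<longleftrightarrow> v \<in> H \<and> u \<in> H"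
  by (simp add: near_hsgn flip: hsgn_0_iff)

lemma near_in_subspace: "subspace Z \<Longrightarrow> v \<in> Z \<Longrightarrow> u \<in> Z \<Longrightarrow> near A v u \<in> Z"
  using near_props(1)[of v u] by (auto simp: subspace_add subspace_scale)

section \<open>Faces as classes of points\<close>

lemma face_of_self: "v \<in> face_of A v" by (simp add: face_of_def)

lemma face_of_eq_iff: "face_of A v = face_of A u \<longleftrightarrow> (\<forall>H\<in>A. hsgn H v = hsgn H u)"
  by (auto simp: face_of_def)

lemma face_of_eq: "u \<in> face_of A v \<Longrightarrow> face_of A u = face_of A v"
  by (auto simp: face_of_def)

lemma face_of_as_side: "face_of A v = (\<Inter>H\<in>A. side H (hsgn H v))"
  by (auto simp: face_of_def side_def hsgn_def)

lemma faces_eq: "faces A = range (face_of A)"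
proof (intro equalityI subsetI)
  fix x assume "x \<in> faces A"
  then obtain \<sigma> v where *: "x = (\<Inter>H\<in>A. side H (\<sigma> H))" "v \<in> x" by (auto simp: faces_def)
  then have "\<forall>H\<in>A. hsgn H v = \<sigma> H" by (auto simp: side_def hsgn_def)
  then have "x = face_of A v" using * by (auto simp: face_of_as_side)
  then show "x \<in> range (face_of A)" by auto
next
  fix x assume "x \<in> range (face_of A)"
  then obtain v where v: "x = face_of A v" by auto
  then show "x \<in> faces A" unfolding faces_def
    using hsgn_values face_of_self[of v] by (auto simp: face_of_as_side intro!: exI[of _ "\<lambda>H. hsgn H v"])
qed

lemma face_of_faces[simp]: "face_of A v \<in> faces A" by (simp add: faces_eq)

lemma faces_point: assumes "x \<in> faces A" "v \<in> x" shows "x = face_of A v"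
proof -
  obtain u where "x = face_of A u" using assms(1) by (auto simp: faces_eq)
  then show ?thesis using assms(2) face_of_eq by blast
qed

lemma facesE: assumes "x \<in> faces A" obtains v where "v \<in> x" "x = face_of A v"
  using assms face_of_self by (auto simp: faces_eq)

lemma finite_faces: "finite (faces A)"
proof -
  have "faces A \<subseteq> (\<lambda>\<sigma>. \<Inter>H\<in>A. side H (\<sigma> H)) ` (A \<rightarrow>\<^sub>E {1,0,-1})"
  proof
    fix x assume "x \<in> faces A"
    then obtain v where v: "x = face_of A v" by (rule facesE)
    show "x \<in> (\<lambda>\<sigma>. \<Inter>H\<in>A. side H (\<sigma> H)) ` (A \<rightarrow>\<^sub>E {1,0,-1})"
      by (rule image_eqI[of _ _ "restrict (\<lambda>H. hsgn H v) A"])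
        (use hsgn_values in \<open>auto simp: v face_of_as_side\<close>)
  qed
  moreover have "finite (A \<rightarrow>\<^sub>E {1,0,-1::real})" by (intro finite_PiE fin) auto
  ultimately show ?thesis by (meson finite_imageI finite_subset)
qed

lemma face_sign_face_of: assumes "H \<in> A" shows "face_sign (face_of A v) H = hsgn H v"
  unfolding face_sign_def
proof (rule the_equality)
  show "face_of A v \<subseteq> side H (hsgn H v)" using assms by (auto simp: face_of_as_side)
  fix s assume "face_of A v \<subseteq> side H s"
  then have "v \<in> side H s" using face_of_self by auto
  then show "s = hsgn H v" by (simp add: side_def hsgn_def)
qed

lemma face_of_subset_hyp: "H \<in> A \<Longrightarrow> face_of A v \<subseteq> H \<longleftrightarrow> v \<in> H"
  using face_of_self[of v] by (auto simp: face_of_def simp flip: hsgn_0_iff)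

lemma supp_face_of[simp]: "supp A (face_of A v) = flat_of A v"
  unfolding supp_def flat_of_def using face_of_subset_hyp by metis

lemma face_mult_face_of[simp]: "face_mult A (face_of A v) (face_of A u) = face_of A (near A v u)"
proof -
  have "face_mult A (face_of A v) (face_of A u) =
      (\<Inter>H\<in>A. side H (if hsgn H v \<noteq> 0 then hsgn H v else hsgn H u))"
    unfolding face_mult_def by (intro INF_cong refl) (simp add: face_sign_face_of)
  also have "\<dots> = (\<Inter>H\<in>A. side H (hsgn H (near A v u)))"
    by (intro INF_cong refl) (simp add: near_hsgn)
  finally show ?thesis by (simp add: face_of_as_side)
qed

lemma face_le_face_of[simp]: "face_le A (face_of A v) (face_of A u) \<longleftrightarrow> pt_le A v u"
  unfolding face_le_def face_mult_face_of face_of_eq_iff pt_le_def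
  by (auto simp: near_hsgn hsgn_0_iff)

section \<open>Flats and the intersection lattice\<close>

lemma flat_of_self: "v \<in> flat_of A v" by (auto simp: flat_of_def)

lemma mem_flat_of: "u \<in> flat_of A v \<longleftrightarrow> (\<forall>H\<in>A. v \<in> H \<longrightarrow> u \<in> H)" by (auto simp: flat_of_def)

lemma subspace_flat_of: "subspace (flat_of A v)"
  unfolding flat_of_def by (intro subspace_Inter) (auto simp: subspace_hyp)

lemma flat_of_mono: "u \<in> flat_of A v \<Longrightarrow> flat_of A u \<subseteq> flat_of A v"
  by (auto simp: flat_of_def)

lemma flat_of_face_of: "u \<in> face_of A v \<Longrightarrow> flat_of A u = flat_of A v"
proof -
  assume "u \<in> face_of A v"
  then have "H \<in> A \<Longrightarrow> u \<in> H \<longleftrightarrow> v \<in> H" for H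
    by (simp add: face_of_def flip: hsgn_0_iff)
  then show ?thesis by (auto simp: flat_of_def)
qed

lemma face_of_subset_flat: "face_of A v \<subseteq> flat_of A v"
  using flat_of_face_of flat_of_self by blast

lemma lattice_eq: "lat = range (flat_of A)"
  by (auto simp: intersection_lattice_def faces_eq image_image)

lemma flat_in_lattice[simp]: "flat_of A v \<in> lat" by (simp add: lattice_eq)

lemma finite_lattice: "finite (lat)"
  by (simp add: intersection_lattice_def finite_faces)

lemma lattice_subspace: "X \<in> lat \<Longrightarrow> subspace X"
  by (auto simp: lattice_eq subspace_flat_of)

lemma flat_of_subset_iff: "H \<in> A \<Longrightarrow> flat_of A v \<subseteq> H \<longleftrightarrow> v \<in> H"
  using flat_of_self by (auto simp: flat_of_def)

lemma lattice_closed: "X \<in> lat \<Longrightarrow> X = \<Inter>{H \<in> A. X \<subseteq> H}"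
proof -
  assume "X \<in> lat"
  then obtain v where v: "X = flat_of A v" by (auto simp: lattice_eq)
  have "{H \<in> A. X \<subseteq> H} = {H \<in> A. v \<in> H}" using flat_of_subset_iff v by auto
  then show "X = \<Inter>{H \<in> A. X \<subseteq> H}" using v by (simp add: flat_of_def)
qed

lemma flat_of_subset: "X \<in> lat \<Longrightarrow> v \<in> X \<Longrightarrow> flat_of A v \<subseteq> X"
  using lattice_closed[of X] by (auto simp: flat_of_def)

text \<open>One hyperplane at a time: a small step from \<open>v\<close> out of \<open>H\<close>
  does not return to a hyperplane that \<open>v\<close> already avoids.\<close>

lemma generic_point:
  assumes "subspace X" "finite T" "T \<subseteq> A" "\<And>H. H \<in> T \<Longrightarrow> \<not> X \<subseteq> H"
  shows "\<exists>v\<in>X. \<forall>H\<in>T. v \<notin> H"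
  using assms(2-4)
proof (induction T)
  case empty
  then show ?case using assms(1) subspace_0 by auto
next
  case (insert H T)
  then obtain v where v: "v \<in> X" "\<forall>H\<in>T. v \<notin> H" by blast
  obtain u where u: "u \<in> X" "u \<notin> H" using insert.prems by blast
  have "K \<in> A \<Longrightarrow> v \<notin> K \<or> u \<notin> K \<Longrightarrow> near A v u \<notin> K" for K by (simp add: near_in_hyp_iff)
  then have "\<forall>K\<in>insert H T. near A v u \<notin> K" using u v insert.prems(1) by blast
  then show ?case using near_in_subspace[OF assms(1) v(1) u(1)] by blast
qed

text \<open>An intersection of hyperplanes is the support of a face because a generic point of it
  lies on no further hyperplane.\<close>

lemma lattice_iff: "X \<in> lat \<longleftrightarrow> X = \<Inter>{H \<in> A. X \<subseteq> H}"
proof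
  assume X: "X = \<Inter>{H \<in> A. X \<subseteq> H}"
  have "subspace (\<Inter>{H \<in> A. X \<subseteq> H})" by (rule subspace_Inter) (simp add: subspace_hyp)
  then have "subspace X" by (rule back_subst[OF _ X[symmetric]])
  moreover have "finite {H\<in>A. \<not> X \<subseteq> H}" using fin by (rule finite_subset[rotated]) blast
  ultimately obtain v where v: "v \<in> X" "\<forall>H\<in>{H\<in>A. \<not> X \<subseteq> H}. v \<notin> H"
    using generic_point[of X "{H\<in>A. \<not> X \<subseteq> H}"] by blast
  then have "{H \<in> A. v \<in> H} = {H \<in> A. X \<subseteq> H}" by blast
  then have "flat_of A v = \<Inter>{H \<in> A. X \<subseteq> H}" by (simp only: flat_of_def)
  then have "X = flat_of A v" by (rule trans[OF X sym])
  then show "X \<in> lat" by simp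
qed (rule lattice_closed)

lemma lattice_Int: "X \<in> lat \<Longrightarrow> H \<in> A \<Longrightarrow> X \<inter> H \<in> lat"
proof -
  assume X: "X \<in> lat" and H: "H \<in> A"
  have "x \<in> X" if "x \<in> \<Inter>{K \<in> A. X \<inter> H \<subseteq> K}" for x
  proof -
    have "x \<in> \<Inter>{K \<in> A. X \<subseteq> K}" using that by blast
    then show ?thesis using lattice_closed[OF X] by simp
  qed
  then have "X \<inter> H = \<Inter>{K \<in> A. X \<inter> H \<subseteq> K}" using H by blast
  then show ?thesis by (simp add: lattice_iff)
qed

lemma hsec_Int: "subspace X \<Longrightarrow> H \<in> A \<Longrightarrow> \<not> X \<subseteq> H \<Longrightarrow> hsec (X \<inter> H) X"
  unfolding hsec_def using normal(2)[of H] by blast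

lemma hyp_separating:
  assumes "X \<in> lat" "Y \<in> lat" "Y \<subset> X"
  obtains H where "H \<in> A" "Y \<subseteq> H" "\<not> X \<subseteq> H"
proof -
  have "\<exists>H\<in>A. Y \<subseteq> H \<and> \<not> X \<subseteq> H"
  proof (rule ccontr)
    assume "\<not> ?thesis"
    then have "X \<subseteq> \<Inter>{H \<in> A. Y \<subseteq> H}" by blast
    then show False using lattice_closed[OF assms(2)] assms(3) by simp
  qed
  then show thesis using that by blast
qed

lemma hsec_hyp:
  assumes "X \<in> lat" "Y \<in> lat" "hsec Y X"
  obtains H where "H \<in> A" "\<not> X \<subseteq> H" "Y = X \<inter> H"
proof -
  obtain H where H: "H \<in> A" "Y \<subseteq> H" "\<not> X \<subseteq> H" using hyp_separating assms hsec_subset by metis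
  moreover have "X \<inter> H = Y \<or> X \<inter> H = X"
    using assms H hsec_subset[of Y X] by (intro hsec_maximal) (auto simp: lattice_subspace subspace_hyp subspace_inter)
  ultimately show thesis using that by blast
qed

text \<open>If \<open>X\<close> covers \<open>Y\<close>, a hyperplane that contains \<open>Y\<close>
  but not \<open>X\<close> cuts \<open>X\<close> in a flat that can only be \<open>Y\<close>.
  Conversely, no subspace fits strictly between two that differ by one dimension.\<close>

lemma covered_by_iff: "covered_by (lat) Y X \<longleftrightarrow>
   Y \<in> lat \<and> X \<in> lat \<and> hsec Y X"
proof
  assume c: "covered_by (lat) Y X"
  then obtain H where H: "H \<in> A" "Y \<subseteq> H" "\<not> X \<subseteq> H" using hyp_separating unfolding covered_by_def by metis
  have "\<not> (Y \<subset> X \<inter> H \<and> X \<inter> H \<subset> X)" using c lattice_Int[OF _ H(1)] unfolding covered_by_def by blast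
  then have "Y = X \<inter> H" using H c unfolding covered_by_def by blast
  then show "Y \<in> lat \<and> X \<in> lat \<and> hsec Y X"
    using c hsec_Int[of X H] H lattice_subspace unfolding covered_by_def by metis
next
  assume "Y \<in> lat \<and> X \<in> lat \<and> hsec Y X"
  then show "covered_by (lat) Y X"
    unfolding covered_by_def using hsec_subset[of Y X] hsec_maximal[of Y X] lattice_subspace by blast
qed

section \<open>The two faces above a face of codimension one\<close>

lemma flat_of_near: "flat_of A (near A v u) = \<Inter>{H\<in>A. v \<in> H \<and> u \<in> H}"
  by (auto simp: flat_of_def near_in_hyp_iff)

lemma pt_le_near: "pt_le A v (near A v u)"
  by (auto simp: pt_le_def near_hsgn hsgn_0_iff)

lemma pt_le_trans: "pt_le A u v \<Longrightarrow> pt_le A v w \<Longrightarrow> pt_le A u w"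
  unfolding pt_le_def using hsgn_0_iff by metis

lemma pt_le_flat: "pt_le A v u \<Longrightarrow> flat_of A v \<subseteq> flat_of A u"
  unfolding pt_le_def flat_of_def using hsgn_0_iff by (auto, metis)

text \<open>A hyperplane through \<open>w\<close> and \<open>u\<close> contains the flat of
  \<open>w\<close> and a vector of \<open>Z\<close> outside it, hence all of
  \<open>Z\<close>.\<close>

lemma flat_of_near_hsec:
  assumes "Z \<in> lat" "hsec (flat_of A w) Z" "u \<in> Z" "u \<notin> flat_of A w"
  shows "flat_of A (near A w u) = Z"
proof -
  have "Z \<subseteq> H" if "H \<in> A" "w \<in> H" "u \<in> H" for H
  proof
    fix x assume "x \<in> Z"
    then obtain c v where "v \<in> flat_of A w" "x = c *\<^sub>R u + v" using hsec_decomp assms by metis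
    then show "x \<in> H" using that subspace_hyp mem_flat_of by (simp add: subspace_add subspace_scale)
  qed
  moreover have "w \<in> Z" using hsec_subset[OF assms(2)] flat_of_self by blast
  then have "near A w u \<in> Z" using near_in_subspace lattice_subspace assms by blast
  ultimately show ?thesis
    using flat_of_subset[OF assms(1), of "near A w u"] by (auto simp: flat_of_near)
qed

text \<open>On a hyperplane through \<open>w\<close> the summand \<open>v\<close> does not count and
  the sign is that of \<open>u\<close>; on all others \<open>w\<close> decides.\<close>

lemma face_of_above:
  assumes "Z \<in> lat" "hsec (flat_of A w) Z" "pt_le A w z"
    "z = c *\<^sub>R u + v" "v \<in> flat_of A w" "c > 0"
  shows "face_of A z = face_of A (near A w u)"
  unfolding face_of_eq_iff
proof
  fix H assume H: "H \<in> A"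
  show "hsgn H z = hsgn H (near A w u)"
  proof (cases "w \<in> H")
    case True
    then have "v \<in> H" using assms(5) H by (auto simp: flat_of_def)
    then show ?thesis using H True assms(6) hsgn_lin[OF H] by (simp add: assms(4) near_hsgn hsgn_0_iff)
  next
    case False
    then show ?thesis using H assms(3) by (simp add: near_hsgn hsgn_0_iff pt_le_def)
  qed
qed

text \<open>Modulo the flat of \<open>w\<close> the space \<open>Z\<close> is a line, so a face
  above is determined by the sign of the coefficient of \<open>u\<close>.\<close>

lemma two_faces_above:
  assumes "Z \<in> lat" "hsec (flat_of A w) Z" "u \<in> Z" "u \<notin> flat_of A w"
  shows "{z \<in> faces A. supp A z = Z \<and> face_le A (face_of A w) z} =
      {face_of A (near A w u), face_of A (near A w (- u))}"
    and "face_of A (near A w u) \<noteq> face_of A (near A w (- u))"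
proof -
  have mu: "- u \<in> Z" "- u \<notin> flat_of A w"
    using assms(3,4) lattice_subspace[OF assms(1)] subspace_flat_of[of w]
    by (auto dest: subspace_neg)
  show "{z \<in> faces A. supp A z = Z \<and> face_le A (face_of A w) z} =
      {face_of A (near A w u), face_of A (near A w (- u))}" (is "?S = ?T")
  proof
    show "?T \<subseteq> ?S" using flat_of_near_hsec assms mu by (auto simp: pt_le_near)
    show "?S \<subseteq> ?T"
    proof
      fix z assume "z \<in> ?S"
      then obtain p where p: "z = face_of A p" "flat_of A p = Z" "pt_le A w p" by (auto simp: faces_eq)
      then have "p \<in> Z" using flat_of_self by blast
      then obtain c v where v: "v \<in> flat_of A w" "p = c *\<^sub>R u + v" using hsec_decomp assms by metis
      have "c \<noteq> 0"
      proof
        assume "c = 0"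
        then have "p \<in> flat_of A w" using v by simp
        then have "Z \<subseteq> flat_of A w" using p flat_of_mono by blast
        then show False using hsec_subset[OF assms(2)] by blast
      qed
      then consider "c > 0" | "- c > 0" by linarith
      then show "z \<in> ?T"
      proof cases
        case 1
        then show ?thesis using face_of_above[OF assms(1,2) p(3) v(2,1)] p by simp
      next
        case 2
        have "p = (- c) *\<^sub>R (- u) + v" using v by simp
        from face_of_above[OF assms(1,2) p(3) this v(1) 2] show ?thesis using p by simp
      qed
    qed
  qed
  obtain H where H: "H \<in> A" "w \<in> H" "u \<notin> H" using assms(4) mem_flat_of by blast
  then show "face_of A (near A w u) \<noteq> face_of A (near A w (- u))"
    using H near_hsgn[OF H(1), of w u] near_hsgn[OF H(1), of w "-u"] hsgn_0_iff[OF H(1), of u]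
      hsgn_0_iff[OF H(1), of w]
    unfolding face_of_eq_iff by (auto simp: hsgn_minus intro!: bexI[of _ H])
qed

end

section \<open>Incidence numbers and the coboundary\<close>

definition rep :: "'v set \<Rightarrow> 'v" where "rep x = (SOME v. v \<in> x)"

definition faces_on :: "'v::real_inner set set \<Rightarrow> 'v set \<Rightarrow> 'v set set" where
  "faces_on A X = {x \<in> faces A. supp A x = X}"

text \<open>The laws of oriented incidence numbers with values in a field. The number is a sign,
  depends only on the side of \<open>W\<close> in \<open>Z\<close> that contains \<open>u\<close>,
  and changes with that side. Going from \<open>W\<close> to \<open>X\<close> through
  \<open>Z\<close> or through \<open>Z'\<close> attaches the vectors \<open>u\<close> and
  \<open>v\<close> in opposite orders, whence the minus sign of the last law.\<close>

definition incidence_system :: "'v::real_inner set set \<Rightarrow> ('v set \<Rightarrow> 'v set \<Rightarrow> 'v \<Rightarrow> 'k::field) \<Rightarrow> bool" where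
  "incidence_system \<L> I \<longleftrightarrow>
    (\<forall>W\<in>\<L>. \<forall>Z\<in>\<L>. \<forall>u. hsec W Z \<and> u \<in> Z \<and> u \<notin> W \<longrightarrow>
       I W Z u * I W Z u = 1 \<and> I W Z (- u) = - I W Z u \<and>
       (\<forall>c>0. \<forall>w\<in>W. I W Z (c *\<^sub>R u + w) = I W Z u)) \<and>
    (\<forall>W\<in>\<L>. \<forall>Z\<in>\<L>. \<forall>Z'\<in>\<L>. \<forall>X\<in>\<L>. \<forall>u v.
       hsec W Z \<and> hsec W Z' \<and> hsec Z X \<and> hsec Z' X \<and> Z \<noteq> Z' \<and>
       u \<in> Z \<and> u \<notin> W \<and> v \<in> Z' \<and> v \<notin> W \<longrightarrow>
       I W Z u * I Z X v = - (I W Z' v * I Z' X u))"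

definition mid :: "'v::real_inner set set \<Rightarrow> 'v set \<Rightarrow> 'v set \<Rightarrow> 'v set set" where
  "mid A W X = {Z \<in> intersection_lattice A. hsec W Z \<and> hsec Z X}"

text \<open>The chambers of the arrangement that \<open>A\<close> induces in \<open>X\<close> are the faces of support \<open>X\<close>; on functions
  on these faces, \<open>cob\<close> is the cellular coboundary of the dual zonotope.\<close>

definition cob :: "'v::real_inner set set \<Rightarrow> ('v set \<Rightarrow> 'v set \<Rightarrow> 'v \<Rightarrow> 'k::field) \<Rightarrow> 'v set \<Rightarrow>
    ('v set \<Rightarrow> 'k) \<Rightarrow> 'v set \<Rightarrow> 'k" where
  "cob A I X g w = (\<Sum>x\<in>{x \<in> faces_on A X. face_le A w x}. I (supp A w) X (rep x) * g x)"

lemma rep_mem: "x \<noteq> {} \<Longrightarrow> rep x \<in> x" unfolding rep_def by (auto intro: someI)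

text \<open>Unless \<open>Z' = Z\<close>, the space \<open>W\<close> is the intersection of the two,
  so the functional that cuts \<open>Z\<close> out of \<open>X\<close> also cuts \<open>W\<close>
  out of \<open>Z'\<close>.\<close>

lemma hsec_other:
  assumes "hsec W Z" "hsec Z X" "hsec Z' X" "W \<subseteq> Z'"
  shows "hsec W Z'"
proof (cases "Z' = Z")
  case False
  have s: "subspace Z" "subspace Z'" using assms hsec_subspace by auto
  have "\<not> Z \<subseteq> Z'" using hsec_maximal[OF assms(2) s(2)] hsec_subset[OF assms(3)] False by blast
  moreover have "Z \<inter> Z' = W \<or> Z \<inter> Z' = Z"
    using assms s hsec_subset[OF assms(1)] by (intro hsec_maximal) (auto simp: subspace_inter)
  ultimately have W: "W = Z \<inter> Z'" by blast
  have "\<not> Z' \<subseteq> Z" using hsec_maximal[OF assms(3) s(1)] hsec_subset[OF assms(2)] False by blast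
  obtain a where "Z = {v \<in> X. inner a v = 0}" using assms(2) by (auto simp: hsec_def)
  then have "W = {v \<in> Z'. inner a v = 0}" using W hsec_subset[OF assms(3)] by blast
  moreover have "W \<noteq> Z'" using W \<open>\<not> Z' \<subseteq> Z\<close> by blast
  ultimately show ?thesis using s by (auto simp: hsec_def)
qed (use assms in simp)

text \<open>\<open>p\<close> lies in the open cone given by the signs of finitely many functionals,
  and the ray in direction \<open>d\<close> leaves it at the smallest time at which one of them
  vanishes. Only those in \<open>S'\<close> ever vanish on the ray. Used to find the walls of a
  sector.\<close>

lemma first_exit:
  fixes n :: "'i \<Rightarrow> 'v::real_inner"
  assumes fin: "finite S" and p: "\<forall>i\<in>S. inner (n i) p \<noteq> 0"
    and ex: "\<exists>i\<in>S. inner (n i) p * inner (n i) d < 0"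
  shows "\<exists>t>0. (\<exists>i\<in>S. inner (n i) (p + t *\<^sub>R d) = 0) \<and>
    (\<forall>i\<in>S. inner (n i) (p + t *\<^sub>R d) = 0 \<or> sgn (inner (n i) (p + t *\<^sub>R d)) = sgn (inner (n i) p))"
proof -
  define S' where "S' = {i\<in>S. inner (n i) p * inner (n i) d < 0}"
  define T where "T i = - inner (n i) p / inner (n i) d" for i
  have "finite S'" "S' \<noteq> {}" using fin ex by (auto simp: S'_def)
  then obtain j where j: "j \<in> S'" "\<And>i. i \<in> S' \<Longrightarrow> T j \<le> T i"
    using ex_min_if_finite[of "T ` S'"] by (metis (no_types, lifting) arg_min_if_finite(1) arg_min_least)
  have pos: "T i > 0" if "i \<in> S'" for i
    using that by (auto simp: S'_def T_def mult_less_0_iff divide_simps)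
  have zero: "inner (n j) (p + T j *\<^sub>R d) = 0"
    using j(1) by (auto simp: S'_def T_def inner_add_right inner_diff_right mult_less_0_iff)
  have "inner (n i) (p + T j *\<^sub>R d) = 0 \<or> sgn (inner (n i) (p + T j *\<^sub>R d)) = sgn (inner (n i) p)"
    if i: "i \<in> S" for i
  proof (cases "i \<in> S'")
    case True
    define a b t where "a = inner (n i) p" and "b = inner (n i) d" and "t = T j"
    have tb: "t \<le> - a / b" "a * b < 0" using j(2)[OF True] True by (auto simp: t_def T_def a_def b_def S'_def)
    have "a + t * b = 0 \<or> sgn (a + t * b) = sgn a"
    proof (cases "a > 0")
      case True
      then have b: "b < 0" using tb(2) by (simp add: mult_less_0_iff)
      then have "t * b \<ge> - a" using tb(1) by (simp add: divide_simps)
      then show ?thesis using True by (auto simp: sgn_if)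
    next
      case False
      then have b: "b > 0" "a < 0" using tb(2) by (auto simp: mult_less_0_iff)
      then have "t * b \<le> - a" using tb(1) by (simp add: divide_simps)
      then show ?thesis using b by (auto simp: sgn_if)
    qed
    then show ?thesis by (simp add: a_def b_def t_def inner_add_right)
  next
    case False
    define a b t where "a = inner (n i) p" and "b = inner (n i) d" and "t = T j"
    have ab: "a * b \<ge> 0" "a \<noteq> 0" "t > 0" using False i p pos[OF j(1)] by (auto simp: a_def b_def S'_def t_def)
    have "sgn (a + t * b) = sgn a"
    proof (cases "a > 0")
      case True
      then have "b \<ge> 0" using ab by (simp add: zero_le_mult_iff)
      then show ?thesis using True ab by (simp add: add_pos_nonneg)
    next
      case False
      then have "b \<le> 0" "a < 0" using ab by (auto simp: zero_le_mult_iff)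
      then have "a + t * b < 0" using ab by (simp add: add_neg_nonpos mult_nonneg_nonpos)
      then show ?thesis using \<open>a < 0\<close> by simp
    qed
    then show ?thesis by (simp add: a_def b_def t_def inner_add_right)
  qed
  then show ?thesis using pos[OF j(1)] zero j(1) by (auto simp: S'_def)
qed

section \<open>Incidence numbers and the coboundary at a wall\<close>

locale incidence_arrangement = hyperplane_arrangement A for A :: "'v::real_inner set set" +
  fixes I :: "'v set \<Rightarrow> 'v set \<Rightarrow> 'v \<Rightarrow> 'k::field"
  assumes inc: "incidence_system (intersection_lattice A) I"
begin

lemma
  assumes "W \<in> lat" "Z \<in> lat" "hsec W Z" "u \<in> Z" "u \<notin> W"
  shows inc_sq: "I W Z u * I W Z u = 1" and inc_minus: "I W Z (- u) = - I W Z u"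
    and inc_side: "c > 0 \<Longrightarrow> w \<in> W \<Longrightarrow> I W Z (c *\<^sub>R u + w) = I W Z u"
proof -
  note * = inc[unfolded incidence_system_def, THEN conjunct1, THEN bspec, OF assms(1), THEN bspec,
      OF assms(2), THEN spec, of u, THEN mp, OF conjI[OF assms(3) conjI[OF assms(4,5)]]]
  from * show "I W Z u * I W Z u = 1" "I W Z (- u) = - I W Z u" by simp_all
  from * show "c > 0 \<Longrightarrow> w \<in> W \<Longrightarrow> I W Z (c *\<^sub>R u + w) = I W Z u" by simp
qed

lemma inc_diamond:
  assumes "W \<in> lat" "Z \<in> lat" "Z' \<in> lat" "X \<in> lat" "hsec W Z" "hsec W Z'" "hsec Z X" "hsec Z' X" "Z \<noteq> Z'"
    "u \<in> Z" "u \<notin> W" "v \<in> Z'" "v \<notin> W"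
  shows "I W Z u * I Z X v = - (I W Z' v * I Z' X u)"
  by (rule inc[unfolded incidence_system_def, THEN conjunct2, THEN bspec, OF assms(1), THEN bspec,
      OF assms(2), THEN bspec, OF assms(3), THEN bspec, OF assms(4), THEN spec, THEN spec, THEN mp])
    (simp add: assms)

lemma rep_face: "x \<in> faces A \<Longrightarrow> face_of A (rep x) = x"
  using faces_point[of x "rep x"] facesE[of x] rep_mem[of x] by blast

lemma rep_face_of: "rep (face_of A v) \<in> face_of A v"
  using rep_mem[of "face_of A v"] face_of_self[of v] by blast

lemma not_mem_of_flat:
  assumes "hsec W Z" "flat_of A z = Z" "W \<in> lat"
  shows "z \<in> Z" "z \<notin> W"
proof -
  show "z \<in> Z" using assms(2) flat_of_self[of z] by simp
  show "z \<notin> W" using assms(2) flat_of_subset[OF assms(3), of z] hsec_subset[OF assms(1)] by blast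
qed

text \<open>Face and incidence number are decided together, by the sign of the coefficient of
  \<open>u\<close> in \<open>z\<close>.\<close>

lemma above_cases:
  assumes Z: "Z \<in> lat" "hsec (flat_of A w) Z" and u: "u \<in> Z" "u \<notin> flat_of A w"
    and z: "z \<in> Z" "z \<notin> flat_of A w" "pt_le A w z"
  shows "face_of A z = face_of A (near A w u) \<and> I (flat_of A w) Z z = I (flat_of A w) Z u \<or>
    face_of A z = face_of A (near A w (- u)) \<and> I (flat_of A w) Z z = - I (flat_of A w) Z u"
proof -
  let ?W = "flat_of A w"
  obtain c v where v: "v \<in> ?W" "z = c *\<^sub>R u + v" using hsec_decomp Z u z by metis
  have mu: "- u \<in> Z" "- u \<notin> ?W"
    using u lattice_subspace[OF Z(1)] subspace_flat_of[of w] by (auto dest: subspace_neg)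
  have "c \<noteq> 0" using v z by auto
  then consider "c > 0" | "- c > 0" by linarith
  then show ?thesis
  proof cases
    case 1
    then show ?thesis using face_of_above[OF Z z(3) v(2,1) 1] inc_side[OF _ Z u 1 v(1)] v(2) by simp
  next
    case 2
    have e: "z = (- c) *\<^sub>R (- u) + v" using v by simp
    have "I ?W Z z = I ?W Z (- u)" using inc_side[OF _ Z mu 2 v(1)] e by simp
    then show ?thesis using face_of_above[OF Z z(3) e v(1) 2] inc_minus[OF _ Z u] by simp
  qed
qed

lemma inc_face:
  assumes Z: "Z \<in> lat" "hsec (flat_of A w) Z" and z: "flat_of A z = Z" "pt_le A w z"
    and z': "z' \<in> face_of A z"
  shows "I (flat_of A w) Z z' = I (flat_of A w) Z z"
proof -
  have f: "flat_of A z' = Z" "face_of A z' = face_of A z"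
    using z' z flat_of_face_of face_of_eq by blast+
  have "pt_le A w z'" using z(2) f(2) by (metis face_le_face_of)
  moreover have m: "z \<in> Z" "z \<notin> flat_of A w" "z' \<in> Z" "z' \<notin> flat_of A w"
    using not_mem_of_flat[OF Z(2)] f z by auto
  moreover have "face_of A (near A w z) \<noteq> face_of A (near A w (- z))"
    using two_faces_above(2)[OF Z m(1,2)] .
  moreover have "face_of A z = face_of A (near A w z)"
    using face_of_above[OF Z z(2), of 1 z 0] subspace_0[OF subspace_flat_of[of w]] by simp
  ultimately show ?thesis using above_cases[OF Z m(1,2) m(3,4)] f by auto
qed

lemma inc_rep:
  assumes Z: "Z \<in> lat" "hsec (flat_of A w) Z" and z: "flat_of A z = Z" "pt_le A w z"
  shows "I (flat_of A w) Z (rep (face_of A z)) = I (flat_of A w) Z z"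
  using inc_face[OF assms rep_face_of] .

lemma inc_near:
  assumes Z: "Z \<in> lat" "hsec (flat_of A w) Z" and u: "u \<in> Z" "u \<notin> flat_of A w"
  shows "I (flat_of A w) Z (near A w u) = I (flat_of A w) Z u"
proof -
  obtain t where t: "t > 0" "near A w u = w + t *\<^sub>R u" using near_props by blast
  then have "near A w u = t *\<^sub>R u + w" by simp
  then show ?thesis using inc_side[OF _ Z u t(1) flat_of_self[of w]] by simp
qed

lemma inc_rep_near:
  assumes Z: "Z \<in> lat" "hsec (flat_of A w) Z" and u: "u \<in> Z" "u \<notin> flat_of A w"
  shows "I (flat_of A w) Z (rep (face_of A (near A w u))) = I (flat_of A w) Z u"
  using inc_rep[OF Z flat_of_near_hsec[OF assms] pt_le_near] inc_near[OF assms] by simp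

text \<open>The two faces above a wall have opposite incidence numbers, so the coboundary is, up to
  sign, the jump across the wall.\<close>

lemma cob_two:
  assumes Z: "Z \<in> lat" "hsec (flat_of A w) Z" and u: "u \<in> Z" "u \<notin> flat_of A w"
  shows "cob A I Z g (face_of A w) =
    I (flat_of A w) Z u * (g (face_of A (near A w u)) - g (face_of A (near A w (- u))))"
proof -
  have mu: "- u \<in> Z" "- u \<notin> flat_of A w"
    using u lattice_subspace[OF Z(1)] subspace_flat_of[of w] by (auto dest: subspace_neg)
  show ?thesis
    unfolding cob_def faces_on_def mem_Collect_eq conj_assoc two_faces_above(1)[OF assms] supp_face_of
    using two_faces_above(2)[OF assms] inc_rep_near[OF assms] inc_rep_near[OF Z mu] inc_minus[OF _ Z u]
    by (simp add: algebra_simps)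
qed

end

lemma (in hyperplane_arrangement) finite_on: "finite (faces_on A X)"
  using finite_faces by (simp add: faces_on_def)

section \<open>Faces of codimension two: the coboundary squares to zero\<close>

context incidence_arrangement
begin

text \<open>Hyperplanes that miss \<open>w\<close> are settled by \<open>w\<close> being below
  \<open>p\<close>, hyperplanes through \<open>w\<close> by the hypothesis on \<open>q\<close>. It
  is applied to the two points supplied by \<open>sector_boundary\<close>.\<close>

lemma mid_sides:
  assumes Z: "Z \<in> lat" "hsec (flat_of A w) Z" "hsec Z (flat_of A p)" and le: "pt_le A w p"
    and q: "q \<in> Z" "q \<notin> flat_of A w"
    and sgn: "\<And>H. H \<in> A \<Longrightarrow> w \<in> H \<Longrightarrow> q \<in> H \<or> hsgn H q = hsgn H p"
  shows "flat_of A (near A w q) = Z" "pt_le A w (near A w q)" "pt_le A (near A w q) p"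
proof -
  show "flat_of A (near A w q) = Z" using flat_of_near_hsec[OF Z(1,2) q] .
  show "pt_le A w (near A w q)" by (rule pt_le_near)
  show "pt_le A (near A w q) p"
    unfolding pt_le_def
  proof (intro ballI impI)
    fix H assume H: "H \<in> A" "near A w q \<notin> H"
    show "hsgn H p = hsgn H (near A w q)"
    proof (cases "w \<in> H")
      case True
      then have "q \<notin> H" using H by (simp add: near_in_hyp_iff)
      then show ?thesis using sgn[OF H(1) True] True H by (simp add: near_hsgn hsgn_0_iff)
    next
      case False
      then show ?thesis using le H by (simp add: near_hsgn hsgn_0_iff pt_le_def)
    qed
  qed
qed

text \<open>Modulo the support of \<open>w\<close> the face of \<open>p\<close> is an open sector of a plane. A line through \<open>p\<close>
  that meets both rays bounding the sector does so in the points \<open>q\<close> and \<open>q'\<close>.\<close>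

lemma sector_boundary:
  assumes le: "pt_le A w p" and Z0: "Z0 \<in> lat" "hsec (flat_of A w) Z0" "hsec Z0 (flat_of A p)"
  obtains q q' Z Z' s t where "Z \<in> lat" "hsec (flat_of A w) Z" "hsec Z (flat_of A p)" "q \<in> Z" "q \<notin> flat_of A w"
    "Z' \<in> lat" "hsec (flat_of A w) Z'" "hsec Z' (flat_of A p)" "q' \<in> Z'" "q' \<notin> flat_of A w"
    "s > 0" "t > 0" "p = s *\<^sub>R q + t *\<^sub>R q'"
    "\<forall>H\<in>A. w \<in> H \<longrightarrow> q \<in> H \<or> hsgn H q = hsgn H p"
    "\<forall>H\<in>A. w \<in> H \<longrightarrow> q' \<in> H \<or> hsgn H q' = hsgn H p"
proof -
  define W X where "W = flat_of A w" and "X = flat_of A p"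
  have XL: "X \<in> lat" and WL: "W \<in> lat" and sX: "subspace X"
    by (auto simp: W_def X_def subspace_flat_of)
  have pX: "p \<in> X" by (simp add: X_def flat_of_self)
  have WX: "W \<subseteq> X" using pt_le_flat[OF le] by (simp add: W_def X_def)
  define S where "S = {H \<in> A. w \<in> H \<and> \<not> X \<subseteq> H}"
  have finS: "finite S" using fin by (auto simp: S_def)
  have pS: "inner (normal_vector H) p \<noteq> 0" if "H \<in> S" for H
  proof -
    have "H \<in> A" "p \<notin> H" using that flat_of_subset_iff[of H p] by (auto simp: S_def X_def)
    then show ?thesis using hsgn_0_iff[of H p] by (simp add: hsgn_def sgn_0_0)
  qed
  obtain H0 where H0: "H0 \<in> A" "\<not> X \<subseteq> H0" "Z0 = X \<inter> H0" using hsec_hyp XL Z0 X_def by metis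
  obtain H1 where H1: "H1 \<in> A" "\<not> Z0 \<subseteq> H1" "W = Z0 \<inter> H1" using hsec_hyp WL Z0 W_def by metis
  have H0S: "H0 \<in> S" and H1S: "H1 \<in> S"
    using H0 H1 flat_of_self[of w] by (auto simp: S_def W_def)
  obtain a where a: "a \<in> Z0" "a \<notin> H1" using H1 by blast
  have "\<not> X \<inter> H1 \<subseteq> H0"
  proof
    assume "X \<inter> H1 \<subseteq> H0"
    then have "X \<inter> H1 \<subseteq> Z0" using H0 by blast
    moreover have "hsec (X \<inter> H1) X" using hsec_Int[OF sX H1(1)] H1S by (auto simp: S_def)
    ultimately have "X \<inter> H1 = Z0"
      using hsec_maximal[of "X \<inter> H1" X Z0] lattice_subspace[OF Z0(1)] hsec_subset[OF Z0(3)]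
      unfolding X_def by blast
    then show False using H1(2) by blast
  qed
  then obtain b where b: "b \<in> X" "b \<in> H1" "b \<notin> H0" by blast
  have aX: "a \<in> X" "a \<in> H0" using a H0 by auto
  define n where "n = (normal_vector :: 'v set \<Rightarrow> 'v)"
  have H_iff: "v \<in> H \<longleftrightarrow> inner (n H) v = 0" if "H \<in> A" for H v
    using normal(2)[OF that] n_def by blast
  \<comment> \<open>Along \<open>d\<close> the form of \<open>H0\<close> starts to shrink in
    absolute value while that of \<open>H1\<close> grows, and along \<open>- d\<close> it is the
    other way round. So the line leaves the sector in both directions, and the form that grows keeps
    each end out of the flat of \<open>w\<close>.\<close>
  define d where "d = - (inner (n H0) p / inner (n H0) b) *\<^sub>R b + (inner (n H1) p / inner (n H1) a) *\<^sub>R a"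
  have dX: "d \<in> X" using aX b sX by (auto simp: d_def intro!: subspace_add subspace_neg subspace_scale subspace_diff)
  have d0: "inner (n H0) d = - inner (n H0) p" and d1: "inner (n H1) d = inner (n H1) p"
    using a b aX H_iff H0 H1 by (auto simp: d_def inner_add_right inner_diff_right)
  have pS': "inner (n H) p \<noteq> 0" if "H \<in> S" for H using pS[OF that] n_def by simp
  have 0: "inner (n H0) p * inner (n H0) d < 0" "inner (n H1) p * inner (n H1) (- d) < 0"
    using pS'[OF H0S] pS'[OF H1S] by (auto simp: d0 d1 simp flip: power2_eq_square)
  have "\<exists>t>0. (\<exists>H\<in>S. inner (n H) (p + t *\<^sub>R d) = 0) \<and>
    (\<forall>H\<in>S. inner (n H) (p + t *\<^sub>R d) = 0 \<or> sgn (inner (n H) (p + t *\<^sub>R d)) = sgn (inner (n H) p))"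
    using first_exit[OF finS, of n p d] pS' 0 H0S by blast
  then obtain t1 where t1: "t1 > 0" "\<exists>H\<in>S. inner (n H) (p + t1 *\<^sub>R d) = 0"
    "\<forall>H\<in>S. inner (n H) (p + t1 *\<^sub>R d) = 0 \<or> sgn (inner (n H) (p + t1 *\<^sub>R d)) = sgn (inner (n H) p)"
    by blast
  have "\<exists>t>0. (\<exists>H\<in>S. inner (n H) (p + t *\<^sub>R (- d)) = 0) \<and>
    (\<forall>H\<in>S. inner (n H) (p + t *\<^sub>R (- d)) = 0 \<or> sgn (inner (n H) (p + t *\<^sub>R (- d))) = sgn (inner (n H) p))"
    using first_exit[OF finS, of n p "- d"] pS' 0 H1S by blast
  then obtain t2 where t2: "t2 > 0" "\<exists>H\<in>S. inner (n H) (p + t2 *\<^sub>R (- d)) = 0"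
    "\<forall>H\<in>S. inner (n H) (p + t2 *\<^sub>R (- d)) = 0 \<or> sgn (inner (n H) (p + t2 *\<^sub>R (- d))) = sgn (inner (n H) p)"
    by blast
  define q q' where "q = p + t1 *\<^sub>R d" and "q' = p + t2 *\<^sub>R (- d)"
  have qX: "q \<in> X" "q' \<in> X" using pX dX sX
    by (auto simp: q_def q'_def intro!: subspace_add subspace_scale subspace_neg subspace_diff)
  have sg: "v \<in> H \<or> hsgn H v = hsgn H p"
    if "H \<in> A" "w \<in> H" "v \<in> X" "\<forall>H\<in>S. inner (n H) v = 0 \<or> sgn (inner (n H) v) = sgn (inner (n H) p)" for H v
    using that H_iff[OF that(1), of v] by (cases "X \<subseteq> H") (auto simp: S_def hsgn_def n_def)
  have nW: "q \<notin> W" "q' \<notin> W"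
  proof -
    have 1: "inner (n H1) q = (1 + t1) * inner (n H1) p" by (simp add: q_def inner_add_right d1 algebra_simps)
    have "inner (n H1) q \<noteq> 0" unfolding 1 using t1(1) pS'[OF H1S] by simp
    then show "q \<notin> W" using H_iff[OF H1(1)] H1(3) by blast
    have 2: "inner (n H0) q' = (1 + t2) * inner (n H0) p" by (simp add: q'_def inner_add_right inner_diff_right d0 algebra_simps)
    have "inner (n H0) q' \<noteq> 0" unfolding 2 using t2(1) pS'[OF H0S] by simp
    moreover have "W \<subseteq> H0" using H1(3) H0(3) by blast
    ultimately show "q' \<notin> W" using H_iff[OF H0(1)] by blast
  qed
  have ex: "\<exists>Z. Z \<in> lat \<and> hsec W Z \<and> hsec Z X \<and> v \<in> Z"
    if v: "v \<in> X" and ex: "\<exists>H\<in>S. inner (n H) v = 0" for v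
  proof -
    obtain H where H: "H \<in> S" "inner (n H) v = 0" using ex by blast
    have HA: "H \<in> A" "w \<in> H" "\<not> X \<subseteq> H" "v \<in> H" using H H_iff by (auto simp: S_def)
    have "hsec (X \<inter> H) X" using hsec_Int[OF sX] HA by blast
    moreover have "W \<subseteq> X \<inter> H" using WX HA(1,2) flat_of_subset_iff W_def by blast
    ultimately have "hsec W (X \<inter> H)" using hsec_other Z0 unfolding W_def X_def by blast
    then show ?thesis using \<open>hsec (X \<inter> H) X\<close> lattice_Int[OF XL HA(1)] v HA by blast
  qed
  obtain Z where Z: "Z \<in> lat" "hsec W Z" "hsec Z X" "q \<in> Z" using ex[OF qX(1)] t1(2) q_def by blast
  obtain Z' where Z': "Z' \<in> lat" "hsec W Z'" "hsec Z' X" "q' \<in> Z'" using ex[OF qX(2)] t2(2) q'_def by blast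
  have "t2 + t1 \<noteq> 0" using t1 t2 by simp
  have "(t1 + t2) *\<^sub>R p = t2 *\<^sub>R q + t1 *\<^sub>R q'" by (simp add: q_def q'_def algebra_simps)
  then have "(1 / (t1 + t2)) *\<^sub>R (t1 + t2) *\<^sub>R p = (1 / (t1 + t2)) *\<^sub>R (t2 *\<^sub>R q + t1 *\<^sub>R q')" by simp
  then have peq: "p = (t2 / (t1 + t2)) *\<^sub>R q + (t1 / (t1 + t2)) *\<^sub>R q'" using t1 t2
    by (simp add: scaleR_add_right)
  have g1: "\<forall>H\<in>A. w \<in> H \<longrightarrow> q \<in> H \<or> hsgn H q = hsgn H p"
    using sg[OF _ _ qX(1)] t1(3) unfolding q_def by blast
  have g2: "\<forall>H\<in>A. w \<in> H \<longrightarrow> q' \<in> H \<or> hsgn H q' = hsgn H p"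
    using sg[OF _ _ qX(2)] t2(3) unfolding q'_def by blast
  have pos: "t2 / (t1 + t2) > 0" "t1 / (t1 + t2) > 0" using t1(1) t2(1) by simp_all
  show thesis
    by (rule that[OF Z(1) Z(2,3)[unfolded W_def X_def] Z(4) nW(1)[unfolded W_def]
      Z'(1) Z'(2,3)[unfolded W_def X_def] Z'(4) nW(2)[unfolded W_def] pos peq g1 g2])
qed

text \<open>Exactly two faces lie between those of \<open>w\<close> and \<open>p\<close>, the two
  sides of the sector. They attach the directions \<open>q\<close> and \<open>q'\<close> in opposite
  orders, so their terms cancel.\<close>

lemma diamond:
  assumes le: "pt_le A w p" and Z0: "Z0 \<in> lat" "hsec (flat_of A w) Z0" "hsec Z0 (flat_of A p)"
  shows "(\<Sum>z\<in>{z \<in> faces A. supp A z \<in> mid A (flat_of A w) (flat_of A p) \<and> face_le A (face_of A w) z \<and>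
     face_le A z (face_of A p)}.
     I (flat_of A w) (supp A z) (rep z) * I (supp A z) (flat_of A p) (rep (face_of A p))) = 0"
proof -
  obtain q q' Z Z' s t where
    Z: "Z \<in> lat" "hsec (flat_of A w) Z" "hsec Z (flat_of A p)" and q: "q \<in> Z" "q \<notin> flat_of A w"
    and Z': "Z' \<in> lat" "hsec (flat_of A w) Z'" "hsec Z' (flat_of A p)" and q': "q' \<in> Z'" "q' \<notin> flat_of A w"
    and st: "s > 0" "t > 0" and p: "p = s *\<^sub>R q + t *\<^sub>R q'"
    and sg0: "\<forall>H\<in>A. w \<in> H \<longrightarrow> q \<in> H \<or> hsgn H q = hsgn H p"
    and sg0': "\<forall>H\<in>A. w \<in> H \<longrightarrow> q' \<in> H \<or> hsgn H q' = hsgn H p"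
    by (rule sector_boundary[OF assms])
  note sg = sg0[THEN bspec, THEN mp] and sg' = sg0'[THEN bspec, THEN mp]
  let ?W = "flat_of A w" and ?X = "flat_of A p"
  define z z' where "z = near A w q" and "z' = near A w q'"
  have zp: "flat_of A z = Z" "pt_le A w z" "pt_le A z p"
    using mid_sides[OF Z le q sg] by (auto simp: z_def)
  have zp': "flat_of A z' = Z'" "pt_le A w z'" "pt_le A z' p"
    using mid_sides[OF Z' le q' sg'] by (auto simp: z'_def)
  have sub: "subspace Z" "subspace Z'" "subspace ?W" using Z Z' lattice_subspace subspace_flat_of by auto
  have pnot: "p \<notin> V" if "V \<in> lat" "hsec V ?X" for V
    using flat_of_subset[OF that(1), of p] hsec_subset[OF that(2)] by blast
  have qZ': "q \<notin> Z'"
  proof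
    assume "q \<in> Z'"
    then have "p \<in> Z'" using q' sub by (simp add: p subspace_add subspace_scale)
    then show False using pnot Z' by blast
  qed
  have q'Z: "q' \<notin> Z"
  proof
    assume "q' \<in> Z"
    then have "p \<in> Z" using q sub by (simp add: p subspace_add subspace_scale)
    then show False using pnot Z by blast
  qed
  have ZZ': "Z \<noteq> Z'" using qZ' q by blast
  have qX: "q \<in> ?X" "q' \<in> ?X" using q q' hsec_subset[OF Z(3)] hsec_subset[OF Z'(3)] by auto
  have ne: "face_of A z \<noteq> face_of A z'" using ZZ' zp(1) zp'(1) supp_face_of by metis
  have set_eq: "{y \<in> faces A. supp A y \<in> mid A ?W ?X \<and> face_le A (face_of A w) y \<and> face_le A y (face_of A p)}
    = {face_of A z, face_of A z'}" (is "?S = _")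
  proof (intro equalityI subsetI)
    fix y assume "y \<in> {face_of A z, face_of A z'}"
    then show "y \<in> ?S" using zp zp' Z Z' by (auto simp: mid_def)
  next
    fix y assume "y \<in> ?S"
    then obtain v where y: "y = face_of A v" and v: "pt_le A w v" "pt_le A v p"
      and V: "hsec ?W (flat_of A v)" "hsec (flat_of A v) ?X" by (auto simp: faces_eq mid_def)
    have vX: "v \<in> ?X" using hsec_subset[OF V(2)] flat_of_self[of v] by blast
    obtain c1 v1 where v1: "v1 \<in> Z" "v = c1 *\<^sub>R q' + v1" using hsec_decomp[OF Z(3) qX(2) q'Z vX] .
    obtain c2 v2 where v2: "v2 \<in> ?W" "v1 = c2 *\<^sub>R q + v2" using hsec_decomp[OF Z(2) q v1(1)] .
    have veq: "v = c1 *\<^sub>R q' + (c2 *\<^sub>R q + v2)" using v1 v2 by simp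
    have hs: "hsgn H v = 0 \<or> hsgn H v = hsgn H p" if "H \<in> A" for H
      using v(2) that by (auto simp: pt_le_def hsgn_0_iff)
    have W_sub: "?W \<subseteq> H" if "H \<in> A" "w \<in> H" for H using flat_of_subset_iff that by blast
    \<comment> \<open>A negative coefficient would put \<open>v\<close> strictly on the other side
      of the wall \<open>V0\<close> from \<open>p\<close>, although the face of \<open>v\<close>
      lies below that of \<open>p\<close>.\<close>
    have nonneg: "c \<ge> 0" if V0: "V0 \<in> lat" "hsec V0 ?X" "?W \<subseteq> V0" and u: "u \<in> ?X" "u \<notin> V0"
        and v0: "v0 \<in> V0" "v = c *\<^sub>R u + v0"
        and su: "\<And>H. H \<in> A \<Longrightarrow> w \<in> H \<Longrightarrow> u \<in> H \<or> hsgn H u = hsgn H p" for c u v0 V0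
    proof (rule ccontr)
      assume "\<not> c \<ge> 0"
      then have c: "sgn c = -1" by simp
      obtain H where H: "H \<in> A" "\<not> ?X \<subseteq> H" "V0 = ?X \<inter> H" using hsec_hyp V0 by (metis flat_in_lattice)
      have "w \<in> H" using V0(3) H flat_of_self[of w] by blast
      have "u \<notin> H" using H u by blast
      then have "hsgn H u = hsgn H p" "hsgn H u \<noteq> 0" using su H \<open>w \<in> H\<close> by (auto simp: hsgn_0_iff)
      moreover have "hsgn H v = - hsgn H u" using hsgn_lin[OF H(1), of v0 c u] v0 H c by simp
      ultimately show False using hs[OF H(1)] by auto
    qed
    have "c1 \<ge> 0"
      by (rule nonneg[OF Z(1,3) _ qX(2) q'Z v1 sg']) (use hsec_subset[OF Z(2)] in auto)
    have "c2 \<ge> 0"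
    proof (rule nonneg[OF Z'(1,3) _ qX(1) qZ' _ _ sg])
      show "?W \<subseteq> Z'" using hsec_subset[OF Z'(2)] by auto
      then show "c1 *\<^sub>R q' + v2 \<in> Z'" using v2(1) q' sub by (auto intro!: subspace_add subspace_scale)
      show "v = c2 *\<^sub>R q + (c1 *\<^sub>R q' + v2)" by (simp add: veq)
    qed
    have "v \<notin> ?W" using flat_of_subset[of ?W v] hsec_subset[OF V(1)] by auto
    then have "c1 \<noteq> 0 \<or> c2 \<noteq> 0" using veq v2(1) by auto
    \<comment> \<open>With two positive coefficients \<open>v\<close> would lie inside the sector,
      and the hyperplane that cuts out its flat would contain both \<open>q\<close> and
      \<open>q'\<close>, hence \<open>p\<close>.\<close>
    moreover have "\<not> (c1 > 0 \<and> c2 > 0)"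
    proof
      assume c: "c1 > 0 \<and> c2 > 0"
      obtain H where H: "H \<in> A" "\<not> ?X \<subseteq> H" "flat_of A v = ?X \<inter> H" using hsec_hyp V by (metis flat_in_lattice)
      have vH: "v \<in> H" using H flat_of_self[of v] by blast
      have "w \<in> H" using H hsec_subset[OF V(1)] flat_of_self[of w] by blast
      have pH: "p \<notin> H" using H flat_of_subset_iff by blast
      have v2H: "v2 \<in> H" using v2 W_sub H \<open>w \<in> H\<close> by blast
      define N where "N = normal_vector H"
      have N: "x \<in> H \<longleftrightarrow> inner N x = 0" for x using normal(2)[OF H(1)] N_def by blast
      have 0: "c1 * inner N q' + c2 * inner N q = 0" using vH v2H by (simp add: N veq inner_add_right)
      have a: "inner N q = 0 \<or> sgn (inner N q) = sgn (inner N p)" "inner N q' = 0 \<or> sgn (inner N q') = sgn (inner N p)"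
        using sg[OF H(1) \<open>w \<in> H\<close>] sg'[OF H(1) \<open>w \<in> H\<close>] by (auto simp: N hsgn_def N_def[symmetric])
      have np: "inner N p = s * inner N q + t * inner N q'" by (simp add: p inner_add_right)
      have "inner N p \<noteq> 0" using pH N by blast
      then consider "inner N p > 0" | "inner N p < 0" by linarith
      then show False
      proof cases
        case 1
        then have "inner N q \<ge> 0" "inner N q' \<ge> 0" using a by (auto simp: sgn_if split: if_splits)
        then have "inner N q = 0 \<and> inner N q' = 0" using 0 c by (metis add_nonneg_eq_0_iff mult_eq_0_iff mult_nonneg_nonneg less_imp_le less_irrefl)
        then show False using np 1 by simp
      next
        case 2
        then have "- inner N q \<ge> 0" "- inner N q' \<ge> 0" using a by (auto simp: sgn_if split: if_splits)
        moreover have "c1 * (- inner N q') + c2 * (- inner N q) = 0" using 0 by simp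
        ultimately have "- inner N q = 0 \<and> - inner N q' = 0" using c by (metis add_nonneg_eq_0_iff mult_eq_0_iff mult_nonneg_nonneg less_imp_le less_irrefl)
        then show False using np 2 by simp
      qed
    qed
    ultimately consider "c1 = 0" "c2 > 0" | "c1 > 0" "c2 = 0" using \<open>c1 \<ge> 0\<close> \<open>c2 \<ge> 0\<close> by linarith
    then show "y \<in> {face_of A z, face_of A z'}"
    proof cases
      case 1
      then have "v = c2 *\<^sub>R q + v2" using veq by simp
      then show ?thesis using face_of_above[OF Z(1,2) v(1) _ v2(1) 1(2)] y z_def by simp
    next
      case 2
      then have "v = c1 *\<^sub>R q' + v2" using veq by simp
      then show ?thesis using face_of_above[OF Z'(1,2) v(1) _ v2(1) 2(1)] y z'_def by simp
    qed
  qed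
  \<comment> \<open>\<open>p\<close> lies on the same side of \<open>V\<close> as \<open>u\<close>,
    so in the incidence number \<open>u\<close> can replace the representative of the face of
    \<open>p\<close>.\<close>
  have Ip: "I V ?X (rep (face_of A p)) = I V ?X u"
    if V: "V \<in> lat" "hsec V ?X" "u \<in> ?X" "u \<notin> V" "flat_of A x = V" "pt_le A x p"
      "p = c *\<^sub>R u + v" "v \<in> V" "c > 0" for V u x c v
  proof -
    have "I V ?X (rep (face_of A p)) = I V ?X p" using inc_rep[of ?X x p] V by simp
    also have "\<dots> = I V ?X u" using inc_side[OF V(1) _ V(2-4) V(9,8)] V(7) by simp
    finally show ?thesis .
  qed
  have "I Z ?X (rep (face_of A p)) = I Z ?X q'"
    by (rule Ip[OF Z(1,3) qX(2) q'Z zp(1,3), of t "s *\<^sub>R q"])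
      (use p q sub st in \<open>auto intro: subspace_scale\<close>)
  moreover have "I Z' ?X (rep (face_of A p)) = I Z' ?X q"
    by (rule Ip[OF Z'(1,3) qX(1) qZ' zp'(1,3), of s "t *\<^sub>R q'"])
      (use p q' sub st in \<open>auto intro: subspace_scale\<close>)
  moreover have "I ?W Z (rep (face_of A z)) = I ?W Z q" unfolding z_def by (rule inc_rep_near[OF Z(1,2) q])
  moreover have "I ?W Z' (rep (face_of A z')) = I ?W Z' q'" unfolding z'_def by (rule inc_rep_near[OF Z'(1,2) q'])
  moreover have "I ?W Z q * I Z ?X q' = - (I ?W Z' q' * I Z' ?X q)"
    by (rule inc_diamond) (use Z Z' q q' ZZ' in auto)
  ultimately show ?thesis unfolding set_eq using ne zp(1) zp'(1) by simp
qed

lemma finite_mid: "finite (mid A W X)"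
  using finite_lattice by (simp add: mid_def)

lemma face_le_trans: "face_le A w z \<Longrightarrow> face_le A z x \<Longrightarrow> w \<in> faces A \<Longrightarrow> z \<in> faces A \<Longrightarrow> x \<in> faces A \<Longrightarrow> face_le A w x"
  by (auto simp: faces_eq intro: pt_le_trans)

text \<open>\<open>diamond\<close> assumes that there is a flat in between; if there is no face in
  between, the sum is empty.\<close>

lemma diamond_faces:
  assumes "w \<in> faces A" "x \<in> faces A"
  shows "(\<Sum>z\<in>{z \<in> faces A. supp A z \<in> mid A (supp A w) (supp A x) \<and> face_le A w z \<and> face_le A z x}.
     I (supp A w) (supp A z) (rep z) * I (supp A z) (supp A x) (rep x)) = 0"
proof -
  obtain v p where v: "w = face_of A v" "x = face_of A p" using assms by (auto simp: faces_eq)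
  show ?thesis
  proof (cases "{z \<in> faces A. supp A z \<in> mid A (supp A w) (supp A x) \<and> face_le A w z \<and> face_le A z x} = {}")
    case False
    then obtain z where z: "z \<in> faces A" "supp A z \<in> mid A (supp A w) (supp A x)" "face_le A w z" "face_le A z x" by blast
    then have "face_le A w x" using face_le_trans assms by blast
    then have "pt_le A v p" using v by simp
    moreover have "supp A z \<in> lat" "hsec (flat_of A v) (supp A z)" "hsec (supp A z) (flat_of A p)"
      using z(2) v by (auto simp: mid_def)
    ultimately show ?thesis using diamond unfolding v by simp
  qed (simp only: sum.empty)
qed

text \<open>After the order of summation is exchanged, the coefficient of \<open>g x\<close> is the
  sum that \<open>diamond_faces\<close> shows to vanish.\<close>

lemma cob_cob:
  assumes "w \<in> faces A"
  shows "(\<Sum>Z\<in>mid A (supp A w) X. cob A I Z (cob A I X g) w) = 0"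
proof -
  let ?W = "supp A w"
  define M where "M = {z \<in> faces A. supp A z \<in> mid A ?W X \<and> face_le A w z}"
  define F where "F z = I ?W (supp A z) (rep z) * cob A I X g z" for z
  have finM: "finite M" using finite_faces by (simp add: M_def)
  have "(\<Sum>Z\<in>mid A ?W X. cob A I Z (cob A I X g) w) = (\<Sum>Z\<in>mid A ?W X. \<Sum>z\<in>{z\<in>M. supp A z = Z}. F z)"
    unfolding cob_def[of A I _ "cob A I X g"]
    by (intro sum.cong refl) (auto simp: faces_on_def M_def F_def)
  also have "\<dots> = (\<Sum>z\<in>M. F z)"
    by (intro sum.group) (auto simp: finM finite_mid, auto simp: M_def)
  also have "\<dots> = (\<Sum>z\<in>M. \<Sum>x\<in>{x\<in>faces_on A X. face_le A z x}. I ?W (supp A z) (rep z) * (I (supp A z) X (rep x) * g x))"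
    by (simp add: F_def cob_def sum_distrib_left)
  also have "\<dots> = (\<Sum>x\<in>faces_on A X. \<Sum>z\<in>{z\<in>M. face_le A z x}. I ?W (supp A z) (rep z) * (I (supp A z) X (rep x) * g x))"
    by (rule sum.swap_restrict[OF finM finite_on])
  also have "\<dots> = (\<Sum>x\<in>faces_on A X. 0)"
  proof (intro sum.cong refl)
    fix x assume x: "x \<in> faces_on A X"
    have "(\<Sum>z\<in>{z\<in>M. face_le A z x}. I ?W (supp A z) (rep z) * (I (supp A z) X (rep x) * g x)) =
      (\<Sum>z\<in>{z \<in> faces A. supp A z \<in> mid A ?W (supp A x) \<and> face_le A w z \<and> face_le A z x}.
        I ?W (supp A z) (rep z) * I (supp A z) (supp A x) (rep x)) * g x"
      unfolding sum_distrib_right using x by (intro sum.cong) (auto simp: M_def faces_on_def)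
    also have "\<dots> = 0" using diamond_faces[OF assms, of x] x by (simp add: faces_on_def)
    finally show "(\<Sum>z\<in>{z\<in>M. face_le A z x}. I ?W (supp A z) (rep z) * (I (supp A z) X (rep x) * g x)) = 0" .
  qed
  finally show ?thesis by simp
qed

end

section \<open>Exactness by deletion of a hyperplane\<close>

lemma incidence_system_mono: "incidence_system \<L> I \<Longrightarrow> \<M> \<subseteq> \<L> \<Longrightarrow> incidence_system \<M> I"
  unfolding incidence_system_def by (elim conjE, intro conjI) (meson subsetD)+

context incidence_arrangement
begin

lemma face_eq_near:
  assumes Z: "Z \<in> lat" "hsec (flat_of A w) Z" and z: "pt_le A w z"
  shows "face_of A z = face_of A (near A w z)"
  using face_of_above[OF Z z, of 1 z 0] subspace_0[OF subspace_flat_of[of w]] by simp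

text \<open>Incidence numbers are invertible, so a vanishing coboundary at \<open>w\<close> means
  equal values on its two sides, and each of \<open>u\<close>, \<open>z\<close> lies on one of
  them.\<close>

lemma cob_zero_imp_eq:
  assumes Z: "Z \<in> lat" "hsec (flat_of A w) Z" and u: "u \<in> Z" "u \<notin> flat_of A w" "pt_le A w u"
    and z: "z \<in> Z" "z \<notin> flat_of A w" "pt_le A w z"
    and 0: "cob A I Z g (face_of A w) = 0"
  shows "g (face_of A u) = g (face_of A z)"
proof -
  have "I (flat_of A w) Z u \<noteq> 0" using inc_sq[OF _ Z u(1,2)] by auto
  then have "g (face_of A (near A w u)) = g (face_of A (near A w (- u)))"
    using 0 unfolding cob_two[OF Z u(1,2)] by simp
  then show ?thesis using above_cases[OF Z u(1,2) z] face_eq_near[OF Z u(3)] by auto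
qed

lemma cob_diff: "cob A I Z (\<lambda>z. f z - g z) w = cob A I Z f w - cob A I Z g w"
  by (simp add: cob_def sum_subtractf right_diff_distrib)

lemma cob_add: "cob A I Z (\<lambda>z. f z + g z) w = cob A I Z f w + cob A I Z g w"
  by (simp add: cob_def sum.distrib distrib_left)

lemma hsec_eq: "hsec Y X \<Longrightarrow> hsec Z X \<Longrightarrow> Y \<subseteq> Z \<Longrightarrow> Y = Z"
  using hsec_maximal[of Y X Z] hsec_subspace(2)[of Z X] hsec_subset[of Z X] by blast

end

section \<open>Comparing an arrangement with its deletion inside a flat\<close>

locale deletion = incidence_arrangement A I for A :: "'v::real_inner set set" and I :: "'v set \<Rightarrow> 'v set \<Rightarrow> 'v \<Rightarrow> 'k::field" +
  fixes X H :: "'v set"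
  assumes X: "X \<in> lat" and H: "H \<in> A" "\<not> X \<subseteq> H"
begin

text \<open>Deleting all hyperplanes with the same trace on \<open>X\<close> as \<open>H\<close> at once, a face inside \<open>X\<close> is
  determined by the face of \<open>A'\<close> that contains it and by its side of \<open>H\<close>.\<close>

definition A' where "A' = {K \<in> A. X \<inter> K \<noteq> X \<inter> H}"

lemma A'_subset: "A' \<subseteq> A" by (auto simp: A'_def)

lemma hyp_arr_A': "hyperplane_arrangement A'"
  using A'_subset fin hyperplane finite_subset by unfold_locales blast+

text \<open>Incidence numbers are constrained only on flats of \<open>A\<close>; through this
  inclusion the same \<open>I\<close> serves \<open>A'\<close>.\<close>

lemma lattice_A': "intersection_lattice A' \<subseteq> lat"
proof
  interpret d: hyperplane_arrangement A' by (rule hyp_arr_A')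
  fix Y assume "Y \<in> intersection_lattice A'"
  then have "Y = \<Inter>{K \<in> A'. Y \<subseteq> K}" by (rule d.lattice_closed)
  moreover have "\<Inter>{K \<in> A. Y \<subseteq> K} \<subseteq> \<Inter>{K \<in> A'. Y \<subseteq> K}" using A'_subset by blast
  ultimately have "Y = \<Inter>{K \<in> A. Y \<subseteq> K}" by blast
  then show "Y \<in> lat" by (simp add: lattice_iff)
qed

sublocale del: incidence_arrangement A' I
  using hyp_arr_A' incidence_system_mono[OF inc lattice_A']
  by (simp add: incidence_arrangement_def incidence_arrangement_axioms_def)

lemma sX: "subspace X" using X lattice_subspace by blast

lemma X': "X \<in> del.lat"
proof -
  have "{K \<in> A'. X \<subseteq> K} = {K \<in> A. X \<subseteq> K}" using H by (auto simp: A'_def)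
  then show ?thesis using X by (simp add: lattice_iff del.lattice_iff)
qed

lemma hsecH: "hsec (X \<inter> H) X" by (rule hsec_Int[OF sX H])

lemma same_trace: "K \<in> A \<Longrightarrow> K \<notin> A' \<Longrightarrow> X \<inter> K = X \<inter> H" by (simp add: A'_def)

text \<open>All deleted hyperplanes have the same trace on \<open>X\<close>, so inside
  \<open>X\<close> each of them has the same two sides as \<open>H\<close>.\<close>

lemma hsgn_deleted:
  assumes "K \<in> A" "K \<notin> A'" "u \<in> X" "v \<in> X" "hsgn H u = hsgn H v"
  shows "hsgn K u = hsgn K v"
proof -
  obtain p where p: "p \<in> X" "p \<notin> X \<inter> H" using H by blast
  obtain c h where c: "h \<in> X \<inter> H" "u = c *\<^sub>R p + h" using hsec_decomp[OF hsecH p assms(3)] .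
  obtain c' h' where c': "h' \<in> X \<inter> H" "v = c' *\<^sub>R p + h'" using hsec_decomp[OF hsecH p assms(4)] .
  have "sgn c * hsgn H p = sgn c' * hsgn H p"
    using assms(5) hsgn_lin[OF H(1), of h c p] hsgn_lin[OF H(1), of h' c' p] c c' by auto
  moreover have "hsgn H p \<noteq> 0" using p H hsgn_0_iff by auto
  ultimately have "sgn c = sgn c'" by simp
  moreover have "h \<in> K" "h' \<in> K" using same_trace[OF assms(1,2)] c(1) c'(1) by blast+
  ultimately show ?thesis using hsgn_lin[OF assms(1), of h c p] hsgn_lin[OF assms(1), of h' c' p] c c' by simp
qed

lemma face'_in_X: "v \<in> X \<Longrightarrow> u \<in> face_of A' v \<Longrightarrow> u \<in> X"
  using del.face_of_subset_flat[of v] del.flat_of_subset[OF X', of v] by blast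

lemma face_eq_iff:
  assumes "u \<in> X" "v \<in> X"
  shows "face_of A u = face_of A v \<longleftrightarrow> face_of A' u = face_of A' v \<and> hsgn H u = hsgn H v"
  unfolding face_of_eq_iff del.face_of_eq_iff using hsgn_deleted[OF _ _ assms] A'_subset H(1) by blast

lemma face'_of_face: "face_of A u = face_of A v \<Longrightarrow> face_of A' u = face_of A' v"
  unfolding face_of_eq_iff del.face_of_eq_iff using A'_subset by blast

lemma in_deleted: "K \<in> A \<Longrightarrow> K \<notin> A' \<Longrightarrow> v \<in> X \<Longrightarrow> v \<in> K \<longleftrightarrow> v \<in> H"
  using same_trace by blast

lemma flat_off: assumes "v \<in> X" "v \<notin> H" shows "flat_of A v = flat_of A' v"
proof -
  have "{K\<in>A. v \<in> K} = {K\<in>A'. v \<in> K}" using in_deleted[OF _ _ assms(1)] assms(2) A'_subset by blast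
  then show ?thesis by (simp add: flat_of_def)
qed

lemma flat_on: assumes "v \<in> X" "v \<in> H" shows "flat_of A v = flat_of A' v \<inter> H"
proof (intro equalityI subsetI)
  fix u assume "u \<in> flat_of A v"
  then show "u \<in> flat_of A' v \<inter> H" using assms H A'_subset by (auto simp: flat_of_def)
next
  fix u assume u: "u \<in> flat_of A' v \<inter> H"
  then have uX: "u \<in> X" using del.flat_of_subset[OF X' assms(1)] by blast
  show "u \<in> flat_of A v"
    unfolding mem_flat_of
  proof (intro ballI impI)
    fix K assume K: "K \<in> A" "v \<in> K"
    show "u \<in> K"
      using u uX K in_deleted[OF K(1) _ uX] del.mem_flat_of[of u v] by blast
  qed
qed

text \<open>The step lengths are chosen separately for the two arrangements, but on
  \<open>A'\<close> both lead to the signs of the product.\<close>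

lemma near': "face_of A' (near A' v u) = face_of A' (near A v u)"
  unfolding del.face_of_eq_iff using A'_subset by (auto simp: near_hsgn del.near_hsgn)

lemma pt_le_I:
  assumes "q \<in> X" "v \<in> X" "q \<in> H" "face_of A' q = face_of A' v"
  shows "pt_le A q v"
  unfolding pt_le_def
proof (intro ballI impI)
  fix K assume K: "K \<in> A" "q \<notin> K"
  then have "K \<in> A'" using in_deleted[OF K(1) _ assms(1)] assms(3) by blast
  then show "hsgn K v = hsgn K q" using assms(4) by (simp add: del.face_of_eq_iff)
qed

text \<open>The segment from \<open>v\<close> to \<open>v'\<close> meets \<open>H\<close>, and by
  convexity it does not leave their common face of \<open>A'\<close>.\<close>

lemma crossing:
  assumes "v \<in> X" "v' \<in> X" "face_of A' v = face_of A' v'" "v \<notin> H" "v' \<notin> H" "hsgn H v \<noteq> hsgn H v'"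
  obtains q where "q \<in> X" "q \<in> H" "face_of A' q = face_of A' v" "pt_le A q v" "pt_le A q v'"
proof -
  define n where "n = normal_vector H"
  have n: "x \<in> H \<longleftrightarrow> inner n x = 0" for x using normal(2)[OF H(1)] n_def by blast
  have s: "sgn (inner n v) \<noteq> sgn (inner n v')" using assms(6) by (simp add: hsgn_def n_def)
  define a b where "a = \<bar>inner n v\<bar>" and "b = \<bar>inner n v'\<bar>"
  have ab: "a > 0" "b > 0" using assms(4,5) by (auto simp: a_def b_def n)
  \<comment> \<open>A positive multiple of the crossing point, which serves as well because faces
    are cones. The weights make the two opposite values of the form cancel.\<close>
  define q where "q = b *\<^sub>R v + a *\<^sub>R v'"
  have qX: "q \<in> X" using assms(1,2) sX by (simp add: q_def subspace_add subspace_scale)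
  have *: "\<bar>y\<bar> * x + \<bar>x\<bar> * y = 0" if "sgn x \<noteq> sgn y" "x \<noteq> 0" "y \<noteq> 0" for x y :: real
    using that by (cases "x > 0"; cases "y > 0") (simp_all add: sgn_if abs_if)
  have "inner n v \<noteq> 0" "inner n v' \<noteq> 0" using assms(4,5) n[of v] n[of v'] by simp_all
  then have "inner n q = 0"
    unfolding q_def inner_add_right inner_scaleR_right a_def b_def by (rule *[OF s])
  then have qH: "q \<in> H" by (simp add: n)
  have "hsgn K q = hsgn K v" if K: "K \<in> A'" for K
  proof -
    have e: "hsgn K v = hsgn K v'" using assms(3) K by (simp add: del.face_of_eq_iff)
    define k where "k = normal_vector K"
    have e: "sgn (inner k v) = sgn (inner k v')" using e by (simp add: hsgn_def k_def)
    have "sgn (b * inner k v + a * inner k v') = sgn (inner k v)"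
    proof (cases "inner k v" "0::real" rule: linorder_cases)
      case less
      then have "inner k v' < 0" using e by (simp add: sgn_if split: if_splits)
      then have "b * inner k v + a * inner k v' < 0" using less ab by (simp add: add_neg_neg mult_pos_neg)
      then show ?thesis using less by simp
    next
      case equal
      then show ?thesis using e by (simp add: sgn_if split: if_splits)
    next
      case greater
      then have "inner k v' > 0" using e by (simp add: sgn_if split: if_splits)
      then have "b * inner k v + a * inner k v' > 0" using greater ab by (simp add: add_pos_pos)
      then show ?thesis using greater by simp
    qed
    then show ?thesis by (simp add: hsgn_def k_def q_def inner_add_right)
  qed
  then have f: "face_of A' q = face_of A' v" by (simp add: del.face_of_eq_iff)
  show thesis
    by (rule that[OF qX qH f pt_le_I[OF qX assms(1) qH f] pt_le_I[OF qX assms(2) qH]]) (simp add: f assms(3))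
qed

text \<open>A small step out of \<open>H\<close> inside the flat of \<open>A'\<close> does not
  change the face of \<open>A'\<close>.\<close>

lemma off_point:
  assumes "v \<in> X" "\<not> flat_of A' v \<subseteq> H"
  obtains w where "w \<in> face_of A' v" "w \<notin> H" "w \<in> X"
proof (cases "v \<in> H")
  case True
  obtain u where u: "u \<in> flat_of A' v" "u \<notin> H" using assms by blast
  have "near A v u \<in> face_of A' v"
    unfolding face_of_def mem_Collect_eq
  proof
    fix K assume K: "K \<in> A'"
    then have "v \<in> K \<longrightarrow> u \<in> K" using u(1) del.mem_flat_of by blast
    then have "hsgn K v = 0 \<longrightarrow> hsgn K u = 0" by (simp add: del.hsgn_0_iff K)
    then show "hsgn K (near A v u) = hsgn K v"
      using subsetD[OF A'_subset K] by (auto simp: near_hsgn)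
  qed
  moreover have "near A v u \<notin> H" using u H by (simp add: near_in_hyp_iff)
  ultimately show thesis using that face'_in_X[OF assms(1)] by blast
next
  case False
  then show thesis using that[of v] assms(1) del.face_of_self by blast
qed

text \<open>A wall inside \<open>H\<close> would be the trace of \<open>H\<close> on
  \<open>X\<close>, and every hyperplane with that trace has been deleted.\<close>

lemma wall'_not_in_H: assumes "Z \<in> del.lat" "hsec Z X" shows "\<not> Z \<subseteq> H"
proof
  assume "Z \<subseteq> H"
  then have "Z = X \<inter> H" using hsec_eq[OF assms(2) hsecH] hsec_subset[OF assms(2)] by blast
  moreover obtain K where "K \<in> A'" "Z = X \<inter> K" using del.hsec_hyp[OF X' assms] .
  ultimately show False by (auto simp: A'_def)
qed

definition descend :: "('v set \<Rightarrow> 'k) \<Rightarrow> 'v set \<Rightarrow> 'k" where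
  "descend f x = f (face_of A (SOME v. v \<in> x \<and> v \<notin> H))"

text \<open>Parts of a face of \<open>A'\<close> on different sides of \<open>H\<close> share a face
  \<open>q\<close> inside \<open>H\<close> (\<open>crossing\<close>), so agreement across such a
  \<open>q\<close> is all that has to be checked.\<close>

lemma descend_eq:
  assumes v: "v \<in> X" "v \<notin> H"
    and well: "\<And>v' q. v' \<in> X \<Longrightarrow> v' \<notin> H \<Longrightarrow> face_of A' v = face_of A' v' \<Longrightarrow>
      q \<in> X \<Longrightarrow> q \<in> H \<Longrightarrow> face_of A' q = face_of A' v \<Longrightarrow> pt_le A q v \<Longrightarrow> pt_le A q v' \<Longrightarrow>
      f (face_of A v) = f (face_of A v')"
  shows "descend f (face_of A' v) = f (face_of A v)"
proof -
  define v' where "v' = (SOME u. u \<in> face_of A' v \<and> u \<notin> H)"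
  have "v' \<in> face_of A' v \<and> v' \<notin> H" unfolding v'_def by (rule someI[of _ v]) (simp add: v del.face_of_self)
  then have v': "v' \<in> X" "v' \<notin> H" "face_of A' v = face_of A' v'"
    using face'_in_X[OF v(1)] del.face_of_eq[of v' v] by auto
  have "f (face_of A v) = f (face_of A v')"
  proof (cases "hsgn H v = hsgn H v'")
    case True
    then have "face_of A v = face_of A v'" using face_eq_iff v v' by blast
    then show ?thesis by simp
  next
    case False
    then obtain q where "q \<in> X" "q \<in> H" "face_of A' q = face_of A' v" "pt_le A q v" "pt_le A q v'"
      by (rule crossing[OF v(1) v'(1,3) v(2) v'(2)])
    then show ?thesis using well v' by blast
  qed
  then show ?thesis by (simp add: descend_def v'_def)
qed

text \<open>The condition \<open>off\<close> keeps both neighbours of \<open>w\<close> away from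
  \<open>H\<close>, and there \<open>f'\<close> is known to agree with \<open>f\<close>.\<close>

lemma cob_lift:
  assumes Z: "Z \<in> del.lat" "Z \<subseteq> X" and w: "w \<in> X" "flat_of A' w = flat_of A w" "hsec (flat_of A w) Z"
    and off: "\<And>u. u \<in> Z \<Longrightarrow> u \<notin> flat_of A w \<Longrightarrow> near A w u \<notin> H"
    and f: "\<And>v. v \<in> X \<Longrightarrow> v \<notin> H \<Longrightarrow> flat_of A' v = Z \<Longrightarrow> f' (face_of A' v) = f (face_of A v)"
  shows "cob A' I Z f' (face_of A' w) = cob A I Z f (face_of A w)"
proof -
  obtain u where u: "u \<in> Z" "u \<notin> flat_of A w" using hsec_subset[OF w(3)] by blast
  have ZL: "Z \<in> lat" using Z lattice_A' by blast
  have sZ: "subspace Z" using ZL lattice_subspace by blast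
  have mu: "- u \<in> Z" "- u \<notin> flat_of A w"
    using u sZ subspace_flat_of[of w] by (auto dest: subspace_neg)
  have *: "f' (face_of A' (near A' w y)) = f (face_of A (near A w y))" if y: "y \<in> Z" "y \<notin> flat_of A w" for y
  proof -
    have "flat_of A' (near A' w y) = Z" using del.flat_of_near_hsec[OF Z(1), of w y] w y by simp
    then have "flat_of A' (near A w y) = Z" using near'[of w y] del.supp_face_of by metis
    moreover have "near A w y \<in> X" using near_in_subspace[OF sX w(1)] y Z(2) by blast
    ultimately show ?thesis using f off[OF y] near' by simp
  qed
  show ?thesis
    using del.cob_two[OF Z(1), of w u f'] cob_two[OF ZL w(3) u, of f] *[OF u] *[OF mu] w u by simp
qed

end

section \<open>Degree zero: functions without jumps are constant\<close>

context incidence_arrangement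
begin

lemma cob_const:
  assumes X: "X \<in> lat" and z: "z \<in> faces A" "hsec (supp A z) X"
  shows "cob A I X (\<lambda>x. c) z = 0"
proof -
  obtain w where w: "z = face_of A w" using z by (auto simp: faces_eq)
  obtain u where "u \<in> X" "u \<notin> flat_of A w" using hsec_subset[OF z(2)] w by auto
  then show ?thesis using cob_two[OF X, of w u "\<lambda>x. c"] z(2) w by simp
qed

text \<open>Only the hyperplanes that do not contain \<open>X\<close> are counted; when none is
  left, \<open>X\<close> is a single chamber without walls. \<open>I\<close> and \<open>X\<close>
  stay fixed throughout.\<close>

lemma delete_induct:
  fixes P :: "'v set set \<Rightarrow> bool"
  assumes X: "X \<in> lat"
    and base: "\<And>A. incidence_arrangement A I \<Longrightarrow> X \<in> intersection_lattice A \<Longrightarrow> \<forall>H\<in>A. X \<subseteq> H \<Longrightarrow> P A"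
    and step: "\<And>A H. deletion A I X H \<Longrightarrow> P (deletion.A' A X H) \<Longrightarrow> P A"
  shows "P A"
proof -
  have "incidence_arrangement A I \<Longrightarrow> X \<in> intersection_lattice A \<Longrightarrow> P A" for A
  proof (induction "card {H\<in>A. \<not> X \<subseteq> H}" arbitrary: A rule: less_induct)
    case (less A)
    show ?case
    proof (cases "\<forall>H\<in>A. X \<subseteq> H")
      case True
      then show ?thesis using base less.prems by blast
    next
      case False
      then obtain H where H: "H \<in> A" "\<not> X \<subseteq> H" by blast
      interpret d: deletion A I X H
        using less.prems H by (simp add: deletion_def deletion_axioms_def)
      have "{K\<in>d.A'. \<not> X \<subseteq> K} \<subset> {K\<in>A. \<not> X \<subseteq> K}" using H by (auto simp: d.A'_def)
      moreover have "finite {K\<in>A. \<not> X \<subseteq> K}" using d.fin by simp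
      ultimately have "card {K\<in>d.A'. \<not> X \<subseteq> K} < card {K\<in>A. \<not> X \<subseteq> K}" by (rule psubset_card_mono[rotated])
      then have "P d.A'" using less.hyps[of d.A'] d.del.incidence_arrangement_axioms d.X' by blast
      then show ?thesis using step d.deletion_axioms by blast
    qed
  qed
  then show ?thesis using X incidence_arrangement_axioms by blast
qed

end

context deletion
begin

lemma wall_flat:
  assumes "q \<in> X" "q \<in> H" "flat_of A' q = X"
  shows "flat_of A q = X \<inter> H"
  using flat_on[OF assms(1,2)] assms(3) by simp

lemma off_wall:
  assumes "z \<in> faces A'" "hsec (supp A' z) X"
  obtains w where "z = face_of A' w" "w \<in> X" "w \<notin> H" "flat_of A w = flat_of A' w" "hsec (flat_of A' w) X"
proof -
  obtain v where v: "z = face_of A' v" using assms by (auto simp: del.faces_eq)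
  have vX: "v \<in> X" using assms(2) v del.flat_of_self[of v] hsec_subset by fastforce
  have "\<not> flat_of A' v \<subseteq> H" using wall'_not_in_H[of "flat_of A' v"] assms(2) v by simp
  then obtain w where w: "w \<in> face_of A' v" "w \<notin> H" "w \<in> X" using off_point vX by blast
  have f: "face_of A' w = z" using del.face_of_eq[OF w(1)] v by simp
  moreover have "hsec (flat_of A' w) X" using assms(2) f del.supp_face_of[of w] by simp
  ultimately show thesis using that[of w] w flat_off[OF w(3,2)] by simp
qed

text \<open>Without a jump across the walls in \<open>H\<close>, \<open>g\<close> agrees on the two
  parts of a chamber of \<open>A'\<close> and descends. A wall of \<open>A'\<close> has a point off
  \<open>H\<close>, and at that point the coboundaries for \<open>A\<close> and \<open>A'\<close>
  coincide.\<close>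

lemma const_step:
  assumes IH: "\<And>g. (\<And>z. z \<in> faces A' \<Longrightarrow> hsec (supp A' z) X \<Longrightarrow> cob A' I X g z = 0) \<Longrightarrow>
      x' \<in> faces_on A' X \<Longrightarrow> y' \<in> faces_on A' X \<Longrightarrow> (g x' :: 'k) = g y'"
    and 0: "\<And>z. z \<in> faces A \<Longrightarrow> hsec (supp A z) X \<Longrightarrow> cob A I X g z = 0"
    and x: "x = face_of A v" "flat_of A v = X" "x' = face_of A' v"
    and y: "y = face_of A u" "flat_of A u = X" "y' = face_of A' u"
  shows "(g x :: 'k) = g y"
proof -
  have descend: "descend g (face_of A' v) = g (face_of A v)" if v: "v \<in> X" "v \<notin> H" "flat_of A' v = X" for v
  proof (rule descend_eq[OF v(1,2)])
    fix v' q
    assume v': "v' \<in> X" "v' \<notin> H" and q: "q \<in> X" "q \<in> H" "face_of A' q = face_of A' v" "pt_le A q v" "pt_le A q v'"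
    have "flat_of A' q = X" using q(3) v(3) del.supp_face_of by metis
    then have fq: "flat_of A q = X \<inter> H" using wall_flat q by blast
    show "g (face_of A v) = g (face_of A v')"
    proof (rule cob_zero_imp_eq[OF X, of q])
      show "hsec (flat_of A q) X" using fq hsecH by simp
      show "v \<notin> flat_of A q" "v' \<notin> flat_of A q" using fq v v' by simp_all
      show "cob A I X g (face_of A q) = 0" by (rule 0) (use fq hsecH in simp_all)
    qed (use v v' q in blast)+
  qed
  have on: "w \<in> X" "w \<notin> H" "flat_of A' w = X" if "flat_of A w = X" for w
  proof -
    show 1: "w \<in> X" using that flat_of_self by blast
    show 2: "w \<notin> H" using that flat_of_subset_iff H by blast
    show "flat_of A' w = X" using flat_off[OF 1 2] that by simp
  qed
  have "descend g x' = descend g y'"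
  proof (rule IH)
    show "x' \<in> faces_on A' X" "y' \<in> faces_on A' X" using on x y by (auto simp: faces_on_def)
    fix z assume z: "z \<in> faces A'" "hsec (supp A' z) X"
    then obtain w where w: "z = face_of A' w" "w \<in> X" "w \<notin> H" "flat_of A w = flat_of A' w" "hsec (flat_of A' w) X"
      by (rule off_wall)
    have "cob A' I X (descend g) (face_of A' w) = cob A I X g (face_of A w)"
    proof (rule cob_lift[OF X'])
      show "near A w u \<notin> H" for u using w(3) H by (simp add: near_in_hyp_iff)
      show "flat_of A' w = flat_of A w" "hsec (flat_of A w) X" using w z by simp_all
    qed (use w descend in blast)+
    also have "\<dots> = 0" using 0[of "face_of A w"] w z by simp
    finally show "cob A' I X (descend g) z = 0" using w by simp
  qed
  then show ?thesis using descend[OF on[OF x(2)]] descend[OF on[OF y(2)]] x y by simp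
qed

end

lemma (in incidence_arrangement) constant_of_cob_zero:
  assumes X: "X \<in> lat" and x: "x \<in> faces_on A X" and y: "y \<in> faces_on A X"
    and "\<And>z. z \<in> faces A \<Longrightarrow> hsec (supp A z) X \<Longrightarrow> cob A I X g z = 0"
  shows "g x = g y"
proof -
  let ?P = "\<lambda>A. \<forall>g x y. x \<in> faces_on A X \<longrightarrow> y \<in> faces_on A X \<longrightarrow>
    (\<forall>z\<in>faces A. hsec (supp A z) X \<longrightarrow> cob A I X g z = 0) \<longrightarrow> (g x :: 'k) = g y"
  have "?P A"
  proof (rule delete_induct[OF X])
    fix A assume "incidence_arrangement A I" "\<forall>H\<in>A. X \<subseteq> H"
    then interpret a: incidence_arrangement A I by simp
    have "x = y" if xy: "x \<in> faces_on A X" "y \<in> faces_on A X" for x y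
    proof -
      obtain v u where vu: "x = face_of A v" "y = face_of A u" "flat_of A v = X" "flat_of A u = X"
        using xy by (auto simp: faces_on_def a.faces_eq)
      then have "v \<in> H \<and> u \<in> H" if "H \<in> A" for H
        using that \<open>\<forall>H\<in>A. X \<subseteq> H\<close> a.flat_of_self by blast
      then have "\<forall>H\<in>A. hsgn H v = 0 \<and> hsgn H u = 0" by (simp add: a.hsgn_0_iff)
      then show ?thesis by (simp add: vu a.face_of_eq_iff)
    qed
    then show "?P A" by blast
  next
    fix A H assume d: "deletion A I X H" and IH: "?P (deletion.A' A X H)"
    interpret d: deletion A I X H by (rule d)
    show "?P A"
    proof (intro allI impI)
      fix g :: "'v set \<Rightarrow> 'k" and x y
      assume xy: "x \<in> faces_on A X" "y \<in> faces_on A X"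
        and 0: "\<forall>z\<in>faces A. hsec (supp A z) X \<longrightarrow> cob A I X g z = 0"
      obtain v u where vu: "x = face_of A v" "flat_of A v = X" "y = face_of A u" "flat_of A u = X"
        using xy by (auto simp: faces_on_def d.faces_eq)
      show "g x = g y"
        by (rule d.const_step[OF _ _ vu(1,2) refl vu(3,4) refl]) (use IH 0 in blast)+
    qed
  qed
  then show ?thesis using assms by blast
qed

section \<open>Degree one: cocycles are coboundaries\<close>

context deletion
begin

text \<open>A hyperplane of \<open>A'\<close> that contains the wall \<open>X \<inter> H\<close>
  contains all of \<open>X\<close>, so crossing this wall is invisible to \<open>A'\<close>.\<close>

lemma near_in_face':
  assumes q: "q \<in> X" "q \<in> H" "flat_of A q = X \<inter> H" and u: "u \<in> X"
  shows "face_of A' (near A q u) = face_of A' q"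
  unfolding del.face_of_eq_iff
proof
  fix K assume K: "K \<in> A'"
  then have KA: "K \<in> A" using A'_subset by blast
  show "hsgn K (near A q u) = hsgn K q"
  proof (cases "q \<in> K")
    case True
    then have "X \<inter> H \<subseteq> K" using q(3) flat_of_subset_iff[OF KA] by blast
    have "X \<subseteq> K"
    proof (rule ccontr)
      assume "\<not> X \<subseteq> K"
      then have "X \<inter> H = X \<inter> K" using hsec_eq[OF hsecH hsec_Int[OF sX KA]] \<open>X \<inter> H \<subseteq> K\<close> by blast
      then show False using K by (auto simp: A'_def)
    qed
    then have "hsgn K u = 0" "hsgn K q = 0" using u q KA hsgn_0_iff by blast+
    then show ?thesis using KA by (simp add: near_hsgn)
  next
    case False
    then show ?thesis using KA by (simp add: near_hsgn hsgn_0_iff)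
  qed
qed

lemma wall_in_H:
  assumes "q \<in> X" "q \<in> H" "hsec (flat_of A q) X"
  shows "flat_of A q = X \<inter> H"
  using hsec_eq[OF assms(3) hsecH] assms flat_on flat_of_subset[OF X assms(1)] by blast

text \<open>A chamber on the positive side of \<open>H\<close> has at most one wall with support
  \<open>X \<inter> H\<close>, so its value can be chosen to produce the required jump there; on the
  other side \<open>g\<close> is zero.\<close>

lemma kill_walls: "\<exists>g. \<forall>z\<in>faces A. supp A z = X \<inter> H \<longrightarrow> cob A I X g z = f z"
proof -
  \<comment> \<open>If \<open>H\<close> misses the face of \<open>A'\<close> around the chamber, the
    inner choice is arbitrary, but then no wall of the chamber has support
    \<open>X \<inter> H\<close>. The factor \<open>I\<close> meets a second one in the coboundary
    and squares to 1.\<close>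
  define g where "g x = (if hsgn H (rep x) > 0 then I (X \<inter> H) X (rep x) *
     f (face_of A (SOME q. q \<in> H \<and> q \<in> face_of A' (rep x))) else 0)" for x
  have "cob A I X g z = f z" if z: "z \<in> faces A" "supp A z = X \<inter> H" for z
  proof -
    obtain q where q: "z = face_of A q" using z by (auto simp: faces_eq)
    have fq: "flat_of A q = X \<inter> H" using z q by simp
    have qX: "q \<in> X" "q \<in> H" using fq flat_of_self[of q] by blast+
    obtain u0 where u0: "u0 \<in> X" "u0 \<notin> H" using H by blast
    define u where "u = (if hsgn H u0 > 0 then u0 else - u0)"
    have u: "u \<in> X" "hsgn H u > 0"
      using u0 sX hsgn_values[of H u0] hsgn_0_iff[OF H(1), of u0]
      by (auto simp: u_def hsgn_minus subspace_neg)
    have uW: "u \<notin> flat_of A q" using u(2) fq hsgn_0_iff[OF H(1), of u] by auto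
    have mu: "- u \<in> X" "- u \<notin> flat_of A q"
      using u uW sX subspace_flat_of[of q] by (auto dest: subspace_neg)
    have hs: "hsec (flat_of A q) X" using hsecH fq by simp
    define x y where "x = face_of A (near A q u)" and "y = face_of A (near A q (- u))"
    have hr: "hsgn H (rep (face_of A v)) = hsgn H v" for v
      using rep_face_of[of v] H(1) by (simp add: face_of_def)
    have hx: "hsgn H (rep x) > 0" "\<not> hsgn H (rep y) > 0"
      using u(2) H(1) qX hsgn_0_iff[OF H(1), of q] by (simp_all add: x_def y_def hr near_hsgn hsgn_minus)
    have gy: "g y = 0" using hx by (simp add: g_def)
    have "face_of A' (rep x) = face_of A' (near A q u)"
      by (rule face'_of_face) (simp add: x_def rep_face)
    then have fx: "face_of A' (rep x) = face_of A' q" using near_in_face'[OF qX fq u(1)] by simp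
    have "(SOME q. q \<in> H \<and> q \<in> face_of A' (rep x)) \<in> H \<and> (SOME q. q \<in> H \<and> q \<in> face_of A' (rep x)) \<in> face_of A' (rep x)"
      by (rule someI[of _ q]) (simp add: fx qX del.face_of_self)
    then obtain q' where q': "q' = (SOME q. q \<in> H \<and> q \<in> face_of A' (rep x))" "q' \<in> H" "q' \<in> face_of A' q"
      using fx by simp
    have q'X: "q' \<in> X" using face'_in_X qX q' by blast
    have "hsgn H q' = hsgn H q"
      using hsgn_0_iff[OF H(1), of q] hsgn_0_iff[OF H(1), of q'] qX(2) q'(2) by simp
    then have "face_of A q' = face_of A q"
      using face_eq_iff[OF q'X qX(1)] del.face_of_eq[OF q'(3)] by blast
    then have gx: "g x = I (X \<inter> H) X (rep x) * f z" using hx q'(1) q by (simp add: g_def)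
    have "I (X \<inter> H) X (rep x) = I (X \<inter> H) X u" using inc_rep_near[OF X hs u(1) uW] fq by (simp add: x_def)
    then have "cob A I X g z = (I (X \<inter> H) X u * I (X \<inter> H) X u) * f z"
      using cob_two[OF X hs u(1) uW, of g] gx gy fq q by (simp add: x_def[symmetric] y_def[symmetric])
    also have "\<dots> = f z" using inc_sq[OF flat_in_lattice X hs u(1) uW] fq by simp
    finally show ?thesis .
  qed
  then show ?thesis by blast
qed

lemma mid_cases:
  assumes "Z \<in> mid A W X"
  shows "Z = X \<inter> H \<or> Z \<in> del.lat"
proof -
  have Z: "Z \<in> lat" "hsec Z X" using assms by (auto simp: mid_def)
  obtain K where K: "K \<in> A" "Z = X \<inter> K" using hsec_hyp[OF X Z] by blast
  show ?thesis
  proof (cases "K \<in> A'")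
    case True
    then show ?thesis using del.lattice_Int[OF X'] K by blast
  next
    case False
    then show ?thesis using same_trace K by blast
  qed
qed

text \<open>Let \<open>H\<close> cut a wall of \<open>A'\<close> along \<open>q\<close>. The only
  flats between \<open>q\<close> and \<open>X\<close> are the flat of this wall and
  \<open>X \<inter> H\<close>, and the latter contributes nothing because \<open>f\<close> vanishes
  there. So the cocycle condition at \<open>q\<close> concerns a single flat and says that
  \<open>f\<close> does not jump across \<open>q\<close>.\<close>

lemma cocycle_step:
  fixes f :: "'v set \<Rightarrow> 'k"
  assumes IH: "\<And>f. (\<And>w. w \<in> faces A' \<Longrightarrow> (\<Sum>Z\<in>mid A' (supp A' w) X. cob A' I Z f w) = 0) \<Longrightarrow>
      \<exists>g. \<forall>z\<in>faces A'. hsec (supp A' z) X \<longrightarrow> cob A' I X g z = (f z :: 'k)"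
    and f: "\<And>w. w \<in> faces A \<Longrightarrow> (\<Sum>Z\<in>mid A (supp A w) X. cob A I Z f w) = 0"
    and vanish: "\<And>z. z \<in> faces A \<Longrightarrow> supp A z = X \<inter> H \<Longrightarrow> f z = 0"
  shows "\<exists>g. \<forall>z\<in>faces A. hsec (supp A z) X \<longrightarrow> cob A I X g z = f z"
proof -
  have cobH: "cob A I (X \<inter> H) f w = 0" for w
    unfolding cob_def by (rule sum.neutral) (use vanish in \<open>auto simp: faces_on_def\<close>)
  have well: "descend f (face_of A' v) = f (face_of A v)"
    if v: "v \<in> X" "v \<notin> H" "hsec (flat_of A' v) X" for v
  proof (rule descend_eq[OF v(1,2)])
    fix v' q
    assume v': "v' \<in> X" "v' \<notin> H" "face_of A' v = face_of A' v'"
      and q: "q \<in> X" "q \<in> H" "face_of A' q = face_of A' v" "pt_le A q v" "pt_le A q v'"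
    let ?Z = "flat_of A' v"
    have Z: "?Z \<in> del.lat" "?Z \<in> lat" using lattice_A' by auto
    have fq': "flat_of A' q = ?Z" using q(3) del.supp_face_of by metis
    then have fq: "flat_of A q = ?Z \<inter> H" using flat_on q by blast
    have vZ: "v \<in> ?Z" "v' \<in> ?Z" using v'(3) del.flat_of_self del.supp_face_of by metis+
    have "\<not> ?Z \<subseteq> H" using v(2) vZ by blast
    then have hs: "hsec (flat_of A q) ?Z" unfolding fq using hsec_Int[OF lattice_subspace[OF Z(2)] H(1)] by blast
    have "Z = ?Z \<or> Z = X \<inter> H" if "Z \<in> mid A (flat_of A q) X" for Z
    proof (cases "Z = X \<inter> H")
      case False
      then have ZL: "Z \<in> del.lat" "hsec Z X" "hsec (flat_of A q) Z" using mid_cases that by (auto simp: mid_def)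
      have "q \<in> Z" using hsec_subset[OF ZL(3)] flat_of_self[of q] by blast
      then have "?Z \<subseteq> Z" using del.flat_of_subset[OF ZL(1)] fq' by metis
      then show ?thesis using hsec_eq[OF v(3) ZL(2)] by blast
    qed simp
    then have sub: "\<forall>Z\<in>mid A (flat_of A q) X - {?Z}. cob A I Z f (face_of A q) = 0"
      using cobH by blast
    have "?Z \<in> mid A (flat_of A q) X" using Z hs v(3) by (simp add: mid_def)
    then have "cob A I ?Z f (face_of A q) = (\<Sum>Z\<in>mid A (flat_of A q) X. cob A I Z f (face_of A q))"
      using sum.neutral[OF sub]
      by (subst sum.remove[OF finite_mid[of "flat_of A q" X], of ?Z]) simp_all
    also have "\<dots> = 0" using f[of "face_of A q"] by simp
    finally show "f (face_of A v) = f (face_of A v')"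
    proof (rule cob_zero_imp_eq[OF Z(2) hs, rotated -1])
      show "v \<notin> flat_of A q" "v' \<notin> flat_of A q" using fq v v' by simp_all
    qed (use vZ q in blast)+
  qed
  have "\<exists>g. \<forall>z\<in>faces A'. hsec (supp A' z) X \<longrightarrow> cob A' I X g z = descend f z"
  proof (rule IH)
    fix w' assume w': "w' \<in> faces A'"
    let ?W = "supp A' w'"
    show "(\<Sum>Z\<in>mid A' ?W X. cob A' I Z (descend f) w') = 0"
    proof (cases "mid A' ?W X = {}")
      case True
      then show ?thesis by simp
    next
      case False
      then obtain Z where "hsec ?W Z" "hsec Z X" by (auto simp: mid_def)
      then have WX: "?W \<subseteq> X" using hsec_subset by blast
      obtain w0 where w0: "w' = face_of A' w0" using w' by (auto simp: del.faces_eq)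
      have w0X: "w0 \<in> X" using WX w0 del.flat_of_self[of w0] by auto
      \<comment> \<open>The point is taken off \<open>H\<close> whenever possible, so that its flats
        for \<open>A\<close> and \<open>A'\<close> agree; if its whole flat lies in
        \<open>H\<close>, they agree anyway.\<close>
      have "\<exists>w. w' = face_of A' w \<and> w \<in> X \<and> (w \<notin> H \<or> ?W \<subseteq> H)"
      proof (cases "?W \<subseteq> H")
        case False
        then obtain w where "w \<in> face_of A' w0" "w \<notin> H" "w \<in> X" using off_point[OF w0X] w0 by auto
        then show ?thesis using w0 del.face_of_eq by blast
      qed (use w0 w0X in blast)
      then obtain w where w: "w' = face_of A' w" "w \<in> X" "w \<notin> H \<or> ?W \<subseteq> H" by blast
      have W': "?W = flat_of A' w" using w(1) by simp
      have W: "flat_of A w = flat_of A' w"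
      proof (cases "w \<in> H")
        case True
        then show ?thesis using flat_on[OF w(2) True] w(3) W' by auto
      qed (use flat_off w in blast)
      have lift: "cob A' I Z (descend f) w' = cob A I Z f (face_of A w)" if Z: "Z \<in> mid A' ?W X" for Z
        unfolding w(1)
      proof (rule cob_lift)
        have m: "Z \<in> del.lat" "hsec ?W Z" "hsec Z X" using Z by (auto simp: mid_def)
        show "Z \<in> del.lat" "Z \<subseteq> X" using m hsec_subset by blast+
        show "w \<in> X" "flat_of A' w = flat_of A w" using w W by auto
        show "hsec (flat_of A w) Z" using m W W' by simp
        show "descend f (face_of A' v) = f (face_of A v)" if "v \<in> X" "v \<notin> H" "flat_of A' v = Z" for v
          by (rule well) (use that m in simp_all)
        show "near A w u \<notin> H" if u: "u \<in> Z" "u \<notin> flat_of A w" for u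
        proof (cases "w \<in> H")
          case True
          then have "?W \<subseteq> H" using w(3) by blast
          moreover have "\<not> Z \<subseteq> H" using wall'_not_in_H m by blast
          ultimately have "?W = Z \<inter> H"
            using hsec_eq[OF m(2) hsec_Int[OF _ H(1)]] hsec_subset[OF m(2)] hsec_subspace(2)[OF m(3)] by blast
          then show ?thesis using u W W' H by (auto simp: near_in_hyp_iff)
        qed (use H in \<open>simp add: near_in_hyp_iff\<close>)
      qed
      have "(\<Sum>Z\<in>mid A' ?W X. cob A' I Z (descend f) w') = (\<Sum>Z\<in>mid A' ?W X. cob A I Z f (face_of A w))"
        by (intro sum.cong refl lift)
      also have "\<dots> = (\<Sum>Z\<in>mid A ?W X. cob A I Z f (face_of A w))"
      proof (rule sum.mono_neutral_left[OF finite_mid])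
        show "mid A' ?W X \<subseteq> mid A ?W X" using lattice_A' by (auto simp: mid_def)
        show "\<forall>Z\<in>mid A ?W X - mid A' ?W X. cob A I Z f (face_of A w) = 0"
        proof
          fix Z assume Z: "Z \<in> mid A ?W X - mid A' ?W X"
          then have "Z = X \<inter> H" using mid_cases[of Z ?W] by (auto simp: mid_def)
          then show "cob A I Z f (face_of A w) = 0" using cobH by simp
        qed
      qed
      also have "\<dots> = 0" using f[of "face_of A w"] W W' by simp
      finally show ?thesis .
    qed
  qed
  then obtain g where g: "\<And>z. z \<in> faces A' \<Longrightarrow> hsec (supp A' z) X \<Longrightarrow> cob A' I X g z = descend f z" by blast
  \<comment> \<open>Pulled back to \<open>A\<close>, \<open>g\<close> has the same value on both
    sides of a wall inside \<open>H\<close>, so its coboundary is 0 there, as is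
    \<open>f\<close>.\<close>
  define h where "h x = g (face_of A' (rep x))" for x
  have h: "h (face_of A v) = g (face_of A' v)" for v
    using face'_of_face[of "rep (face_of A v)" v] rep_face by (simp add: h_def)
  have "cob A I X h z = f z" if z: "z \<in> faces A" "hsec (supp A z) X" for z
  proof -
    obtain p where p: "z = face_of A p" using z by (auto simp: faces_eq)
    have hs: "hsec (flat_of A p) X" using z p by simp
    have pX: "p \<in> X" using hsec_subset[OF hs] flat_of_self[of p] by blast
    obtain u where u: "u \<in> X" "u \<notin> flat_of A p" using hsec_subset[OF hs] by blast
    have mu: "- u \<in> X" using u sX subspace_neg by blast
    show ?thesis
    proof (cases "p \<in> H")
      case True
      then have fp: "flat_of A p = X \<inter> H" using wall_in_H pX hs by blast
      have "cob A I X h z = 0"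
        unfolding p cob_two[OF X hs u] h using near_in_face'[OF pX True fp] u(1) mu by simp
      then show ?thesis using vanish[OF z(1)] p fp by simp
    next
      case False
      then have e: "flat_of A p = flat_of A' p" using flat_off pX by blast
      have hs': "hsec (flat_of A' p) X" using hs e by simp
      have u': "u \<notin> flat_of A' p" using u e by simp
      have "cob A I X h z = cob A' I X g (face_of A' p)"
        unfolding p cob_two[OF X hs u] h del.cob_two[OF X' hs' u(1) u'] near' e ..
      also have "\<dots> = descend f (face_of A' p)" using g hs' by simp
      also have "\<dots> = f z" using well[OF pX False hs'] p by simp
      finally show ?thesis .
    qed
  qed
  then show ?thesis by blast
qed

lemma cocycle_step':
  fixes f :: "'v set \<Rightarrow> 'k"
  assumes IH: "\<And>f. (\<And>w. w \<in> faces A' \<Longrightarrow> (\<Sum>Z\<in>mid A' (supp A' w) X. cob A' I Z f w) = 0) \<Longrightarrow>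
      \<exists>g. \<forall>z\<in>faces A'. hsec (supp A' z) X \<longrightarrow> cob A' I X g z = (f z :: 'k)"
    and f: "\<And>w. w \<in> faces A \<Longrightarrow> (\<Sum>Z\<in>mid A (supp A w) X. cob A I Z f w) = 0"
  shows "\<exists>g. \<forall>z\<in>faces A. hsec (supp A z) X \<longrightarrow> cob A I X g z = f z"
proof -
  obtain g1 where g1: "\<And>z. z \<in> faces A \<Longrightarrow> supp A z = X \<inter> H \<Longrightarrow> cob A I X g1 z = f z"
    using kill_walls by blast
  have "\<exists>g. \<forall>z\<in>faces A. hsec (supp A z) X \<longrightarrow> cob A I X g z = f z - cob A I X g1 z"
  proof (rule cocycle_step[OF IH])
    fix w assume w: "w \<in> faces A"
    show "(\<Sum>Z\<in>mid A (supp A w) X. cob A I Z (\<lambda>z. f z - cob A I X g1 z) w) = 0"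
      unfolding cob_diff sum_subtractf using f[OF w] cob_cob[OF w] by simp
  qed (simp_all add: g1)
  then obtain g where "\<forall>z\<in>faces A. hsec (supp A z) X \<longrightarrow> cob A I X g z = f z - cob A I X g1 z" by blast
  then have "\<forall>z\<in>faces A. hsec (supp A z) X \<longrightarrow> cob A I X (\<lambda>x. g x + g1 x) z = f z"
    unfolding cob_add by simp
  then show ?thesis by blast
qed

end

lemma (in incidence_arrangement) coboundary_of_cocycle:
  assumes X: "X \<in> lat"
    and f: "\<And>w. w \<in> faces A \<Longrightarrow> (\<Sum>Z\<in>mid A (supp A w) X. cob A I Z f w) = 0"
  shows "\<exists>g. \<forall>z\<in>faces A. hsec (supp A z) X \<longrightarrow> cob A I X g z = f z"
proof -
  let ?P = "\<lambda>A. \<forall>f. (\<forall>w\<in>faces A. (\<Sum>Z\<in>mid A (supp A w) X. cob A I Z f w) = 0) \<longrightarrow>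
     (\<exists>g. \<forall>z\<in>faces A. hsec (supp A z) X \<longrightarrow> cob A I X g z = f z)"
  have "?P A"
  proof (rule delete_induct[OF X])
    fix A assume "incidence_arrangement A I" "\<forall>H\<in>A. X \<subseteq> H"
    then interpret a: incidence_arrangement A I by simp
    have "\<not> hsec (supp A z) X" if "z \<in> faces A" for z
    proof -
      have "X \<subseteq> supp A z" using \<open>\<forall>H\<in>A. X \<subseteq> H\<close> by (auto simp: supp_def)
      then show ?thesis using hsec_subset by blast
    qed
    then show "?P A" by blast
  next
    fix A H assume d: "deletion A I X H" and IH: "?P (deletion.A' A X H)"
    interpret d: deletion A I X H by (rule d)
    show "?P A" using d.cocycle_step' IH by blast
  qed
  then show ?thesis using f by blast
qed

section \<open>Finite-dimensional algebras with a multiplicative basis\<close>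

definition smul :: "'k::field \<Rightarrow> ('b \<Rightarrow> 'k) \<Rightarrow> 'b \<Rightarrow> 'k" where
  "smul c f = (\<lambda>b. c * f b)"

text \<open>Summing over \<open>B\<close> instead of the supports of the factors makes the product
  bilinear for arbitrary functions; on the carrier it is the product of the algebra
  (\<open>mult_R\<close>).\<close>

definition bprod :: "'b set \<Rightarrow> ('b \<Rightarrow> 'b \<Rightarrow> 'b option) \<Rightarrow> ('b \<Rightarrow> 'k::field) \<Rightarrow> ('b \<Rightarrow> 'k) \<Rightarrow> 'b \<Rightarrow> 'k" where
  "bprod B m f g = (\<lambda>c. \<Sum>a\<in>B. \<Sum>b\<in>B. if m a b = Some c then f a * g b else 0)"

section \<open>Linear structure on functions and the bilinear product\<close>

lemma sum_fun_apply: "(\<Sum>i\<in>S. f i) x = (\<Sum>i\<in>S. f i x)"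
  by (induction S rule: infinite_finite_induct) auto

lemma smul_apply: "smul c f x = c * f x" by (simp add: smul_def)

lemma smul_0[simp]: "smul c 0 = 0" "smul 0 f = 0" by (auto simp: smul_def)

lemma smul_1[simp]: "smul 1 f = f" by (simp add: smul_def)

lemma smul_smul[simp]: "smul a (smul b f) = smul (a * b) f" by (auto simp: smul_def)

lemma smul_add: "smul c (f + g) = smul c f + smul c g" by (auto simp: smul_def algebra_simps)

lemma smul_add_left: "smul (c + d) f = smul c f + smul d f" by (auto simp: smul_def algebra_simps)

lemma smul_diff: "smul c (f - g) = smul c f - smul c g" by (auto simp: smul_def algebra_simps)

lemma smul_minus: "smul c (- f) = - smul c f" "smul (- c) f = - smul c f" by (auto simp: smul_def)

lemma smul_sum: "smul c (\<Sum>i\<in>S. f i) = (\<Sum>i\<in>S. smul c (f i))"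
  by (auto simp: smul_def sum_fun_apply sum_distrib_left)

lemma smul_sum_left: "smul (\<Sum>i\<in>S. c i) f = (\<Sum>i\<in>S. smul (c i) f)"
  by (auto simp: smul_def sum_fun_apply sum_distrib_right)

lemma bprod_add_left: "bprod B m (f + g) h = bprod B m f h + bprod B m g h"
  by (rule ext, simp only: bprod_def plus_fun_apply sum.distrib[symmetric])
    (auto simp: algebra_simps intro!: sum.cong)

lemma bprod_add_right: "bprod B m f (g + h) = bprod B m f g + bprod B m f h"
  by (rule ext, simp only: bprod_def plus_fun_apply sum.distrib[symmetric])
    (auto simp: algebra_simps intro!: sum.cong)

lemma bprod_0[simp]: "bprod B m 0 f = 0" "bprod B m f 0 = 0"
  by (auto simp: bprod_def cong: if_cong)

lemma bprod_minus_left: "bprod B m (- f) h = - bprod B m f h"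
  by (rule ext, simp only: bprod_def uminus_apply sum_negf[symmetric]) (auto intro!: sum.cong)

lemma bprod_minus_right: "bprod B m f (- h) = - bprod B m f h"
  by (rule ext, simp only: bprod_def uminus_apply sum_negf[symmetric]) (auto intro!: sum.cong)

lemma bprod_diff_left: "bprod B m (f - g) h = bprod B m f h - bprod B m g h"
  using bprod_add_left[of B m f "- g" h] by (simp add: bprod_minus_left)

lemma bprod_diff_right: "bprod B m f (g - h) = bprod B m f g - bprod B m f h"
  using bprod_add_right[of B m f g "- h"] by (simp add: bprod_minus_right)

lemma bprod_smul_left: "bprod B m (smul c f) g = smul c (bprod B m f g)"
  by (auto simp: bprod_def smul_def sum_distrib_left intro!: sum.cong)

lemma bprod_smul_right: "bprod B m f (smul c g) = smul c (bprod B m f g)"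
  by (auto simp: bprod_def smul_def sum_distrib_left intro!: sum.cong)

lemma bprod_sum_left: "bprod B m (\<Sum>i\<in>S. f i) g = (\<Sum>i\<in>S. bprod B m (f i) g)"
proof (induction S rule: infinite_finite_induct)
  case (infinite S)
  then show ?case by (simp only: sum.infinite[OF infinite] bprod_0)
next
  case empty
  show ?case by (simp only: sum.empty bprod_0)
next
  case (insert x S)
  then show ?case by (simp only: sum.insert[OF insert(1,2)] bprod_add_left)
qed

lemma bprod_sum_right: "bprod B m f (\<Sum>i\<in>S. g i) = (\<Sum>i\<in>S. bprod B m f (g i))"
proof (induction S rule: infinite_finite_induct)
  case (infinite S)
  then show ?case by (simp only: sum.infinite[OF infinite] bprod_0)
next
  case empty
  show ?case by (simp only: sum.empty bprod_0)
next
  case (insert x S)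
  then show ?case by (simp only: sum.insert[OF insert(1,2)] bprod_add_right)
qed

lemma basis_expansion:
  assumes "finite B" "\<And>b. f b \<noteq> 0 \<Longrightarrow> b \<in> B"
  shows "f = (\<Sum>b\<in>B. smul (f b) (basis_elem b))"
proof
  fix x
  have "(\<Sum>b\<in>B. smul (f b) (basis_elem b)) x = (\<Sum>b\<in>B. if x = b then f b else 0)"
    by (auto simp: sum_fun_apply smul_apply basis_elem_def intro!: sum.cong)
  also have "\<dots> = (if x \<in> B then f x else 0)" using assms(1) by simp
  also have "\<dots> = f x" using assms(2)[of x] by auto
  finally show "f x = (\<Sum>b\<in>B. smul (f b) (basis_elem b)) x" by simp
qed

lemma linear_extension_eq:
  assumes "finite B" "\<And>b. f b \<noteq> 0 \<Longrightarrow> b \<in> B"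
  shows "linear_extension g f = (\<Sum>b\<in>B. smul (f b) (g b))"
proof
  fix x
  have "(\<Sum>b\<in>{b. f b \<noteq> 0}. f b * g b x) = (\<Sum>b\<in>B. f b * g b x)"
    by (rule sum.mono_neutral_left) (use assms in auto)
  then show "linear_extension g f x = (\<Sum>b\<in>B. smul (f b) (g b)) x"
    by (simp add: linear_extension_def sum_fun_apply smul_apply)
qed

text \<open>Products of basis elements may be undefined, and the unit is a sum of local units. This
  covers both the semigroup algebra, with one unit, and the path algebra, with one local unit for
  each vertex.\<close>

locale finite_basis_algebra =
  fixes B :: "'b set" and m :: "'b \<Rightarrow> 'b \<Rightarrow> 'b option" and U :: "'b set"
  assumes finB: "finite B"
    and closed: "\<And>a b c. a \<in> B \<Longrightarrow> b \<in> B \<Longrightarrow> m a b = Some c \<Longrightarrow> c \<in> B"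
    and assoc: "\<And>a b c. a \<in> B \<Longrightarrow> b \<in> B \<Longrightarrow> c \<in> B \<Longrightarrow>
      Option.bind (m a b) (\<lambda>d. m d c) = Option.bind (m b c) (m a)"
    and U: "U \<subseteq> B"
    and unit_left: "\<And>b. b \<in> B \<Longrightarrow> \<exists>u\<in>U. m u b = Some b \<and> (\<forall>u'\<in>U. u' \<noteq> u \<longrightarrow> m u' b = None)"
    and unit_right: "\<And>b. b \<in> B \<Longrightarrow> \<exists>u\<in>U. m b u = Some b \<and> (\<forall>u'\<in>U. u' \<noteq> u \<longrightarrow> m b u' = None)"
begin

abbreviation R :: "('k::field, 'b \<Rightarrow> 'k) module" where "R \<equiv> basis_algebra B m U"

lemma carrier_R: "f \<in> carrier R \<longleftrightarrow> (\<forall>b. f b \<noteq> 0 \<longrightarrow> b \<in> B)"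
  using finB by (auto simp: basis_algebra_def intro: finite_subset[of _ B])

lemma bprod_closed: "bprod B m f g \<in> carrier R"
proof -
  have "c \<in> B" if "bprod B m f g c \<noteq> 0" for c
  proof -
    have nz: "bprod B m f g c \<noteq> 0" by (fact that)
    obtain a where a: "a \<in> B" "(\<Sum>b\<in>B. if m a b = Some c then f a * g b else 0) \<noteq> 0"
      by (rule sum.not_neutral_contains_not_neutral[OF nz[unfolded bprod_def]])
    obtain b where "b \<in> B" "(if m a b = Some c then f a * g b else 0) \<noteq> 0"
      by (rule sum.not_neutral_contains_not_neutral[OF a(2)])
    then show ?thesis using closed[OF a(1)] by (auto split: if_splits)
  qed
  then show ?thesis by (simp add: carrier_R)
qed

lemma mult_R:
  assumes "f \<in> carrier R" "g \<in> carrier R"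
  shows "f \<otimes>\<^bsub>R\<^esub> g = bprod B m f g"
proof
  fix c
  have fB: "{a. f a \<noteq> 0} \<subseteq> B" and gB: "{b. g b \<noteq> 0} \<subseteq> B"
    using assms unfolding carrier_R by auto
  have "(f \<otimes>\<^bsub>R\<^esub> g) c = (\<Sum>(a, b)\<in>{a. f a \<noteq> 0} \<times> {b. g b \<noteq> 0}. if m a b = Some c then f a * g b else 0)"
    by (simp add: basis_algebra_def)
  also have "\<dots> = (\<Sum>(a, b)\<in>B \<times> B. if m a b = Some c then f a * g b else 0)"
    using fB gB finB by (intro sum.mono_neutral_left) (auto split: if_splits)
  also have "\<dots> = bprod B m f g c" by (simp add: sum.cartesian_product bprod_def)
  finally show "(f \<otimes>\<^bsub>R\<^esub> g) c = bprod B m f g c" .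
qed

lemma add_R: "f \<oplus>\<^bsub>R\<^esub> g = f + g" by (simp add: basis_algebra_def plus_fun_def)

lemma zero_R: "\<zero>\<^bsub>R\<^esub> = 0" by (simp add: basis_algebra_def zero_fun_def)

lemma smult_R: "c \<odot>\<^bsub>R\<^esub> f = smul c f" by (simp add: basis_algebra_def smul_def)

lemma one_R: "\<one>\<^bsub>R\<^esub> = (\<Sum>u\<in>U. basis_elem u)"
proof
  fix x
  have "(\<Sum>u\<in>U. basis_elem u) x = (\<Sum>u\<in>U. if u = x then 1 else 0 :: 'k::field)"
    unfolding sum_fun_apply by (intro sum.cong) (auto simp: basis_elem_def)
  also have "\<dots> = (if x \<in> U then 1 else 0)" using finite_subset[OF U finB] by simp
  finally have *: "(\<Sum>u\<in>U. basis_elem u) x = (if x \<in> U then 1 else 0 :: 'k::field)" .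
  show "\<one>\<^bsub>R\<^esub> x = (\<Sum>u\<in>U. basis_elem u) x" unfolding * by (simp add: basis_algebra_def)
qed

lemma carrier_basis_elem[simp]: "b \<in> B \<Longrightarrow> basis_elem b \<in> carrier R"
  by (auto simp: carrier_R basis_elem_def)

lemma carrier_add: "f \<in> carrier R \<Longrightarrow> g \<in> carrier R \<Longrightarrow> f + g \<in> carrier R"
  unfolding carrier_R plus_fun_apply by (metis add.right_neutral)

lemma carrier_diff: "f \<in> carrier R \<Longrightarrow> g \<in> carrier R \<Longrightarrow> f - g \<in> carrier R"
  unfolding carrier_R minus_apply by (metis diff_zero)

lemma carrier_smul: "f \<in> carrier R \<Longrightarrow> smul c f \<in> carrier R"
  by (auto simp: carrier_R smul_apply)

lemma carrier_0: "0 \<in> carrier R" by (simp add: carrier_R)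

lemma carrier_sum: "(\<And>i. i \<in> S \<Longrightarrow> f i \<in> carrier R) \<Longrightarrow> (\<Sum>i\<in>S. f i) \<in> carrier R"
  by (induction S rule: infinite_finite_induct) (auto simp: carrier_0 carrier_add)

lemma expansion: "f \<in> carrier R \<Longrightarrow> f = (\<Sum>b\<in>B. smul (f b) (basis_elem b))"
  by (rule basis_expansion[OF finB]) (simp add: carrier_R)

lemma bprod_basis_elem:
  assumes "a \<in> B" "b \<in> B"
  shows "bprod B m (basis_elem a) (basis_elem b) = (case m a b of None \<Rightarrow> 0 | Some c \<Rightarrow> basis_elem c)"
proof
  fix c
  have "bprod B m (basis_elem a) (basis_elem b) c =
      (\<Sum>a'\<in>B. if a' = a then (\<Sum>b'\<in>B. if b' = b then (if m a b = Some c then 1 else 0) else 0) else 0)"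
    unfolding bprod_def by (intro sum.cong) (auto simp: basis_elem_def intro!: sum.neutral sum.cong)
  also have "\<dots> = (if m a b = Some c then 1 else 0)" using assms finB by simp
  finally show "bprod B m (basis_elem a) (basis_elem b) c = (case m a b of None \<Rightarrow> 0 | Some c \<Rightarrow> basis_elem c) c"
    by (auto simp: basis_elem_def split: option.split)
qed

text \<open>\<open>bprod\<close> reads only the values on \<open>B\<close>; this extends
  associativity from basis elements to all functions, in or out of the carrier.\<close>

lemma bprod_restrict:
  "bprod B m f g = bprod B m (\<Sum>b\<in>B. smul (f b) (basis_elem b)) (\<Sum>b\<in>B. smul (g b) (basis_elem b))"
proof -
  have *: "(\<Sum>b\<in>B. smul (h b) (basis_elem b)) x = h x" if "x \<in> B" for h :: "'b \<Rightarrow> 'k::field" and x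
  proof -
    have "(\<Sum>b\<in>B. smul (h b) (basis_elem b)) x = (\<Sum>b\<in>B. if b = x then h b else 0)"
      unfolding sum_fun_apply smul_apply by (intro sum.cong) (auto simp: basis_elem_def)
    then show ?thesis using that finB by simp
  qed
  show ?thesis unfolding bprod_def by (intro ext sum.cong refl) (simp add: *)
qed

lemma bprod_assoc:
  fixes f g h :: "'b \<Rightarrow> 'k::field"
  shows "bprod B m (bprod B m f g) h = bprod B m f (bprod B m g h)"
proof -
  have *: "bprod B m (bprod B m (basis_elem a) (basis_elem b)) (basis_elem c) =
      bprod B m (basis_elem a) (bprod B m (basis_elem b) (basis_elem c) :: 'b \<Rightarrow> 'k)"
    if abc: "a \<in> B" "b \<in> B" "c \<in> B" for a b c
  proof -
    have "bprod B m (bprod B m (basis_elem a) (basis_elem b)) (basis_elem c) =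
       (case Option.bind (m a b) (\<lambda>d. m d c) of None \<Rightarrow> 0 | Some c \<Rightarrow> (basis_elem c :: 'b \<Rightarrow> 'k))"
      using abc closed[OF abc(1,2)] by (cases "m a b") (auto simp: bprod_basis_elem)
    also have "\<dots> = bprod B m (basis_elem a) (bprod B m (basis_elem b) (basis_elem c))"
      unfolding assoc[OF abc] using abc closed[OF abc(2,3)] by (cases "m b c") (auto simp: bprod_basis_elem)
    finally show ?thesis .
  qed
  let ?E = "\<lambda>f. \<Sum>b\<in>B. smul (f b) (basis_elem b)"
  have "bprod B m (bprod B m f g) h = bprod B m (bprod B m (?E f) (?E g)) (?E h)"
    by (subst bprod_restrict, subst expansion[OF bprod_closed, symmetric], subst bprod_restrict[of f g]) (rule refl)
  also have "\<dots> = bprod B m (?E f) (bprod B m (?E g) (?E h))"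
    unfolding bprod_sum_left bprod_sum_right bprod_smul_left bprod_smul_right smul_sum
    by (intro sum.cong refl) (simp add: * mult.commute mult.left_commute)
  also have "\<dots> = bprod B m f (bprod B m g h)"
    by (subst (2) bprod_restrict, subst expansion[OF bprod_closed, symmetric], subst bprod_restrict[of g h]) (rule refl)
  finally show ?thesis .
qed

lemma bprod_unit:
  assumes "f \<in> carrier R"
  shows "bprod B m (\<Sum>u\<in>U. basis_elem u) f = f" "bprod B m f (\<Sum>u\<in>U. basis_elem u) = f"
proof -
  have UB: "u \<in> U \<Longrightarrow> u \<in> B" for u using U by blast
  have finU: "finite U" using finite_subset[OF U finB] .
  have l: "bprod B m (\<Sum>u\<in>U. basis_elem u) (basis_elem b) = (basis_elem b :: 'b \<Rightarrow> 'k::field)" if b: "b \<in> B" for b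
  proof -
    obtain u where u: "u \<in> U" "m u b = Some b" "\<forall>u'\<in>U. u' \<noteq> u \<longrightarrow> m u' b = None" using unit_left[OF b] by blast
    have "bprod B m (\<Sum>u\<in>U. basis_elem u) (basis_elem b) = (\<Sum>u'\<in>U. if u' = u then basis_elem b else 0)"
      unfolding bprod_sum_left using u by (intro sum.cong) (auto simp: bprod_basis_elem UB b)
    then show ?thesis using u finU by simp
  qed
  have r: "bprod B m (basis_elem b) (\<Sum>u\<in>U. basis_elem u) = (basis_elem b :: 'b \<Rightarrow> 'k::field)" if b: "b \<in> B" for b
  proof -
    obtain u where u: "u \<in> U" "m b u = Some b" "\<forall>u'\<in>U. u' \<noteq> u \<longrightarrow> m b u' = None" using unit_right[OF b] by blast
    have "bprod B m (basis_elem b) (\<Sum>u\<in>U. basis_elem u) = (\<Sum>u'\<in>U. if u' = u then basis_elem b else 0)"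
      unfolding bprod_sum_right using u by (intro sum.cong) (auto simp: bprod_basis_elem UB b)
    then show ?thesis using u finU by simp
  qed
  have "bprod B m (\<Sum>u\<in>U. basis_elem u) (\<Sum>b\<in>B. smul (f b) (basis_elem b)) = (\<Sum>b\<in>B. smul (f b) (basis_elem b))"
    unfolding bprod_sum_right[of _ _ _ _ B] bprod_smul_right by (simp add: l)
  then show "bprod B m (\<Sum>u\<in>U. basis_elem u) f = f" using expansion[OF assms] by simp
  have "bprod B m (\<Sum>b\<in>B. smul (f b) (basis_elem b)) (\<Sum>u\<in>U. basis_elem u) = (\<Sum>b\<in>B. smul (f b) (basis_elem b))"
    unfolding bprod_sum_left[of _ _ _ B] bprod_smul_left by (simp add: r)
  then show "bprod B m f (\<Sum>u\<in>U. basis_elem u) = f" using expansion[OF assms] by simp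
qed

lemma one_closed: "(\<Sum>u\<in>U. basis_elem u) \<in> carrier R"
  using U by (intro carrier_sum) auto

lemma ring_R: "ring R"
proof (rule ringI)
  show "abelian_group R"
  proof (rule abelian_groupI)
    show "\<exists>y\<in>carrier R. y \<oplus>\<^bsub>R\<^esub> x = \<zero>\<^bsub>R\<^esub>" if "x \<in> carrier R" for x
      using carrier_diff[OF carrier_0 that] by (intro bexI[of _ "0 - x"]) (auto simp: add_R zero_R)
  qed (auto simp: add_R zero_R carrier_add carrier_0 add.assoc add.commute)
  show "Group.monoid R"
    by (rule monoidI) (simp_all add: mult_R bprod_closed one_R one_closed bprod_assoc bprod_unit)
qed (simp_all add: mult_R add_R carrier_add bprod_closed bprod_add_left bprod_add_right)

lemma finsum_R:
  assumes "\<And>i. i \<in> S \<Longrightarrow> f i \<in> carrier R"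
  shows "finsum R f S = (\<Sum>i\<in>S. f i)"
proof -
  interpret ring R by (rule ring_R)
  show ?thesis
    using assms
  proof (induction S rule: infinite_finite_induct)
    case (infinite S)
    then show ?case by (simp add: zero_R finsum_infinite)
  next
    case (insert x S)
    then have "finsum R f (insert x S) = f x \<oplus>\<^bsub>R\<^esub> finsum R f S" by (intro finsum_insert) auto
    then show ?case using insert by (simp add: add_R)
  qed (simp add: zero_R)
qed

lemma minus_R:
  assumes "f \<in> carrier R" "g \<in> carrier R"
  shows "f \<ominus>\<^bsub>R\<^esub> g = f - g"
proof -
  interpret ring R by (rule ring_R)
  have "- g \<in> carrier R" using carrier_diff[OF carrier_0 assms(2)] by simp
  then have "\<ominus>\<^bsub>R\<^esub> g = - g" using assms by (intro minus_equality) (auto simp: add_R zero_R)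
  then show ?thesis by (simp add: a_minus_def add_R)
qed

end

section \<open>The face algebra and its idempotents\<close>

notation basis_elem ("\<delta>")

text \<open>The recursion for \<open>e X\<close> refers to the flats strictly above
  \<open>X\<close>, hence an induction from the largest flat downwards.\<close>

lemma psubset_induct_down [consumes 2, case_names step]:
  assumes "finite S" "X \<in> S"
    and step: "\<And>X. X \<in> S \<Longrightarrow> (\<And>Y. Y \<in> S \<Longrightarrow> X \<subset> Y \<Longrightarrow> P Y) \<Longrightarrow> P X"
  shows "P X"
  using assms(2)
proof (induction "card {Y \<in> S. X \<subset> Y}" arbitrary: X rule: less_induct)
  case less
  show ?case
  proof (rule step[OF less.prems])
    fix Y assume Y: "Y \<in> S" "X \<subset> Y"
    have "{Z \<in> S. Y \<subset> Z} \<subset> {Z \<in> S. X \<subset> Z}" using Y by blast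
    then have "card {Z \<in> S. Y \<subset> Z} < card {Z \<in> S. X \<subset> Z}"
      using assms(1) by (intro psubset_card_mono) auto
    then show "P Y" using less.hyps Y by blast
  qed
qed

section \<open>The face semigroup and its algebra\<close>

context hyperplane_arrangement
begin

abbreviation "F \<equiv> faces A"
abbreviation "fmult \<equiv> face_mult A"

lemma fmult_closed: "x \<in> F \<Longrightarrow> y \<in> F \<Longrightarrow> fmult x y \<in> F"
  by (auto simp: faces_eq)

lemma fmult_assoc: "x \<in> F \<Longrightarrow> y \<in> F \<Longrightarrow> z \<in> F \<Longrightarrow> fmult (fmult x y) z = fmult x (fmult y z)"
proof -
  assume "x \<in> F" "y \<in> F" "z \<in> F"
  then obtain u v w where "x = face_of A u" "y = face_of A v" "z = face_of A w" by (auto simp: faces_eq)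
  then show ?thesis by (simp add: face_of_eq_iff near_hsgn)
qed

lemma supp_lat: "x \<in> F \<Longrightarrow> supp A x \<in> lat"
  by (auto simp: faces_eq)

text \<open>Wherever \<open>x\<close> has sign 0, so has \<open>y\<close>.\<close>

lemma fmult_absorb: assumes "x \<in> F" "y \<in> F" "supp A y \<subseteq> supp A x" shows "fmult x y = x"
proof -
  obtain v u where *: "x = face_of A v" "y = face_of A u" using assms by (auto simp: faces_eq)
  then have s: "flat_of A u \<subseteq> flat_of A v" using assms by simp
  have "hsgn H u = 0" if "H \<in> A" "hsgn H v = 0" for H
    using that s flat_of_self[of u] by (auto simp: hsgn_0_iff flat_of_def)
  then show ?thesis using * by (auto simp: face_of_eq_iff near_hsgn)
qed

text \<open>Together the three parts say that the support of a product is the join of the supports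
  in the lattice.\<close>

lemma supp_fmult:
  assumes "x \<in> F" "y \<in> F"
  shows "supp A x \<subseteq> supp A (fmult x y)" "supp A y \<subseteq> supp A (fmult x y)"
    "X \<in> lat \<Longrightarrow> supp A x \<subseteq> X \<Longrightarrow> supp A y \<subseteq> X \<Longrightarrow> supp A (fmult x y) \<subseteq> X"
proof -
  obtain v u where *: "x = face_of A v" "y = face_of A u" using assms by (auto simp: faces_eq)
  show "supp A x \<subseteq> supp A (fmult x y)" "supp A y \<subseteq> supp A (fmult x y)"
    unfolding * face_mult_face_of supp_face_of flat_of_near by (auto simp: flat_of_def)
  assume X: "X \<in> lat" "supp A x \<subseteq> X" "supp A y \<subseteq> X"
  then have "near A v u \<in> X"
    using * flat_of_self by (intro near_in_subspace lattice_subspace) auto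
  then show "supp A (fmult x y) \<subseteq> X" using flat_of_subset[OF X(1)] * by simp
qed

lemma supp_fmult_eq: "x \<in> F \<Longrightarrow> y \<in> F \<Longrightarrow> supp A x \<subseteq> supp A y \<Longrightarrow> supp A (fmult x y) = supp A y"
  using supp_fmult[of x y] supp_lat[of y] by blast

lemma Inter_face: "\<Inter>A = face_of A 0"
proof -
  have "hsgn H x = hsgn H 0 \<longleftrightarrow> x \<in> H" if "H \<in> A" for H x
    using hsgn_0_iff[OF that, of x] by (simp add: hsgn_def)
  then show ?thesis by (auto simp: face_of_def)
qed

lemma Inter_in_F: "\<Inter>A \<in> F" by (simp add: Inter_face)

lemma fmult_unit: "x \<in> F \<Longrightarrow> fmult (\<Inter>A) x = x" "x \<in> F \<Longrightarrow> fmult x (\<Inter>A) = x"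
proof -
  assume "x \<in> F"
  then obtain u where u: "x = face_of A u" by (auto simp: faces_eq)
  have "hsgn H (0::'v) = 0" for H by (simp add: hsgn_def)
  then show "fmult (\<Inter>A) x = x" "fmult x (\<Inter>A) = x"
    by (simp_all add: u Inter_face face_of_eq_iff near_hsgn)
qed

lemma supp_Inter: "X \<in> lat \<Longrightarrow> supp A (\<Inter>A) \<subseteq> X"
  using lattice_closed[of X] by (auto simp: supp_def)

sublocale fa: finite_basis_algebra F "\<lambda>x y. Some (fmult x y)" "{\<Inter>A}"
  by unfold_locales (auto simp: finite_faces fmult_closed fmult_assoc Inter_in_F fmult_unit)

abbreviation fm :: "('v set \<Rightarrow> 'k::field) \<Rightarrow> ('v set \<Rightarrow> 'k) \<Rightarrow> 'v set \<Rightarrow> 'k" where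
  "fm \<equiv> bprod F (\<lambda>x y. Some (fmult x y))"

lemma fm_delta: "x \<in> F \<Longrightarrow> y \<in> F \<Longrightarrow> fm (\<delta> x) (\<delta> y) = \<delta> (fmult x y)"
  by (simp add: fa.bprod_basis_elem)

lemma fm_expand: assumes "f \<in> carrier (face_algebra A)" shows "fm f g = (\<Sum>x\<in>F. smul (f x) (fm (\<delta> x) g))"
proof -
  have "f = (\<Sum>x\<in>F. smul (f x) (\<delta> x))"
    using assms by (intro fa.expansion) (simp add: face_algebra_def)
  then have "fm f g = fm (\<Sum>x\<in>F. smul (f x) (\<delta> x)) g" by (rule arg_cong)
  then show ?thesis by (simp only: bprod_sum_left bprod_smul_left)
qed

lemma fm_delta_act: "x \<in> F \<Longrightarrow> y \<in> F \<Longrightarrow> fm (\<delta> x) (fm (\<delta> y) g) = fm (\<delta> (fmult x y)) g"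
  by (simp only: fa.bprod_assoc[symmetric] fm_delta)

lemma fm_delta_on:
  assumes "finite S" "S \<subseteq> F" "\<And>y. g y \<noteq> 0 \<Longrightarrow> y \<in> S" "x \<in> F"
  shows "fm (\<delta> x) g = (\<Sum>y\<in>S. smul (g y) (\<delta> (fmult x y)))"
proof -
  have "g = (\<Sum>y\<in>S. smul (g y) (\<delta> y))" using assms by (intro basis_expansion) auto
  then have "fm (\<delta> x) g = (\<Sum>y\<in>S. smul (g y) (fm (\<delta> x) (\<delta> y)))"
    by (metis (no_types, lifting) bprod_sum_right bprod_smul_right sum.cong)
  also have "\<dots> = (\<Sum>y\<in>S. smul (g y) (\<delta> (fmult x y)))"
    by (intro sum.cong refl) (use assms in \<open>simp add: fm_delta subset_iff\<close>)
  finally show ?thesis .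
qed

lemma fm_on:
  assumes "S \<subseteq> F" "\<And>y. f y \<noteq> 0 \<Longrightarrow> y \<in> S"
  shows "fm f g = (\<Sum>y\<in>S. smul (f y) (fm (\<delta> y) g))"
proof -
  have "finite S" using assms(1) finite_faces finite_subset by blast
  then have "f = (\<Sum>y\<in>S. smul (f y) (\<delta> y))" using assms(2) by (intro basis_expansion)
  then have "fm f g = fm (\<Sum>y\<in>S. smul (f y) (\<delta> y)) g" by (rule arg_cong)
  then show ?thesis by (simp only: bprod_sum_left bprod_smul_left)
qed

lemma fm_nonzero:
  assumes "fm f g z \<noteq> 0"
  obtains x y where "x \<in> F" "y \<in> F" "f x \<noteq> 0" "g y \<noteq> 0" "z = fmult x y"
proof -
  obtain x where x: "x \<in> F" "(\<Sum>b\<in>F. if Some (fmult x b) = Some z then f x * g b else 0) \<noteq> 0"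
    by (rule sum.not_neutral_contains_not_neutral[OF assms[unfolded bprod_def]])
  obtain y where "y \<in> F" "(if Some (fmult x y) = Some z then f x * g y else 0) \<noteq> 0"
    by (rule sum.not_neutral_contains_not_neutral[OF x(2)])
  then show thesis using that x by (auto split: if_splits)
qed

lemma on_subset: "faces_on A X \<subseteq> F" by (auto simp: faces_on_def)

end

section \<open>The recursively defined idempotents\<close>

locale face_idempotents = hyperplane_arrangement A for A :: "'v::real_inner set set" +
  fixes l e :: "'v set \<Rightarrow> 'v set \<Rightarrow> 'k::field"
  assumes l_supp: "\<And>X x. X \<in> lat \<Longrightarrow> l X x \<noteq> 0 \<Longrightarrow> x \<in> F \<and> supp A x = X"
    and l_sum: "\<And>X. X \<in> lat \<Longrightarrow> (\<Sum>x\<in>faces_on A X. l X x) = 1"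
    and e_eq: "\<And>X. X \<in> lat \<Longrightarrow> e X = l X - (\<Sum>Y\<in>{Y \<in> lat. X \<subset> Y}. fm (l X) (e Y))"
begin

lemma l_on: "X \<in> lat \<Longrightarrow> l X x \<noteq> 0 \<Longrightarrow> x \<in> faces_on A X"
  using l_supp by (simp add: faces_on_def)

text \<open>Every face that occurs in \<open>l X\<close> is absorbed by \<open>x\<close>, and the
  coefficients add up to 1.\<close>

lemma act_l:
  assumes "X \<in> lat" "x \<in> F" "X \<subseteq> supp A x"
  shows "fm (\<delta> x) (l X) = \<delta> x"
proof -
  have "fm (\<delta> x) (l X) = (\<Sum>y\<in>faces_on A X. smul (l X y) (\<delta> (fmult x y)))"
    by (rule fm_delta_on) (use finite_on on_subset l_on assms in auto)
  also have "\<dots> = (\<Sum>y\<in>faces_on A X. smul (l X y) (\<delta> x))"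
    by (intro sum.cong refl) (use assms fmult_absorb in \<open>auto simp: faces_on_def\<close>)
  also have "\<dots> = smul (\<Sum>y\<in>faces_on A X. l X y) (\<delta> x)" by (simp only: smul_sum_left)
  also have "\<dots> = \<delta> x" using l_sum[OF assms(1)] by simp
  finally show ?thesis .
qed

lemma fm_l: "X \<in> lat \<Longrightarrow> fm (l X) g = (\<Sum>x\<in>faces_on A X. smul (l X x) (fm (\<delta> x) g))"
  by (rule fm_on[OF on_subset]) (rule l_on)

lemma mult_l:
  assumes "X \<in> lat" "S \<subseteq> F" "\<And>y. f y \<noteq> 0 \<Longrightarrow> y \<in> S" "\<And>y. y \<in> S \<Longrightarrow> X \<subseteq> supp A y"
  shows "fm f (l X) = f"
proof -
  have "fm f (l X) = (\<Sum>y\<in>S. smul (f y) (fm (\<delta> y) (l X)))" by (rule fm_on[OF assms(2,3)])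
  also have "\<dots> = (\<Sum>y\<in>S. smul (f y) (\<delta> y))"
    by (intro sum.cong refl) (use act_l assms in auto)
  also have "\<dots> = f"
    using assms(2) finite_faces finite_subset by (intro basis_expansion[symmetric] assms(3)) blast+
  finally show ?thesis .
qed

lemma l_l: "X \<in> lat \<Longrightarrow> fm (l X) (l X) = l X"
  by (rule mult_l[of _ "faces_on A X"]) (auto simp: l_on on_subset, auto simp: faces_on_def)

lemma act_e: "X \<in> lat \<Longrightarrow> x \<in> F \<Longrightarrow> fm (\<delta> x) (e X) =
    fm (\<delta> x) (l X) - (\<Sum>Y\<in>{Y \<in> lat. X \<subset> Y}. fm (fm (\<delta> x) (l X)) (e Y))"
  by (subst e_eq, assumption) (simp only: bprod_diff_right bprod_sum_right fa.bprod_assoc)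

lemma e_nonzero:
  assumes "X \<in> lat"
  shows "e X x \<noteq> 0 \<Longrightarrow> x \<in> F \<and> X \<subseteq> supp A x"
  using finite_lattice assms
proof (induction X arbitrary: x rule: psubset_induct_down)
  case (step X)
  show ?case
  proof (cases "l X x = 0")
    case False
    then show ?thesis using l_supp[OF step(1)] by blast
  next
    case True
    then have nz: "(\<Sum>Y\<in>{Y \<in> lat. X \<subset> Y}. fm (l X) (e Y) x) \<noteq> 0"
      using step(3) e_eq[OF step(1)] by (simp add: sum_fun_apply)
    obtain Y where "Y \<in> {Y \<in> lat. X \<subset> Y}" and Ynz: "fm (l X) (e Y) x \<noteq> 0"
      by (rule sum.not_neutral_contains_not_neutral[OF nz])
    then have Y: "Y \<in> lat" "X \<subset> Y" by auto
    obtain y z where yz: "y \<in> F" "z \<in> F" "e Y z \<noteq> 0" "x = fmult y z"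
      by (rule fm_nonzero[OF Ynz]) blast
    then have "Y \<subseteq> supp A z" using step(2) Y by blast
    then show ?thesis using supp_fmult(2)[OF yz(1,2)] fmult_closed Y yz by blast
  qed
qed

lemma e_carrier: "X \<in> lat \<Longrightarrow> e X \<in> carrier (face_algebra A)"
  unfolding face_algebra_def fa.carrier_R using e_nonzero by blast

lemma e_top:
  assumes "X \<in> lat" "supp A x = X"
  shows "e X x = l X x"
proof -
  have "fm (l X) (e Y) x = 0" if Y: "Y \<in> lat" "X \<subset> Y" for Y
  proof (rule ccontr)
    assume nz: "fm (l X) (e Y) x \<noteq> 0"
    obtain y z where yz: "y \<in> F" "z \<in> F" "e Y z \<noteq> 0" "x = fmult y z"
      by (rule fm_nonzero[OF nz]) blast
    then have "Y \<subseteq> supp A z" using e_nonzero Y by blast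
    then show False using supp_fmult(2)[OF yz(1,2)] Y yz assms by blast
  qed
  then show ?thesis using e_eq[OF assms(1)] by (simp add: sum_fun_apply)
qed

text \<open>This is the recursion for \<open>e\<close> at the support of \<open>u\<close>,
  multiplied from the left by \<open>u\<close>, which absorbs \<open>l\<close>.\<close>

lemma act_e_sum:
  assumes "u \<in> F"
  shows "(\<Sum>Z\<in>{Z \<in> lat. supp A u \<subseteq> Z}. fm (\<delta> u) (e Z)) = \<delta> u"
proof -
  let ?U = "supp A u"
  have U: "?U \<in> lat" using assms supp_lat by blast
  have l: "fm (\<delta> u) (l ?U) = \<delta> u" using act_l[OF U assms] by simp
  have eq: "{Z \<in> lat. ?U \<subseteq> Z} = insert ?U {Z \<in> lat. ?U \<subset> Z}" using U by auto
  have fin: "finite {Z \<in> lat. ?U \<subset> Z}" using finite_lattice by simp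
  have "(\<Sum>Z\<in>{Z \<in> lat. ?U \<subseteq> Z}. fm (\<delta> u) (e Z)) =
      fm (\<delta> u) (e ?U) + (\<Sum>Z\<in>{Z \<in> lat. ?U \<subset> Z}. fm (\<delta> u) (e Z))"
    unfolding eq by (rule sum.insert[OF fin]) simp
  also have "fm (\<delta> u) (e ?U) = \<delta> u - (\<Sum>Z\<in>{Z \<in> lat. ?U \<subset> Z}. fm (\<delta> u) (e Z))"
    using act_e[OF U assms] unfolding l .
  finally show ?thesis by (simp only: diff_add_cancel)
qed

text \<open>Every face \<open>u = y x\<close> in the product of \<open>y\<close> and
  \<open>l X\<close> has support larger than \<open>X\<close>. By induction \<open>u\<close> kills
  \<open>e Z\<close> unless \<open>Z\<close> contains the support of \<open>u\<close>, and over
  those \<open>Z\<close> the products sum to \<open>u\<close> (\<open>act_e_sum\<close>). So the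
  recursion subtracts exactly what \<open>l X\<close> contributes.\<close>

lemma act_e_zero:
  assumes "X \<in> lat" "y \<in> F" "\<not> supp A y \<subseteq> X"
  shows "fm (\<delta> y) (e X) = 0"
  using finite_lattice assms(1,3)
proof (induction X rule: psubset_induct_down)
  case (step X)
  have "fm (\<delta> y) (e X) = (\<Sum>x\<in>faces_on A X. smul (l X x)
      (\<delta> (fmult y x) - (\<Sum>Z\<in>{Z \<in> lat. X \<subset> Z}. fm (\<delta> (fmult y x)) (e Z))))"
  proof -
    have 1: "fm (\<delta> y) (l X) = (\<Sum>x\<in>faces_on A X. smul (l X x) (\<delta> (fmult y x)))"
      by (rule fm_delta_on) (use finite_on on_subset l_on step assms in auto)
    have "(\<Sum>Z\<in>{Z \<in> lat. X \<subset> Z}. fm (fm (\<delta> y) (l X)) (e Z)) =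
        (\<Sum>x\<in>faces_on A X. \<Sum>Z\<in>{Z \<in> lat. X \<subset> Z}. smul (l X x) (fm (\<delta> (fmult y x)) (e Z)))"
      unfolding 1 bprod_sum_left bprod_smul_left by (rule sum.swap)
    then show ?thesis
      unfolding act_e[OF step(1) assms(2)] by (simp only: 1 smul_diff smul_sum sum_subtractf)
  qed
  also have "\<dots> = (\<Sum>x\<in>faces_on A X. 0)"
  proof (intro sum.cong refl)
    fix x assume "x \<in> faces_on A X"
    then have x: "x \<in> F" "supp A x = X" by (auto simp: faces_on_def)
    let ?u = "fmult y x"
    have u: "?u \<in> F" "X \<subset> supp A ?u"
      using fmult_closed supp_fmult[OF assms(2) x(1)] assms(2) x step(3) by blast+
    have sub: "{Z \<in> lat. supp A ?u \<subseteq> Z} \<subseteq> {Z \<in> lat. X \<subset> Z}" using u by blast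
    have van: "fm (\<delta> ?u) (e Z) = 0" if Z: "Z \<in> {Z \<in> lat. X \<subset> Z} - {Z \<in> lat. supp A ?u \<subseteq> Z}" for Z
    proof -
      have Z': "Z \<in> lat" "X \<subset> Z" "\<not> supp A ?u \<subseteq> Z" using Z by auto
      then have "\<not> supp A y \<subseteq> Z" using supp_fmult(3)[OF assms(2) x(1)] x by blast
      then have "fm (\<delta> y) (e Z) = 0" using step(2) Z' by blast
      show ?thesis
      proof (cases "\<not> supp A y \<subseteq> Z")
        case True
        \<comment> \<open>\<open>u\<close> absorbs \<open>y\<close>, so \<open>u = u y\<close> and a
          factor \<open>y\<close> can be placed next to \<open>e Z\<close>.\<close>
        have "fmult y x = fmult (fmult y x) y"
          using fmult_absorb[OF u(1) assms(2)] supp_fmult(1)[OF assms(2) x(1)] by simp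
        then have "fm (\<delta> ?u) (e Z) = fm (\<delta> ?u) (fm (\<delta> y) (e Z))"
          using fm_delta_act[OF u(1) assms(2)] by metis
        then show ?thesis using \<open>fm (\<delta> y) (e Z) = 0\<close> by (simp only: bprod_0)
      qed (use \<open>\<not> supp A y \<subseteq> Z\<close> in blast)
    qed
    have "(\<Sum>Z\<in>{Z \<in> lat. X \<subset> Z}. fm (\<delta> ?u) (e Z)) = (\<Sum>Z\<in>{Z \<in> lat. supp A ?u \<subseteq> Z}. fm (\<delta> ?u) (e Z))"
      by (rule sum.mono_neutral_right[OF _ sub]) (use finite_lattice van in auto)
    also have "\<dots> = \<delta> ?u" by (rule act_e_sum[OF u(1)])
    finally show "smul (l X x) (\<delta> ?u - (\<Sum>Z\<in>{Z \<in> lat. X \<subset> Z}. fm (\<delta> ?u) (e Z))) = 0"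
      by (simp only: diff_self smul_0)
  qed
  finally show ?case by (simp only: sum.neutral_const)
qed

text \<open>The faces of larger support in \<open>e X\<close> keep a larger support under
  multiplication by \<open>y\<close>; those of support \<open>X\<close> are absorbed by
  \<open>y\<close>, with total coefficient 1.\<close>

lemma act_e_top:
  assumes "X \<in> lat" "x \<in> faces_on A X" "y \<in> faces_on A X"
  shows "fm (\<delta> y) (e X) x = (if x = y then 1 else 0)"
proof -
  have xy: "x \<in> F" "y \<in> F" "supp A x = X" "supp A y = X" using assms by (auto simp: faces_on_def)
  have "fm (\<delta> y) (e X) x = (\<Sum>z\<in>F. smul (e X z) (\<delta> (fmult y z)) x)"
    using fm_delta_on[OF finite_faces order_refl, of "e X" y] e_nonzero[OF assms(1)] xy(2)
    by (simp add: sum_fun_apply)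
  also have "\<dots> = (\<Sum>z\<in>faces_on A X. l X z * \<delta> y x)"
  proof (rule sum.mono_neutral_cong_right[OF finite_faces on_subset])
    show "\<forall>z\<in>F - faces_on A X. smul (e X z) (\<delta> (fmult y z)) x = 0"
    proof
      fix z assume z: "z \<in> F - faces_on A X"
      show "smul (e X z) (\<delta> (fmult y z)) x = 0"
      proof (cases "e X z = 0")
        case False
        then have "X \<subset> supp A z" using e_nonzero[OF assms(1) False] z by (auto simp: faces_on_def)
        then have "x \<noteq> fmult y z" using supp_fmult(2)[OF xy(2), of z] z xy by blast
        then show ?thesis by (simp add: smul_apply basis_elem_def)
      qed (simp add: smul_apply)
    qed
    show "smul (e X z) (\<delta> (fmult y z)) x = l X z * \<delta> y x" if "z \<in> faces_on A X" for z
      using that e_top[OF assms(1)] fmult_absorb[OF xy(2), of z] xy(4)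
      by (simp add: smul_apply faces_on_def)
  qed
  also have "\<dots> = \<delta> y x" using l_sum[OF assms(1)] by (simp flip: sum_distrib_right)
  finally show ?thesis by (simp add: basis_elem_def)
qed

lemma fm_e_top:
  assumes "X \<in> lat" "x \<in> faces_on A X" "\<And>y. f y \<noteq> 0 \<Longrightarrow> y \<in> faces_on A X"
  shows "fm f (e X) x = f x"
proof -
  have "fm f (e X) x = (\<Sum>y\<in>faces_on A X. f y * fm (\<delta> y) (e X) x)"
    by (subst fm_on[OF on_subset assms(3)]) (simp_all add: sum_fun_apply smul_apply)
  also have "\<dots> = (\<Sum>y\<in>faces_on A X. if x = y then f y else 0)"
    using act_e_top[OF assms(1,2)] by (intro sum.cong) auto
  also have "\<dots> = f x" using finite_on assms(2) by simp
  finally show ?thesis .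
qed

lemma l_e: assumes "X \<in> lat" shows "fm (l X) (e X) = e X"
proof -
  have "fm (l X) (fm (l X) (e Y)) = fm (l X) (e Y)" for Y
    by (simp only: fa.bprod_assoc[symmetric] l_l[OF assms])
  then show ?thesis
    by (subst (1 2) e_eq[OF assms]) (simp only: bprod_diff_right bprod_sum_right l_l[OF assms])
qed

lemma fm_e:
  assumes "X \<in> lat" "f \<in> carrier (face_algebra A)"
  shows "fm f (e X) = (\<Sum>x\<in>{x \<in> F. supp A x \<subseteq> X}. smul (f x) (fm (\<delta> x) (e X)))"
  unfolding fm_expand[OF assms(2)]
proof (rule sum.mono_neutral_right[OF finite_faces])
  show "\<forall>x\<in>F - {x \<in> F. supp A x \<subseteq> X}. smul (f x) (fm (\<delta> x) (e X)) = 0"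
  proof
    fix x assume "x \<in> F - {x \<in> F. supp A x \<subseteq> X}"
    then have "fm (\<delta> x) (e X) = 0" using act_e_zero[OF assms(1)] by blast
    then show "smul (f x) (fm (\<delta> x) (e X)) = 0" by (simp only: smul_0)
  qed
qed auto

lemma fm_e_not_above:
  assumes "X \<in> lat" "f \<in> carrier (face_algebra A)" "\<And>x. f x \<noteq> 0 \<Longrightarrow> supp A x \<subseteq> X \<Longrightarrow> False"
  shows "fm f (e X) = 0"
  unfolding fm_e[OF assms(1,2)]
proof (rule sum.neutral, rule ballI)
  fix x assume "x \<in> {x \<in> F. supp A x \<subseteq> X}"
  then have "f x = 0" using assms(3) by blast
  then show "smul (f x) (fm (\<delta> x) (e X)) = 0" by (simp only: smul_0)
qed

text \<open>Faces of larger support kill \<open>e X\<close> by \<open>act_e_zero\<close>, so only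
  the part of \<open>f\<close> of support \<open>X\<close> acts.\<close>

lemma e_part:
  assumes X: "X \<in> lat" and f: "f \<in> carrier (face_algebra A)" "\<And>x. f x \<noteq> 0 \<Longrightarrow> X \<subseteq> supp A x"
    and g: "\<And>x. supp A x = X \<Longrightarrow> f x = g x" "\<And>x. g x \<noteq> 0 \<Longrightarrow> x \<in> faces_on A X"
  shows "fm f (e X) = fm g (e X)"
proof -
  have "fm f (e X) = (\<Sum>x\<in>faces_on A X. smul (f x) (fm (\<delta> x) (e X)))"
    unfolding fm_e[OF X f(1)]
  proof (rule sum.mono_neutral_right)
    show "\<forall>x\<in>{x \<in> F. supp A x \<subseteq> X} - faces_on A X. smul (f x) (fm (\<delta> x) (e X)) = 0"
    proof
      fix x assume "x \<in> {x \<in> F. supp A x \<subseteq> X} - faces_on A X"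
      then have "f x = 0" using f(2)[of x] by (auto simp: faces_on_def)
      then show "smul (f x) (fm (\<delta> x) (e X)) = 0" by (simp only: smul_0)
    qed
  qed (auto simp: faces_on_def finite_faces)
  also have "\<dots> = (\<Sum>x\<in>faces_on A X. smul (g x) (fm (\<delta> x) (e X)))"
    by (intro sum.cong refl) (simp add: g(1) faces_on_def)
  also have "\<dots> = fm g (e X)" by (rule fm_on[OF on_subset g(2), symmetric])
  finally show ?thesis .
qed

lemma e_idem: assumes "X \<in> lat" shows "fm (e X) (e X) = e X"
proof -
  have "fm (e X) (e X) = fm (l X) (e X)"
    by (rule e_part[OF assms e_carrier[OF assms]]) (use e_nonzero e_top l_on assms in auto)
  then show ?thesis using l_e[OF assms] by (simp only:)
qed

text \<open>Unless \<open>X\<close> lies below \<open>Y\<close>, the supports force the product to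
  be 0. Otherwise, by induction, only the term for \<open>Y\<close> survives in the recursion, and
  it cancels the product of \<open>l X\<close> and \<open>e Y\<close>.\<close>

lemma e_orth:
  assumes "X \<in> lat" "Y \<in> lat" "X \<noteq> Y"
  shows "fm (e X) (e Y) = 0"
  using finite_lattice assms(1,3)
proof (induction X rule: psubset_induct_down)
  case (step X)
  show ?case
  proof (cases "X \<subseteq> Y")
    case False
    show ?thesis
      by (rule fm_e_not_above[OF assms(2) e_carrier[OF step(1)]]) (use e_nonzero[OF step(1)] False in blast)
  next
    case True
    then have XY: "Y \<in> {Z \<in> lat. X \<subset> Z}" using step assms by auto
    have "fm (e X) (e Y) = fm (l X) (e Y) - (\<Sum>Z\<in>{Z \<in> lat. X \<subset> Z}. fm (l X) (fm (e Z) (e Y)))"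
      by (subst e_eq[OF step(1)]) (simp only: bprod_diff_left bprod_sum_left fa.bprod_assoc)
    also have "(\<Sum>Z\<in>{Z \<in> lat. X \<subset> Z}. fm (l X) (fm (e Z) (e Y))) = (\<Sum>Z\<in>{Y}. fm (l X) (fm (e Z) (e Y)))"
    proof (rule sum.mono_neutral_right)
      show "\<forall>Z\<in>{Z \<in> lat. X \<subset> Z} - {Y}. fm (l X) (fm (e Z) (e Y)) = 0"
      proof
        fix Z assume "Z \<in> {Z \<in> lat. X \<subset> Z} - {Y}"
        then have "fm (e Z) (e Y) = 0" using step(2) by blast
        then show "fm (l X) (fm (e Z) (e Y)) = 0" by (simp only: bprod_0)
      qed
    qed (use finite_lattice XY in auto)
    also have "\<dots> = fm (l X) (e Y)" using e_idem[OF assms(2)] by simp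
    finally show ?thesis by (simp only: diff_self)
  qed
qed

lemma e_sum: "(\<Sum>X\<in>lat. e X) = \<delta> (\<Inter>A)"
proof -
  have "fm (\<delta> (\<Inter>A)) (e Z) = e Z" if "Z \<in> lat" for Z
    using fa.bprod_unit(1)[of "e Z"] e_carrier[OF that] by (simp add: face_algebra_def)
  then have "(\<Sum>Z\<in>{Z \<in> lat. supp A (\<Inter>A) \<subseteq> Z}. fm (\<delta> (\<Inter>A)) (e Z)) = (\<Sum>X\<in>lat. e X)"
    using supp_Inter by (intro sum.cong) auto
  then show ?thesis using act_e_sum[OF Inter_in_F] by simp
qed

text \<open>The corner at \<open>e X\<close> is one-dimensional, which makes \<open>e X\<close>
  primitive. A face \<open>a\<close> with support in \<open>X\<close> is absorbed by every face in
  \<open>e X\<close>, so the product of \<open>e X\<close> and \<open>a\<close> agrees with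
  \<open>l X\<close> on the faces of support \<open>X\<close>, and \<open>e_part\<close>
  applies.\<close>

lemma e_sandwich:
  assumes X: "X \<in> lat" and f: "f \<in> carrier (face_algebra A)"
  shows "fm (e X) (fm f (e X)) = smul (\<Sum>x\<in>{x \<in> F. supp A x \<subseteq> X}. f x) (e X)"
proof -
  have a: "fm (e X) (fm (\<delta> a) (e X)) = e X" if a: "a \<in> F" "supp A a \<subseteq> X" for a
  proof -
    have "fm (e X) (fm (\<delta> a) (e X)) = fm (fm (e X) (\<delta> a)) (e X)" by (simp only: fa.bprod_assoc)
    also have "\<dots> = fm (l X) (e X)"
    proof (rule e_part[OF X])
      show "fm (e X) (\<delta> a) \<in> carrier (face_algebra A)" using fa.bprod_closed by (simp add: face_algebra_def)
      show "X \<subseteq> supp A x" if nz: "fm (e X) (\<delta> a) x \<noteq> 0" for x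
        using nz
      proof (rule fm_nonzero)
        fix y z assume yz: "y \<in> F" "z \<in> F" "e X y \<noteq> 0" "x = fmult y z"
        then show "X \<subseteq> supp A x" using e_nonzero[OF X yz(3)] supp_fmult(1)[OF yz(1,2)] by blast
      qed
      show "x \<in> faces_on A X" if "l X x \<noteq> 0" for x using that l_on X by blast
      fix x assume x: "supp A x = X"
      have "fm (e X) (\<delta> a) x = (\<Sum>y\<in>F. e X y * \<delta> (fmult y a) x)"
        unfolding fm_expand[OF e_carrier[OF X]] by (simp add: sum_fun_apply smul_apply fm_delta a)
      also have "\<dots> = (\<Sum>y\<in>F. if x = y then e X y else 0)"
      proof (intro sum.cong refl)
        fix y assume y: "y \<in> F"
        show "e X y * \<delta> (fmult y a) x = (if x = y then e X y else 0)"
        proof (cases "e X y = 0")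
          case False
          then have Xy: "X \<subseteq> supp A y" using e_nonzero[OF X] by blast
          then have "fmult y a = y" using fmult_absorb[OF y a(1)] a(2) by blast
          then show ?thesis by (simp add: basis_elem_def)
        qed simp
      qed
      also have "\<dots> = e X x" using finite_faces e_nonzero[OF X, of x] by auto
      finally show "fm (e X) (\<delta> a) x = l X x" using e_top[OF X x] by simp
    qed
    also have "\<dots> = e X" by (rule l_e[OF X])
    finally show ?thesis .
  qed
  show ?thesis
    unfolding fm_e[OF X f] bprod_sum_right bprod_smul_right smul_sum_left
    by (intro sum.cong refl) (simp add: a)
qed

lemma e_neq_0: assumes "X \<in> lat" shows "e X \<noteq> 0"
proof
  assume "e X = 0"
  then have "\<forall>x\<in>faces_on A X. l X x = 0" using e_top[OF assms] by (auto simp: faces_on_def)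
  then show False using l_sum[OF assms] by simp
qed

lemma complete_idempotents:
  "complete_primitive_orthogonal_idempotents (face_algebra A) lat e"
  unfolding complete_primitive_orthogonal_idempotents_def
proof (intro conjI ballI impI)
  have kF: "face_algebra A = basis_algebra F (\<lambda>x y. Some (fmult x y)) {\<Inter>A}" by (simp add: face_algebra_def)
  have mult: "f \<otimes>\<^bsub>face_algebra A\<^esub> g = fm f g"
    if "f \<in> carrier (face_algebra A)" "g \<in> carrier (face_algebra A)" for f g :: "'v set \<Rightarrow> 'k"
    using that fa.mult_R unfolding kF by blast
  have zero: "\<zero>\<^bsub>face_algebra A\<^esub> = (0 :: 'v set \<Rightarrow> 'k)" unfolding kF by (rule fa.zero_R)
  have add: "f \<oplus>\<^bsub>face_algebra A\<^esub> g = f + g" for f g :: "'v set \<Rightarrow> 'k" unfolding kF by (rule fa.add_R)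
  show "(\<Oplus>\<^bsub>face_algebra A\<^esub>i\<in>lat. e i) = \<one>\<^bsub>face_algebra A\<^esub>"
  proof -
    have "\<one>\<^bsub>face_algebra A\<^esub> = (\<delta> (\<Inter>A) :: 'v set \<Rightarrow> 'k)" unfolding kF by (subst fa.one_R) simp
    moreover have "(\<Oplus>\<^bsub>face_algebra A\<^esub>i\<in>lat. e i) = (\<Sum>i\<in>lat. e i)"
      unfolding kF by (rule fa.finsum_R) (rule e_carrier[unfolded kF])
    ultimately show ?thesis using e_sum by (simp only:)
  qed
  show "e X \<otimes>\<^bsub>face_algebra A\<^esub> e Y = \<zero>\<^bsub>face_algebra A\<^esub>" if "X \<in> lat" "Y \<in> lat" "X \<noteq> Y" for X Y
    using e_orth that e_carrier by (simp only: mult zero)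
  fix X assume X: "X \<in> lat"
  show "primitive_idempotent (face_algebra A) (e X)"
    unfolding primitive_idempotent_def
  proof (intro conjI notI)
    show "e X \<in> carrier (face_algebra A)" by (rule e_carrier[OF X])
    show "e X \<otimes>\<^bsub>face_algebra A\<^esub> e X = e X" using e_idem e_carrier X by (simp only: mult)
    show "e X = \<zero>\<^bsub>face_algebra A\<^esub> \<Longrightarrow> False" using e_neq_0[OF X] by (simp only: zero)
    assume "\<exists>f\<in>carrier (face_algebra A). \<exists>g\<in>carrier (face_algebra A). f \<noteq> \<zero>\<^bsub>face_algebra A\<^esub> \<and>
      g \<noteq> \<zero>\<^bsub>face_algebra A\<^esub> \<and> f \<otimes>\<^bsub>face_algebra A\<^esub> f = f \<and> g \<otimes>\<^bsub>face_algebra A\<^esub> g = g \<and>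
      f \<otimes>\<^bsub>face_algebra A\<^esub> g = \<zero>\<^bsub>face_algebra A\<^esub> \<and> g \<otimes>\<^bsub>face_algebra A\<^esub> f = \<zero>\<^bsub>face_algebra A\<^esub> \<and>
      e X = f \<oplus>\<^bsub>face_algebra A\<^esub> g"
    then obtain f g where c: "f \<in> carrier (face_algebra A)" "g \<in> carrier (face_algebra A)"
      and *: "f \<noteq> \<zero>\<^bsub>face_algebra A\<^esub> \<and>
      g \<noteq> \<zero>\<^bsub>face_algebra A\<^esub> \<and> f \<otimes>\<^bsub>face_algebra A\<^esub> f = f \<and> g \<otimes>\<^bsub>face_algebra A\<^esub> g = g \<and>
      f \<otimes>\<^bsub>face_algebra A\<^esub> g = \<zero>\<^bsub>face_algebra A\<^esub> \<and> g \<otimes>\<^bsub>face_algebra A\<^esub> f = \<zero>\<^bsub>face_algebra A\<^esub> \<and>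
      e X = f \<oplus>\<^bsub>face_algebra A\<^esub> g" by blast
    have nz: "f \<noteq> 0" "g \<noteq> 0" and fg: "fm f f = f" "fm g g = g" "fm f g = 0" "fm g f = 0" "e X = f + g"
      using * by (simp_all only: mult[OF c] mult[OF c(2,1)] mult[OF c(1,1)] mult[OF c(2,2)] zero add simp_thms)
    have "fm (e X) (fm f (e X)) = f" "fm (e X) (fm g (e X)) = g"
      by (simp_all only: fg bprod_add_left bprod_add_right add_0_left add_0_right bprod_0)
    \<comment> \<open>Both summands lie in the one-dimensional corner at \<open>e X\<close>, so they
      are multiples of \<open>e X\<close>, and orthogonality forces one of the scalars to
      vanish.\<close>
    then obtain a b where ab: "f = smul a (e X)" "g = smul b (e X)"
      using e_sandwich[OF X c(1)] e_sandwich[OF X c(2)] by metis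
    have "fm f g = smul (a * b) (e X)"
      by (simp only: ab bprod_smul_left bprod_smul_right e_idem[OF X] smul_smul mult.commute)
    then have "smul (a * b) (e X) = 0" using fg by simp
    moreover obtain x where "e X x \<noteq> 0" using e_neq_0[OF X] by (auto simp: fun_eq_iff)
    ultimately have "a * b = 0" by (auto simp: fun_eq_iff smul_apply)
    then have "f = 0 \<or> g = 0" unfolding ab by auto
    then show False using nz by blast
  qed
qed

end

section \<open>The image of a path\<close>

locale face_quiver = incidence_arrangement A I + face_idempotents A l e
  for A :: "'v::real_inner set set" and I :: "'v set \<Rightarrow> 'v set \<Rightarrow> 'v \<Rightarrow> 'k::field"
    and l e :: "'v set \<Rightarrow> 'v set \<Rightarrow> 'k"
begin

abbreviation "P \<equiv> quiver_paths lat"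

text \<open>In the basis \<open>x e\<^sub>X\<close> of \<open>kF e\<^sub>X\<close>, the image of a path \<open>p\<close> with first vertex \<open>X\<close> has the
  coordinates \<open>pathel p\<close>.\<close>

definition face_bdry :: "'v set \<Rightarrow> 'v set \<Rightarrow> 'v set \<Rightarrow> 'k" where
  "face_bdry X z = (\<Sum>x\<in>{x \<in> faces_on A X. face_le A z x}. smul (I (supp A z) X (rep x)) (\<delta> x))"

definition bdry :: "'v set \<Rightarrow> 'v set \<Rightarrow> ('v set \<Rightarrow> 'k) \<Rightarrow> 'v set \<Rightarrow> 'k" where
  "bdry Z X m = (\<Sum>z\<in>faces_on A Z. smul (m z) (face_bdry X z))"

fun pathel :: "'v set list \<Rightarrow> 'v set \<Rightarrow> 'k" where
  "pathel [] = 0"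
| "pathel [X] = l X"
| "pathel (X # Z # p) = bdry Z X (pathel (Z # p))"

section \<open>Paths in the quiver\<close>

lemma path_single: "[X] \<in> P \<longleftrightarrow> X \<in> lat" by (simp add: quiver_paths_def)

lemma path_Cons: "X # Z # p \<in> P \<longleftrightarrow> X \<in> lat \<and> hsec Z X \<and> Z # p \<in> P"
  by (auto simp: quiver_paths_def covered_by_iff)

lemma path_induct [consumes 1, case_names single Cons]:
  assumes "p \<in> P" and "\<And>X. X \<in> lat \<Longrightarrow> Q [X]"
    and "\<And>X Z p. X \<in> lat \<Longrightarrow> hsec Z X \<Longrightarrow> Z \<in> lat \<Longrightarrow> Z # p \<in> P \<Longrightarrow> Q (Z # p) \<Longrightarrow> Q (X # Z # p)"
  shows "Q p"
  using assms(1)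
proof (induction p rule: induct_list012)
  case 1
  then show ?case by (simp add: quiver_paths_def)
next
  case (2 X)
  then show ?case using assms(2) by (simp add: path_single)
next
  case (3 X Z p)
  then have "X \<in> lat" "hsec Z X" "Z # p \<in> P" by (simp_all add: path_Cons)
  moreover have "Z \<in> lat" using \<open>Z # p \<in> P\<close> by (simp add: quiver_paths_def)
  ultimately show ?case using 3 assms(3) by blast
qed

lemma path_lat: "p \<in> P \<Longrightarrow> p \<noteq> [] \<and> set p \<subseteq> lat"
  by (auto simp: quiver_paths_def)

lemma hd_lat: "p \<in> P \<Longrightarrow> hd p \<in> lat"
  using path_lat hd_in_set by blast

lemma last_lat: "p \<in> P \<Longrightarrow> last p \<in> lat"
  using path_lat last_in_set by blast

lemma path_below: "p \<in> P \<Longrightarrow> Y \<in> set p \<Longrightarrow> Y \<subseteq> hd p"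
proof (induction p rule: path_induct)
  case (Cons X Z p)
  then show ?case using hsec_subset[OF Cons(2)] by auto
qed simp

lemma last_below: "p \<in> P \<Longrightarrow> last p \<subseteq> hd p"
  using path_below path_lat last_in_set by blast

lemma path_distinct: "p \<in> P \<Longrightarrow> distinct p"
proof (induction p rule: path_induct)
  case (Cons X Z p)
  have "X \<notin> set (Z # p)" using path_below[OF Cons(4), of X] hsec_subset[OF Cons(2)] by auto
  then show ?case using Cons by simp
qed simp

lemma finite_P: "finite P"
proof (rule finite_subset)
  show "P \<subseteq> {xs. set xs \<subseteq> lat \<and> length xs \<le> card lat}"
  proof
    fix p assume p: "p \<in> P"
    then have "length p = card (set p)" using path_distinct distinct_card by fastforce
    then show "p \<in> {xs. set xs \<subseteq> lat \<and> length xs \<le> card lat}"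
      using path_lat[OF p] card_mono[OF finite_lattice] by auto
  qed
  show "finite {xs. set xs \<subseteq> lat \<and> length xs \<le> card lat}"
    by (rule finite_lists_length_le[OF finite_lattice])
qed

lemma path_append: "q \<in> P \<Longrightarrow> p \<in> P \<Longrightarrow> last q = hd p \<Longrightarrow> q @ tl p \<in> P"
proof (induction q rule: path_induct)
  case (single X)
  then show ?case by (cases p) (auto simp: quiver_paths_def)
next
  case (Cons X Z q)
  then show ?case by (simp add: path_Cons)
qed

section \<open>Left multiplication by faces and the boundary\<close>

lemma face_bdry_on: "face_bdry X z x \<noteq> 0 \<Longrightarrow> x \<in> faces_on A X"
proof (rule ccontr)
  assume "face_bdry X z x \<noteq> 0" "x \<notin> faces_on A X"
  moreover have "face_bdry X z x = 0" if "x \<notin> faces_on A X"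
    unfolding face_bdry_def sum_fun_apply smul_apply basis_elem_def
    by (rule sum.neutral) (use that in auto)
  ultimately show False by blast
qed

lemma bdry_on: "bdry Z X m x \<noteq> 0 \<Longrightarrow> x \<in> faces_on A X"
proof (rule ccontr)
  assume "bdry Z X m x \<noteq> 0" "x \<notin> faces_on A X"
  moreover have "bdry Z X m x = 0" if "x \<notin> faces_on A X"
    unfolding bdry_def sum_fun_apply smul_apply
    by (rule sum.neutral) (use that face_bdry_on in auto)
  ultimately show False by blast
qed

lemma pathel_on: "p \<in> P \<Longrightarrow> pathel p x \<noteq> 0 \<Longrightarrow> x \<in> faces_on A (hd p)"
  by (induction p rule: path_induct) (auto intro: bdry_on l_on)

lemma face_bdry_two:
  assumes X: "X \<in> lat" "hsec (flat_of A w) X" and u: "u \<in> X" "u \<notin> flat_of A w"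
  shows "face_bdry X (face_of A w) = smul (I (flat_of A w) X u) (\<delta> (face_of A (near A w u)) - \<delta> (face_of A (near A w (- u))))"
proof -
  have mu: "- u \<in> X" "- u \<notin> flat_of A w"
    using u lattice_subspace[OF X(1)] subspace_flat_of[of w] by (auto dest: subspace_neg)
  have "face_bdry X (face_of A w) = smul (I (flat_of A w) X u) (\<delta> (face_of A (near A w u)))
      + smul (I (flat_of A w) X (- u)) (\<delta> (face_of A (near A w (- u))))"
    unfolding face_bdry_def faces_on_def mem_Collect_eq conj_assoc two_faces_above(1)[OF assms] supp_face_of
    using two_faces_above(2)[OF assms] inc_rep_near[OF assms] inc_rep_near[OF X mu] by simp
  then show ?thesis by (simp only: inc_minus[OF flat_in_lattice X u] smul_minus smul_diff add_uminus_conv_diff)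
qed

text \<open>\<open>y\<close> moves the two neighbours of \<open>z\<close> to the neighbours of
  \<open>y z\<close> in the same directions \<open>u\<close> and \<open>- u\<close>, so the
  incidence numbers do not change.\<close>

lemma act_face_bdry:
  assumes X: "X \<in> lat" "hsec Z X" and z: "z \<in> faces_on A Z" and y: "y \<in> F" "supp A y \<subseteq> Z"
  shows "fm (\<delta> y) (face_bdry X z) = face_bdry X (fmult y z)"
proof -
  obtain w where w: "z = face_of A w" "flat_of A w = Z" using z by (auto simp: faces_on_def faces_eq)
  obtain a where a: "y = face_of A a" using y by (auto simp: faces_eq)
  obtain u where u: "u \<in> X" "u \<notin> Z" using hsec_subset[OF X(2)] by blast
  have fZ: "flat_of A (near A a w) = Z"
    using supp_fmult_eq[OF y(1), of z] y(2) a w by simp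
  have e: "face_of A (near A a (near A w v)) = face_of A (near A (near A a w) v)" for v
    by (simp add: face_of_eq_iff near_hsgn)
  have "fm (\<delta> y) (face_bdry X z) = smul (I Z X u) (\<delta> (face_of A (near A a (near A w u))) - \<delta> (face_of A (near A a (near A w (- u)))))"
    unfolding w(1) a using face_bdry_two[OF X(1), of w u] X u w(2)
    by (simp add: bprod_smul_right bprod_diff_right fm_delta)
  also have "\<dots> = face_bdry X (fmult y z)"
    unfolding w(1) a face_mult_face_of e using face_bdry_two[OF X(1), of "near A a w" u] X u fZ by simp
  finally show ?thesis .
qed

text \<open>A hyperplane left undecided by both \<open>y\<close> and \<open>z\<close> contains
  \<open>Z\<close> and a vector of \<open>X\<close> outside \<open>Z\<close>, hence
  \<open>X\<close>. So \<open>y\<close> sends the two neighbours of \<open>z\<close> to the same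
  face and their difference disappears.\<close>

lemma act_face_bdry_zero:
  assumes X: "X \<in> lat" "hsec Z X" and z: "z \<in> faces_on A Z"
    and y: "y \<in> F" "supp A y \<subseteq> X" "\<not> supp A y \<subseteq> Z"
  shows "fm (\<delta> y) (face_bdry X z) = 0"
proof -
  obtain w where w: "z = face_of A w" "flat_of A w = Z" using z by (auto simp: faces_on_def faces_eq)
  obtain a where a: "y = face_of A a" using y by (auto simp: faces_eq)
  obtain b where b: "b \<in> flat_of A a" "b \<notin> Z" "b \<in> X" using y a by auto
  obtain u where u: "u \<in> X" "u \<notin> Z" using hsec_subset[OF X(2)] by blast
  have "hsgn H (near A a (near A w u)) = hsgn H (near A a (near A w (- u)))" if H: "H \<in> A" for H
  proof (cases "a \<in> H \<and> w \<in> H")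
    case True
    then have bH: "b \<in> H" "Z \<subseteq> H" using H b(1) w(2) flat_of_subset_iff mem_flat_of by blast+
    obtain c v where "v \<in> Z" "u = c *\<^sub>R b + v" using hsec_decomp[OF X(2) b(3,2) u(1)] .
    then have "u \<in> H" using bH subspace_hyp[OF H] by (auto simp: subspace_add subspace_scale)
    then have "hsgn H u = 0" using H hsgn_0_iff by blast
    then show ?thesis using H by (simp add: near_hsgn hsgn_minus)
  next
    case False
    then have "hsgn H a \<noteq> 0 \<or> hsgn H w \<noteq> 0" using H hsgn_0_iff by blast
    then show ?thesis using H by (auto simp: near_hsgn)
  qed
  then have e: "face_of A (near A a (near A w u)) = face_of A (near A a (near A w (- u)))"
    by (simp add: face_of_eq_iff)
  have "fm (\<delta> y) (face_bdry X z) = smul (I Z X u) (\<delta> (face_of A (near A a (near A w u))) - \<delta> (face_of A (near A a (near A w (- u)))))"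
    unfolding w(1) a using face_bdry_two[OF X(1), of w u] X u w(2)
    by (simp add: bprod_smul_right bprod_diff_right fm_delta)
  then show ?thesis unfolding e by (simp only: diff_self smul_0)
qed

lemma bdry_act:
  assumes X: "X \<in> lat" "hsec Z X" "Z \<in> lat" and y: "y \<in> F" "supp A y \<subseteq> Z"
    and m: "\<And>z. m z \<noteq> 0 \<Longrightarrow> z \<in> faces_on A Z"
  shows "fm (\<delta> y) (bdry Z X m) = bdry Z X (fm (\<delta> y) m)"
proof -
  have cl: "fmult y z \<in> faces_on A Z" if "z \<in> faces_on A Z" for z
    using that supp_fmult_eq[OF y(1), of z] y fmult_closed[OF y(1)] by (auto simp: faces_on_def)
  have 1: "fm (\<delta> y) (bdry Z X m) = (\<Sum>z\<in>faces_on A Z. smul (m z) (face_bdry X (fmult y z)))"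
    unfolding bdry_def bprod_sum_right bprod_smul_right
    by (intro sum.cong refl) (simp add: act_face_bdry[OF X(1,2) _ y])
  have 2: "fm (\<delta> y) m = (\<Sum>z\<in>faces_on A Z. smul (m z) (\<delta> (fmult y z)))"
    by (rule fm_delta_on[OF finite_on on_subset m y(1)])
  have "bdry Z X (fm (\<delta> y) m) = (\<Sum>z'\<in>faces_on A Z. \<Sum>z\<in>faces_on A Z.
      smul (m z * \<delta> (fmult y z) z') (face_bdry X z'))"
    unfolding bdry_def 2 by (simp only: sum_fun_apply smul_apply smul_sum_left)
  also have "\<dots> = (\<Sum>z\<in>faces_on A Z. \<Sum>z'\<in>faces_on A Z. smul (m z * \<delta> (fmult y z) z') (face_bdry X z'))"
    by (rule sum.swap)
  also have "\<dots> = (\<Sum>z\<in>faces_on A Z. smul (m z) (face_bdry X (fmult y z)))"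
  proof (intro sum.cong refl)
    fix z assume z: "z \<in> faces_on A Z"
    have "(\<Sum>z'\<in>faces_on A Z. smul (m z * \<delta> (fmult y z) z') (face_bdry X z')) =
        (\<Sum>z'\<in>faces_on A Z. if z' = fmult y z then smul (m z) (face_bdry X z') else 0)"
      by (intro sum.cong refl) (auto simp: basis_elem_def)
    then show "(\<Sum>z'\<in>faces_on A Z. smul (m z * \<delta> (fmult y z) z') (face_bdry X z')) = smul (m z) (face_bdry X (fmult y z))"
      using cl[OF z] finite_on by simp
  qed
  finally show ?thesis using 1 by (simp only:)
qed

lemma bdry_0[simp]: "bdry Z X 0 = 0" by (simp add: bdry_def)

text \<open>Some step of the path leads from a flat that contains the support of \<open>y\<close> to
  one that does not. \<open>y\<close> commutes with the boundaries before that step and annihilates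
  the boundary of the step itself.\<close>

lemma act_pathel_zero:
  assumes "p \<in> P" "y \<in> F" "supp A y \<subseteq> hd p" "\<not> supp A y \<subseteq> last p"
  shows "fm (\<delta> y) (pathel p) = 0"
  using assms(1,3,4)
proof (induction p rule: path_induct)
  case (Cons X Z p)
  note m = pathel_on[OF Cons(4)]
  show ?case
  proof (cases "supp A y \<subseteq> Z")
    case True
    have "fm (\<delta> y) (pathel (Z # p)) = 0"
      by (rule Cons(5)) (use Cons(7) True in simp_all)
    moreover have "fm (\<delta> y) (bdry Z X (pathel (Z # p))) = bdry Z X (fm (\<delta> y) (pathel (Z # p)))"
      by (rule bdry_act[OF Cons(1,2,3) assms(2) True]) (use m in simp)
    ultimately show ?thesis by (simp only: pathel.simps bdry_0)
  next
    case False
    have "fm (\<delta> y) (face_bdry X z) = 0" if "z \<in> faces_on A Z" for z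
      using act_face_bdry_zero[OF Cons(1,2) that assms(2)] Cons False by simp
    then show ?thesis
      unfolding pathel.simps bdry_def bprod_sum_right bprod_smul_right by (simp only: smul_0 sum.neutral_const cong: sum.cong)
  qed
qed simp

text \<open>The faces in \<open>pathel p\<close> have support \<open>hd p\<close>, which lies in
  every flat of \<open>q\<close>. They pass through all boundaries of \<open>q\<close> until they
  meet \<open>l (hd p)\<close>, a right identity for them.\<close>

lemma fm_pathel:
  assumes "q \<in> P" "p \<in> P" "last q = hd p"
  shows "fm (pathel p) (pathel q) = pathel (q @ tl p)"
  using assms(1,3)
proof (induction q rule: path_induct)
  case (single X)
  then have "[X] @ tl p = p" using path_lat[OF assms(2)] by auto
  moreover have "fm (pathel p) (l X) = pathel p"
    by (rule mult_l[of X "faces_on A X"]) (use single pathel_on[OF assms(2)] on_subset in \<open>auto simp: faces_on_def\<close>)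
  ultimately show ?case by simp
next
  case (Cons X Z q)
  have l: "last (Z # q) = hd p" using Cons by simp
  have lZ: "hd p \<subseteq> Z" using last_below[OF Cons(4)] l by simp
  let ?S = "faces_on A (hd p)"
  have S: "\<And>y. pathel p y \<noteq> 0 \<Longrightarrow> y \<in> ?S" by (rule pathel_on[OF assms(2)])
  have "fm (pathel p) (pathel (X # Z # q)) = (\<Sum>y\<in>?S. smul (pathel p y) (fm (\<delta> y) (bdry Z X (pathel (Z # q)))))"
    unfolding pathel.simps by (rule fm_on[OF on_subset S])
  also have "\<dots> = (\<Sum>y\<in>?S. smul (pathel p y) (bdry Z X (fm (\<delta> y) (pathel (Z # q)))))"
  proof (intro sum.cong refl)
    fix y assume y: "y \<in> ?S"
    then have "y \<in> F" "supp A y \<subseteq> Z" using lZ by (auto simp: faces_on_def)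
    then show "smul (pathel p y) (fm (\<delta> y) (bdry Z X (pathel (Z # q)))) =
       smul (pathel p y) (bdry Z X (fm (\<delta> y) (pathel (Z # q))))"
      using bdry_act[OF Cons(1,2,3)] pathel_on[OF Cons(4)] by simp
  qed
  also have "\<dots> = bdry Z X (\<Sum>y\<in>?S. smul (pathel p y) (fm (\<delta> y) (pathel (Z # q))))"
    unfolding bdry_def smul_sum sum_fun_apply smul_apply smul_sum_left smul_smul by (rule ext) (rule sum.swap)
  also have "(\<Sum>y\<in>?S. smul (pathel p y) (fm (\<delta> y) (pathel (Z # q)))) = fm (pathel p) (pathel (Z # q))"
    by (rule fm_on[OF on_subset S, symmetric])
  also have "\<dots> = pathel ((Z # q) @ tl p)" using Cons l by simp
  finally show ?case by simp
qed

definition pathim :: "'v set list \<Rightarrow> 'v set \<Rightarrow> 'k" where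
  "pathim p = fm (pathel p) (e (hd p))"

section \<open>Images of paths multiply like paths\<close>

lemma act_pathim_zero:
  assumes "p \<in> P" "y \<in> F" "\<not> supp A y \<subseteq> last p"
  shows "fm (\<delta> y) (pathim p) = 0"
proof (cases "supp A y \<subseteq> hd p")
  case True
  then have "fm (\<delta> y) (pathel p) = 0" using act_pathel_zero assms by blast
  then show ?thesis unfolding pathim_def fa.bprod_assoc[symmetric] by (simp only: bprod_0)
next
  case False
  let ?X = "hd p"
  have "pathim p = (\<Sum>x\<in>faces_on A ?X. smul (pathel p x) (fm (\<delta> x) (e ?X)))"
    unfolding pathim_def by (rule fm_on[OF on_subset]) (rule pathel_on[OF assms(1)])
  then have "fm (\<delta> y) (pathim p) = (\<Sum>x\<in>faces_on A ?X. smul (pathel p x) (fm (\<delta> y) (fm (\<delta> x) (e ?X))))"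
    by (simp only: bprod_sum_right bprod_smul_right)
  also have "\<dots> = (\<Sum>x\<in>faces_on A ?X. 0)"
  proof (intro sum.cong refl)
    fix x assume "x \<in> faces_on A ?X"
    then have x: "x \<in> F" "supp A x = ?X" by (auto simp: faces_on_def)
    have "\<not> supp A (fmult y x) \<subseteq> ?X" using supp_fmult(1)[OF assms(2) x(1)] False by blast
    then have "fm (\<delta> (fmult y x)) (e ?X) = 0"
      using act_e_zero[OF hd_lat[OF assms(1)] fmult_closed[OF assms(2) x(1)]] by blast
    then show "smul (pathel p x) (fm (\<delta> y) (fm (\<delta> x) (e ?X))) = 0"
      by (simp only: fm_delta_act[OF assms(2) x(1)] smul_0)
  qed
  finally show ?thesis by (simp only: sum.neutral_const)
qed

text \<open>The faces of larger support in \<open>e (last p)\<close> kill the image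
  (\<open>act_pathim_zero\<close>), so \<open>e (last p)\<close> acts like
  \<open>l (last p)\<close>, that is, like the trivial path at the end.\<close>

lemma e_pathim_last:
  assumes "p \<in> P"
  shows "fm (e (last p)) (pathim p) = pathim p"
proof -
  let ?Y = "last p"
  have Y: "?Y \<in> lat" by (rule last_lat[OF assms])
  have "fm (e ?Y) (pathim p) = (\<Sum>x\<in>F. smul (e ?Y x) (fm (\<delta> x) (pathim p)))"
    by (rule fm_expand[OF e_carrier[OF Y]])
  also have "\<dots> = (\<Sum>x\<in>faces_on A ?Y. smul (l ?Y x) (fm (\<delta> x) (pathim p)))"
  proof (rule sum.mono_neutral_cong_right[OF finite_faces on_subset])
    show "\<forall>x\<in>F - faces_on A ?Y. smul (e ?Y x) (fm (\<delta> x) (pathim p)) = 0"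
    proof
      fix x assume x: "x \<in> F - faces_on A ?Y"
      show "smul (e ?Y x) (fm (\<delta> x) (pathim p)) = 0"
      proof (cases "e ?Y x = 0")
        case False
        then have "\<not> supp A x \<subseteq> ?Y" using e_nonzero[OF Y False] x by (auto simp: faces_on_def)
        then have "fm (\<delta> x) (pathim p) = 0" using act_pathim_zero[OF assms] x by blast
        then show ?thesis by (simp only: smul_0)
      qed (simp only: smul_0)
    qed
    show "smul (e ?Y x) (fm (\<delta> x) (pathim p)) = smul (l ?Y x) (fm (\<delta> x) (pathim p))"
      if "x \<in> faces_on A ?Y" for x using e_top[OF Y, of x] that by (simp add: faces_on_def)
  qed
  also have "\<dots> = fm (l ?Y) (pathim p)" by (rule fm_l[OF Y, symmetric])
  also have "\<dots> = fm (fm (pathel [?Y]) (pathel p)) (e (hd p))" by (simp add: pathim_def fa.bprod_assoc)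
  also have "fm (pathel [?Y]) (pathel p) = pathel p"
    using fm_pathel[OF assms, of "[?Y]"] Y by (simp add: path_single)
  finally show ?thesis by (simp only: pathim_def)
qed

lemma e_pathim:
  assumes "p \<in> P" "Y \<in> lat"
  shows "fm (e Y) (pathim p) = (if Y = last p then pathim p else 0)"
proof (cases "Y = last p")
  case False
  have "fm (e Y) (pathim p) = fm (fm (e Y) (e (last p))) (pathim p)"
    by (simp only: fa.bprod_assoc e_pathim_last[OF assms(1)])
  then show ?thesis using False e_orth[OF assms(2) last_lat[OF assms(1)] False] by (simp only: bprod_0 if_False)
qed (use e_pathim_last assms in simp)

lemma pathim_e:
  assumes "p \<in> P" "X \<in> lat"
  shows "fm (pathim p) (e X) = (if X = hd p then pathim p else 0)"
proof (cases "X = hd p")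
  case True
  then show ?thesis using e_idem[OF assms(2)] by (simp add: pathim_def fa.bprod_assoc)
next
  case False
  have "fm (e (hd p)) (e X) = 0" by (rule e_orth[OF hd_lat[OF assms(1)] assms(2)]) (use False in blast)
  then show ?thesis using False by (simp only: pathim_def fa.bprod_assoc bprod_0 if_False)
qed

text \<open>The zero products come from orthogonality of the idempotents at the vertices, all others
  from \<open>fm_pathel\<close>.\<close>

lemma pathim_mult:
  assumes "p \<in> P" "q \<in> P"
  shows "fm (pathim p) (pathim q) = (if last q = hd p then pathim (q @ tl p) else 0)"
proof -
  have *: "fm (pathim p) (pathim q) = fm (pathel p) (fm (e (hd p)) (pathim q))"
    by (simp only: pathim_def[of p] fa.bprod_assoc)
  show ?thesis
  proof (cases "last q = hd p")
    case True
    then have "fm (pathim p) (pathim q) = fm (fm (pathel p) (pathel q)) (e (hd q))"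
      unfolding * using e_pathim[OF assms(2) hd_lat[OF assms(1)]] by (simp add: pathim_def fa.bprod_assoc)
    then show ?thesis using True fm_pathel[OF assms(2,1) True] path_lat[OF assms(2)] by (simp add: pathim_def)
  next
    case False
    have z: "fm (e (hd p)) (pathim q) = 0"
      by (subst e_pathim[OF assms(2) hd_lat[OF assms(1)]], rule if_not_P) (use False in blast)
    show ?thesis unfolding * z using False by (simp only: if_False bprod_0)
  qed
qed

lemma pathim_single: "X \<in> lat \<Longrightarrow> pathim [X] = e X"
  by (simp add: pathim_def l_e)

lemma pathim_carrier: "pathim p \<in> carrier (face_algebra A)"
  unfolding pathim_def face_algebra_def by (rule fa.bprod_closed)

lemma pathim_top: "p \<in> P \<Longrightarrow> x \<in> faces_on A (hd p) \<Longrightarrow> pathim p x = pathel p x"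
  unfolding pathim_def by (rule fm_e_top[OF hd_lat _ pathel_on])

text \<open>\<open>bdry\<close> and \<open>cob\<close> are transposes of each other; this carries
  statements about cochains over to the images of paths.\<close>

lemma bdry_cob:
  "(\<Sum>x\<in>faces_on A X. bdry Z X m x * g x) = (\<Sum>z\<in>faces_on A Z. m z * cob A I X g z)"
proof -
  have b: "(\<Sum>x\<in>faces_on A X. face_bdry X z x * g x) = cob A I X g z" for z
  proof -
    have "(\<Sum>x\<in>faces_on A X. face_bdry X z x * g x) =
        (\<Sum>x\<in>faces_on A X. \<Sum>y\<in>{x \<in> faces_on A X. face_le A z x}. if y = x then I (supp A z) X (rep y) * g y else 0)"
      unfolding face_bdry_def sum_fun_apply sum_distrib_right
      by (intro sum.cong refl) (auto simp: smul_apply basis_elem_def)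
    also have "\<dots> = (\<Sum>y\<in>{x \<in> faces_on A X. face_le A z x}. \<Sum>x\<in>faces_on A X. if y = x then I (supp A z) X (rep y) * g y else 0)"
      by (rule sum.swap)
    also have "\<dots> = cob A I X g z"
      unfolding cob_def by (intro sum.cong refl) (simp add: finite_on)
    finally show ?thesis .
  qed
  have "(\<Sum>x\<in>faces_on A X. bdry Z X m x * g x) = (\<Sum>x\<in>faces_on A X. \<Sum>z\<in>faces_on A Z. m z * (face_bdry X z x * g x))"
    by (simp add: bdry_def sum_fun_apply smul_apply sum_distrib_right mult.assoc)
  also have "\<dots> = (\<Sum>z\<in>faces_on A Z. \<Sum>x\<in>faces_on A X. m z * (face_bdry X z x * g x))" by (rule sum.swap)
  also have "\<dots> = (\<Sum>z\<in>faces_on A Z. m z * cob A I X g z)" by (simp add: b flip: sum_distrib_left)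
  finally show ?thesis .
qed

text \<open>Paired against functions on the faces, the elements attached to the paths with first vertex \<open>X\<close>
  span: this is the surjectivity of the quiver presentation.\<close>

lemma pairing_zero:
  assumes "X \<in> lat" "\<And>p. p \<in> P \<Longrightarrow> hd p = X \<Longrightarrow> (\<Sum>x\<in>faces_on A X. pathel p x * g x) = 0" "x \<in> faces_on A X"
  shows "g x = 0"
  using assms
proof (induction "card {Y \<in> lat. Y \<subset> X}" arbitrary: X g x rule: less_induct)
  case less
  have cob0: "cob A I X g z = 0" if z: "z \<in> F" "hsec (supp A z) X" for z
  proof -
    let ?Z = "supp A z"
    have Z: "?Z \<in> lat" using supp_lat z by blast
    have "{Y \<in> lat. Y \<subset> ?Z} \<subset> {Y \<in> lat. Y \<subset> X}" using hsec_subset[OF z(2)] Z by blast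
    then have "card {Y \<in> lat. Y \<subset> ?Z} < card {Y \<in> lat. Y \<subset> X}"
      using finite_lattice by (intro psubset_card_mono) auto
    moreover have "(\<Sum>y\<in>faces_on A ?Z. pathel p y * cob A I X g y) = 0" if p: "p \<in> P" "hd p = ?Z" for p
    proof -
      obtain p' where p': "p = ?Z # p'" using p path_lat by (metis list.collapse)
      then have "X # p \<in> P" using p less.prems z by (simp add: path_Cons)
      then have "(\<Sum>x\<in>faces_on A X. pathel (X # p) x * g x) = 0" using less.prems(2) by simp
      then show ?thesis using bdry_cob[of ?Z X "pathel p" g] p' by simp
    qed
    ultimately show ?thesis using less.hyps[OF _ Z, of "cob A I X g" z] z by (simp add: faces_on_def)
  qed
  \<comment> \<open>By induction the coboundary of \<open>g\<close> vanishes, so \<open>g\<close> is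
    constant; pairing it with the trivial path \<open>[X]\<close> then shows that the constant is
    0.\<close>
  have c: "g y = g x" if "y \<in> faces_on A X" for y
    by (rule constant_of_cob_zero[OF less.prems(1) that less.prems(3) cob0])
  have "0 = (\<Sum>y\<in>faces_on A X. pathel [X] y * g y)"
    using less.prems(2)[of "[X]"] less.prems(1) by (simp add: path_single)
  also have "\<dots> = (\<Sum>y\<in>faces_on A X. l X y) * g x"
    unfolding sum_distrib_right by (intro sum.cong) (auto simp: c)
  also have "\<dots> = g x" using l_sum[OF less.prems(1)] by simp
  finally show ?case by simp
qed

text \<open>A functional on the paths that kills the relations comes from a function on the faces: this is
  the injectivity of the quiver presentation, proved in dual form.\<close>

lemma pairing_exists:
  assumes "X \<in> lat" "\<And>q p. q \<in> P \<Longrightarrow> p \<in> P \<Longrightarrow> hd q = X \<Longrightarrow> (\<Sum>Z\<in>mid A (hd p) (last q). \<mu> (q @ Z # p)) = (0::'k)"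
  shows "\<exists>g. \<forall>p\<in>P. hd p = X \<longrightarrow> (\<Sum>x\<in>faces_on A X. pathel p x * g x) = \<mu> p"
  using assms
proof (induction "card {Y \<in> lat. Y \<subset> X}" arbitrary: X \<mu> rule: less_induct)
  case less
  \<comment> \<open>Prefixing \<open>X\<close> turns \<open>\<mu>\<close> into a functional on the
    paths from \<open>Z\<close> with the same relations. The solutions for all walls
    \<open>Z\<close> together form a candidate for a coboundary on \<open>X\<close>.\<close>
  have "\<exists>g. \<forall>p\<in>P. hd p = Z \<longrightarrow> (\<Sum>z\<in>faces_on A Z. pathel p z * g z) = \<mu> (X # p)"
    if Z: "Z \<in> lat" "hsec Z X" for Z
  proof (rule less.hyps[OF _ Z(1)])
    have "{Y \<in> lat. Y \<subset> Z} \<subset> {Y \<in> lat. Y \<subset> X}" using hsec_subset[OF Z(2)] Z by blast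
    then show "card {Y \<in> lat. Y \<subset> Z} < card {Y \<in> lat. Y \<subset> X}"
      using finite_lattice by (intro psubset_card_mono) auto
    fix q p assume qp: "q \<in> P" "p \<in> P" "hd q = Z"
    then obtain q' where q': "q = Z # q'" using path_lat by (metis list.collapse)
    then have "X # q \<in> P" using qp less.prems Z by (simp add: path_Cons)
    then show "(\<Sum>Y\<in>mid A (hd p) (last q). \<mu> (X # q @ Y # p)) = 0"
      using less.prems(2)[of "X # q" p] qp q' by simp
  qed
  then obtain gs where gs: "\<And>Z p. Z \<in> lat \<Longrightarrow> hsec Z X \<Longrightarrow> p \<in> P \<Longrightarrow> hd p = Z \<Longrightarrow>
      (\<Sum>z\<in>faces_on A Z. pathel p z * gs Z z) = \<mu> (X # p)" by metis
  define f where "f z = gs (supp A z) z" for z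
  have f: "(\<Sum>z\<in>faces_on A Z. pathel p z * f z) = \<mu> (X # p)"
    if "Z \<in> lat" "hsec Z X" "p \<in> P" "hd p = Z" for Z p
    using gs[OF that] by (simp add: f_def faces_on_def)
  have "\<exists>g. \<forall>z\<in>F. hsec (supp A z) X \<longrightarrow> cob A I X g z = f z"
  proof (rule coboundary_of_cocycle[OF less.prems(1)])
    fix w assume w: "w \<in> F"
    let ?W = "supp A w"
    show "(\<Sum>Z\<in>mid A ?W X. cob A I Z f w) = 0"
    \<comment> \<open>The failure of the cocycle condition is itself a function on the faces of
      support \<open>?W\<close>. By the relations it pairs to zero with every path, so it
      vanishes.\<close>
    proof (rule pairing_zero[of ?W "\<lambda>w. \<Sum>Z\<in>mid A ?W X. cob A I Z f w"])
      show "?W \<in> lat" "w \<in> faces_on A ?W" using w supp_lat by (auto simp: faces_on_def)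
      fix p assume p: "p \<in> P" "hd p = ?W"
      have "(\<Sum>x\<in>faces_on A ?W. pathel p x * (\<Sum>Z\<in>mid A ?W X. cob A I Z f x)) =
          (\<Sum>x\<in>faces_on A ?W. \<Sum>Z\<in>mid A ?W X. pathel p x * cob A I Z f x)"
        by (simp only: sum_distrib_left)
      also have "\<dots> = (\<Sum>Z\<in>mid A ?W X. \<Sum>x\<in>faces_on A ?W. pathel p x * cob A I Z f x)"
        by (rule sum.swap)
      also have "\<dots> = (\<Sum>Z\<in>mid A ?W X. \<mu> (X # Z # p))"
      proof (intro sum.cong refl)
        fix Z assume "Z \<in> mid A ?W X"
        then have Z: "Z \<in> lat" "hsec ?W Z" "hsec Z X" by (auto simp: mid_def)
        obtain p' where p': "p = ?W # p'" using p path_lat by (metis list.collapse)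
        have "Z # p \<in> P" using p p' Z by (simp add: path_Cons)
        then have "(\<Sum>z\<in>faces_on A Z. pathel (Z # p) z * f z) = \<mu> (X # Z # p)" using f Z by simp
        then show "(\<Sum>x\<in>faces_on A ?W. pathel p x * cob A I Z f x) = \<mu> (X # Z # p)"
          using bdry_cob[of ?W Z "pathel p" f] p' by simp
      qed
      also have "\<dots> = 0" using less.prems(2)[of "[X]" p] less.prems(1) p by (simp add: path_single)
      finally show "(\<Sum>x\<in>faces_on A ?W. pathel p x * (\<Sum>Z\<in>mid A ?W X. cob A I Z f x)) = 0" .
    qed
  qed
  then obtain g0 where g0: "\<And>z. z \<in> F \<Longrightarrow> hsec (supp A z) X \<Longrightarrow> cob A I X g0 z = f z" by blast
  \<comment> \<open>A constant has no coboundary, so adding it leaves the pairings with the longer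
    paths alone; this one corrects the value on the trivial path \<open>[X]\<close>.\<close>
  define c where "c = \<mu> [X] - (\<Sum>x\<in>faces_on A X. l X x * g0 x)"
  define g where "g = (\<lambda>x. g0 x + c)"
  have "(\<Sum>x\<in>faces_on A X. pathel p x * g x) = \<mu> p" if p: "p \<in> P" "hd p = X" for p
  proof -
    obtain p0 where p0: "p = X # p0" using p path_lat by (metis list.collapse)
    show ?thesis
    proof (cases p0)
      case Nil
      have "(\<Sum>x\<in>faces_on A X. l X x * g x) = (\<Sum>x\<in>faces_on A X. l X x * g0 x) + (\<Sum>x\<in>faces_on A X. l X x) * c"
        by (simp add: g_def distrib_left sum.distrib sum_distrib_right)
      then show ?thesis using Nil p0 l_sum[OF less.prems(1)] by (simp add: c_def)
    next
      case (Cons Z p1)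
      then have Z: "hsec Z X" "p0 \<in> P" using p p0 by (simp_all add: path_Cons)
      have ZL: "Z \<in> lat" using hd_lat[OF Z(2)] Cons by simp
      have "(\<Sum>x\<in>faces_on A X. pathel p x * g x) = (\<Sum>z\<in>faces_on A Z. pathel p0 z * cob A I X g z)"
        using bdry_cob[of Z X "pathel p0" g] Cons p0 by simp
      also have "\<dots> = (\<Sum>z\<in>faces_on A Z. pathel p0 z * f z)"
      proof (intro sum.cong refl)
        fix z assume "z \<in> faces_on A Z"
        then have z: "z \<in> F" "hsec (supp A z) X" using Z by (auto simp: faces_on_def)
        show "pathel p0 z * cob A I X g z = pathel p0 z * f z"
          unfolding g_def cob_add cob_const[OF less.prems(1) z] using g0[OF z] by simp
      qed
      also have "\<dots> = \<mu> p" using f[OF ZL Z] Cons p0 by simp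
      finally show ?thesis .
    qed
  qed
  then show ?case by blast
qed

end

section \<open>Orientations\<close>

lemma sign_cancel:
  fixes a x y :: int
  assumes "a * a = 1" "a * x = y"
  shows "x = a * y"
proof -
  have "a * y = (a * a) * x" using assms(2) by (simp add: mult.assoc)
  then show ?thesis using assms(1) by simp
qed

lemma ordered_basis_exists:
  fixes X :: "'v::real_vector set"
  assumes "\<exists>B :: 'v set. finite B \<and> span B = UNIV" "subspace X"
  obtains bs where "ordered_basis X bs"
proof -
  obtain C :: "'v set" where C: "finite C" "span C = UNIV" using assms(1) by blast
  obtain B where B: "B \<subseteq> X" "independent B" "X \<subseteq> span B" using real_vector.maximal_independent_subset .
  have "finite B" using real_vector.independent_span_bound[OF C(1) B(2)] C(2) by simp
  then obtain bs where "set bs = B" "distinct bs" using finite_distinct_list by blast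
  moreover have "span B = X" using B span_minimal[OF B(1) assms(2)] by blast
  ultimately show thesis using that[of bs] B by (simp add: ordered_basis_def)
qed

lemma ordered_basis_snoc:
  assumes "ordered_basis W bs" "hsec W Z" "u \<in> Z" "u \<notin> W"
  shows "ordered_basis Z (bs @ [u])"
proof -
  have bs: "distinct bs" "independent (set bs)" "span (set bs) = W" using assms(1) by (auto simp: ordered_basis_def)
  have "u \<notin> set bs" using assms(4) bs(3) span_base by blast
  moreover have "independent (insert u (set bs))" using bs assms(4) by (simp add: independent_insert)
  moreover have "span (insert u (set bs)) = Z"
  proof (rule antisym)
    have "set bs \<subseteq> Z" using bs(3) span_superset hsec_subset[OF assms(2)] by blast
    then show "span (insert u (set bs)) \<subseteq> Z"
      using assms(3) hsec_subspace(1)[OF assms(2)] by (intro span_minimal) auto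
    show "Z \<subseteq> span (insert u (set bs))"
    proof
      fix x assume "x \<in> Z"
      then obtain c w where "w \<in> W" "x = c *\<^sub>R u + w" using hsec_decomp[OF assms(2,3,4)] by blast
      moreover have "w \<in> span (insert u (set bs))" using \<open>w \<in> W\<close> bs(3) span_mono[of "set bs" "insert u (set bs)"] by blast
      moreover have "c *\<^sub>R u \<in> span (insert u (set bs))" by (intro span_scale span_base) simp
      ultimately show "x \<in> span (insert u (set bs))" using span_add by blast
    qed
  qed
  ultimately show ?thesis using bs by (simp add: ordered_basis_def)
qed

lemma ordered_basis_length:
  assumes "ordered_basis X bs" "ordered_basis X cs"
  shows "length bs = length cs"
proof -
  have b: "distinct bs" "independent (set bs)" "span (set bs) = X" "distinct cs" "independent (set cs)" "span (set cs) = X"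
    using assms by (auto simp: ordered_basis_def)
  have "set bs \<subseteq> span (set cs)" "set cs \<subseteq> span (set bs)" using b(3,6) span_superset[of "set bs"] span_superset[of "set cs"] by auto
  then have "card (set bs) = card (set cs)"
    using real_vector.independent_span_bound[of "set cs" "set bs"] real_vector.independent_span_bound[of "set bs" "set cs"] b
    by auto
  then show ?thesis using b by (simp add: distinct_card)
qed

lemma change_of_basis_self:
  assumes "ordered_basis X bs"
  shows "change_of_basis bs bs = 1\<^sub>m (length bs)"
  using assms by (intro eq_matI)
    (auto simp: change_of_basis_def ordered_basis_def real_vector.representation_basis nth_eq_iff_index_eq)

text \<open>The matrix is block upper triangular with \<open>c\<close> as its last diagonal entry:
  the new vector may involve the old basis, but vectors of \<open>W\<close> do not involve
  \<open>u\<close>.\<close>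

lemma det_change_of_basis_snoc:
  assumes bs: "ordered_basis W bs" and cs: "ordered_basis W cs"
    and Z: "hsec W Z" "u \<in> Z" "u \<notin> W" and w: "w \<in> W"
  shows "Determinant.det (change_of_basis (bs @ [u]) (cs @ [c *\<^sub>R u + w])) = Determinant.det (change_of_basis bs cs) * c"
proof -
  let ?n = "length bs" and ?B = "insert u (set bs)"
  have b: "distinct bs" "independent (set bs)" "span (set bs) = W" "span (set cs) = W"
    using bs cs by (auto simp: ordered_basis_def)
  have len: "length cs = ?n" using ordered_basis_length[OF cs bs] .
  have ob: "ordered_basis Z (bs @ [u])" by (rule ordered_basis_snoc[OF bs Z])
  have iB: "independent ?B" using ob by (simp add: ordered_basis_def)
  have unb: "u \<notin> set bs" using ob by (simp add: ordered_basis_def)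
  have rW: "representation ?B x = representation (set bs) x" if "x \<in> W" for x
    using that by (intro real_vector.representation_extend iB) (auto simp: b(3))
  have r0: "representation (set bs) x u = 0" for x using unb real_vector.representation_ne_zero by blast
  have csW: "cs ! j \<in> W" if "j < ?n" for j using that len b(4) span_base[of "cs ! j" "set cs"] by simp
  have wB: "w \<in> span ?B" using w b(3) span_mono[of "set bs" ?B] by blast
  have ru: "representation ?B (c *\<^sub>R u + w) u = c"
  proof -
    have "representation ?B (c *\<^sub>R u + w) = (\<lambda>x. representation ?B (c *\<^sub>R u) x + representation ?B w x)"
      using wB by (intro real_vector.representation_add iB) (auto intro: span_scale span_base)
    moreover have "representation ?B (c *\<^sub>R u) = (\<lambda>x. c * representation ?B u x)"
      by (intro real_vector.representation_scale iB) (auto intro: span_base)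
    moreover have "representation ?B u = (\<lambda>x. if x = u then 1 else 0)"
      by (intro real_vector.representation_basis iB) simp
    ultimately show ?thesis using rW[OF w] r0 by simp
  qed
  let ?A2 = "mat ?n 1 (\<lambda>(i, j). representation ?B (c *\<^sub>R u + w) (bs ! i))"
  have "change_of_basis (bs @ [u]) (cs @ [c *\<^sub>R u + w]) =
      four_block_mat (change_of_basis bs cs) ?A2 (0\<^sub>m 1 ?n) (mat 1 1 (\<lambda>_. c))"
  proof (rule eq_matI)
    fix i j assume "i < dim_row (four_block_mat (change_of_basis bs cs) ?A2 (0\<^sub>m 1 ?n) (mat 1 1 (\<lambda>_. c)))"
      "j < dim_col (four_block_mat (change_of_basis bs cs) ?A2 (0\<^sub>m 1 ?n) (mat 1 1 (\<lambda>_. c)))"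
    then have ij: "i < Suc ?n" "j < Suc ?n" by (auto simp: change_of_basis_def)
    have "i < ?n \<or> i = ?n" "j < ?n \<or> j = ?n" using ij by auto
    then show "change_of_basis (bs @ [u]) (cs @ [c *\<^sub>R u + w]) $$ (i, j) =
      four_block_mat (change_of_basis bs cs) ?A2 (0\<^sub>m 1 ?n) (mat 1 1 (\<lambda>_. c)) $$ (i, j)"
      using len csW rW r0 ru ij
      by (elim disjE) (simp_all add: change_of_basis_def nth_append)
  qed (auto simp: change_of_basis_def)
  moreover have "Determinant.det (four_block_mat (change_of_basis bs cs) ?A2 (0\<^sub>m 1 ?n) (mat 1 1 (\<lambda>_. c))) =
      Determinant.det (change_of_basis bs cs) * Determinant.det (mat 1 1 (\<lambda>_. c))"
    by (rule det_four_block_mat_lower_left_zero) (auto simp: change_of_basis_def)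
  moreover have "Determinant.det (mat 1 1 (\<lambda>_. c)) = c" by (simp add: det_single)
  ultimately show ?thesis by simp
qed

text \<open>The change of basis is the identity matrix with its last two rows exchanged.\<close>

lemma det_change_of_basis_swap:
  assumes "ordered_basis X (bs @ [u, v])"
  shows "Determinant.det (change_of_basis (bs @ [u, v]) (bs @ [v, u])) = - 1"
proof -
  let ?n = "length bs" and ?cs = "bs @ [u, v]"
  have d: "distinct ?cs" and i: "independent (set ?cs)" using assms by (auto simp: ordered_basis_def)
  have "change_of_basis ?cs (bs @ [v, u]) = mat_swaprows ?n (Suc ?n) (1\<^sub>m (Suc (Suc ?n)))"
  proof (rule eq_matI)
    fix i j assume "i < dim_row (mat_swaprows ?n (Suc ?n) (1\<^sub>m (Suc (Suc ?n)) :: real mat))"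
      "j < dim_col (mat_swaprows ?n (Suc ?n) (1\<^sub>m (Suc (Suc ?n)) :: real mat))"
    then have ij: "i < Suc (Suc ?n)" "j < Suc (Suc ?n)" by auto
    define \<pi> where "\<pi> j = (if j = ?n then Suc ?n else if j = Suc ?n then ?n else j)" for j
    have pj: "\<pi> j < Suc (Suc ?n)" using ij by (auto simp: \<pi>_def)
    have "j < ?n \<or> j = ?n \<or> j = Suc ?n" using ij by auto
    then have "(bs @ [v, u]) ! j = ?cs ! (\<pi> j)" by (auto simp: \<pi>_def nth_append)
    then have "representation (set ?cs) ((bs @ [v, u]) ! j) (?cs ! i) = (if ?cs ! i = ?cs ! (\<pi> j) then 1 else 0)"
      using real_vector.representation_basis[OF i, of "?cs ! (\<pi> j)"] pj nth_mem[of "\<pi> j" ?cs] by simp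
    also have "\<dots> = (if i = \<pi> j then 1 else 0)" using d ij pj by (simp add: nth_eq_iff_index_eq del: distinct_append)
    finally show "change_of_basis ?cs (bs @ [v, u]) $$ (i, j) = mat_swaprows ?n (Suc ?n) (1\<^sub>m (Suc (Suc ?n))) $$ (i, j)"
      using ij by (auto simp: change_of_basis_def \<pi>_def)
  qed (auto simp: change_of_basis_def)
  moreover have "Determinant.det (mat_swaprows ?n (Suc ?n) (1\<^sub>m (Suc (Suc ?n)) :: real mat)) = - 1"
    using det_swaprows[of ?n "Suc (Suc ?n)" "Suc ?n" "1\<^sub>m (Suc (Suc ?n)) :: real mat"] by simp
  ultimately show ?thesis by simp
qed

lemma orientation_cases:
  assumes "orientation X \<omega>" "ordered_basis X bs" "ordered_basis X cs"
  shows "\<omega> bs * \<omega> cs = (if Determinant.det (change_of_basis bs cs) > 0 then 1 else - 1)"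
    and "\<omega> bs * \<omega> bs = 1"
proof -
  have 1: "\<omega> bs \<in> {1, -1}" "\<omega> cs \<in> {1, -1}" using assms unfolding orientation_def by blast+
  have 2: "\<omega> bs = \<omega> cs \<longleftrightarrow> Determinant.det (change_of_basis bs cs) > 0"
    using assms unfolding orientation_def by blast
  show "\<omega> bs * \<omega> cs = (if Determinant.det (change_of_basis bs cs) > 0 then 1 else - 1)"
    using 1 by (auto simp flip: 2)
  show "\<omega> bs * \<omega> bs = 1" using 1 by auto
qed

text \<open>The sign in \<open>[x : y]\<close>, freed from the faces: their supports and one vector
  suffice. The basis is a choice; \<open>inc_sign_eq\<close> shows that any other gives the same
  sign.\<close>

definition inc_sign :: "('v::real_inner set \<Rightarrow> 'v list \<Rightarrow> int) \<Rightarrow> 'v set \<Rightarrow> 'v set \<Rightarrow> 'v \<Rightarrow> int" where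
  "inc_sign \<epsilon> W Z u = (let bs = SOME bs. ordered_basis W bs in \<epsilon> W bs * \<epsilon> Z (bs @ [u]))"

section \<open>Incidence signs from orientations\<close>

locale oriented_space =
  fixes \<L> :: "'v::real_inner set set" and \<epsilon> :: "'v set \<Rightarrow> 'v list \<Rightarrow> int"
  assumes finite_dim: "\<exists>B :: 'v set. finite B \<and> span B = UNIV"
    and orient: "\<And>X. X \<in> \<L> \<Longrightarrow> orientation X (\<epsilon> X)"
begin

text \<open>By \<open>det_change_of_basis_snoc\<close> the two changes of basis have determinants
  that differ by the factor \<open>c > 0\<close>, so both orientations change or neither
  does.\<close>

lemma inc_sign_compare:
  assumes W: "W \<in> \<L>" and Z: "Z \<in> \<L>" "hsec W Z" "u \<in> Z" "u \<notin> W"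
    and bs: "ordered_basis W bs" "ordered_basis W cs" and u': "u' = c *\<^sub>R u + w" "w \<in> W" "c > 0"
  shows "\<epsilon> W cs * \<epsilon> Z (cs @ [u']) = \<epsilon> W bs * \<epsilon> Z (bs @ [u])"
proof -
  have "u' \<in> Z" using u' Z hsec_subset[OF Z(2)] hsec_subspace(1)[OF Z(2)] by (auto intro!: subspace_add subspace_scale)
  moreover have "u' \<notin> W"
  proof
    assume "u' \<in> W"
    then have "(1 / c) *\<^sub>R (u' - w) \<in> W" using u' hsec_subspace(2)[OF Z(2)] by (intro subspace_scale subspace_diff)
    then show False using u' Z by simp
  qed
  ultimately have b: "ordered_basis Z (bs @ [u])" "ordered_basis Z (cs @ [u'])"
    using ordered_basis_snoc[OF bs(1) Z(2)] ordered_basis_snoc[OF bs(2) Z(2)] Z by auto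
  have "\<epsilon> Z (bs @ [u]) * \<epsilon> Z (cs @ [u']) = \<epsilon> W bs * \<epsilon> W cs"
    unfolding orientation_cases(1)[OF orient[OF W] bs] orientation_cases(1)[OF orient[OF Z(1)] b]
    using det_change_of_basis_snoc[OF bs Z(2-4) u'(2), of c] u' by (simp add: zero_less_mult_iff)
  then have "\<epsilon> Z (cs @ [u']) = \<epsilon> Z (bs @ [u]) * (\<epsilon> W bs * \<epsilon> W cs)"
    by (rule sign_cancel[OF orientation_cases(2)[OF orient[OF Z(1)] b(1,1)]])
  then have "\<epsilon> W cs * \<epsilon> Z (cs @ [u']) = (\<epsilon> W cs * \<epsilon> W cs) * (\<epsilon> W bs * \<epsilon> Z (bs @ [u]))"
    by (simp add: ac_simps)
  then show ?thesis using orientation_cases(2)[OF orient[OF W] bs(2,2)] by simp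
qed

lemma basis_of_hsec: "hsec (W :: 'v set) Z \<Longrightarrow> \<exists>bs. ordered_basis W bs"
  by (rule ordered_basis_exists[OF finite_dim, of W]) (auto dest: hsec_subspace(2))

lemma inc_sign_eq:
  assumes W: "W \<in> \<L>" and Z: "Z \<in> \<L>" "hsec W Z" "u \<in> Z" "u \<notin> W" and bs: "ordered_basis W bs"
  shows "inc_sign \<epsilon> W Z u = \<epsilon> W bs * \<epsilon> Z (bs @ [u])"
proof -
  have "ordered_basis W (SOME bs. ordered_basis W bs)" using bs by (rule someI)
  then show ?thesis
    unfolding inc_sign_def Let_def
    by (rule inc_sign_compare[OF W Z bs, of _ u 1 0]) (simp_all add: subspace_0 hsec_subspace(2)[OF Z(2)])
qed

lemma inc_sign_system: "incidence_system \<L> (\<lambda>W Z u. of_int (inc_sign \<epsilon> W Z u) :: 'k::field)"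
  unfolding incidence_system_def
proof (intro conjI ballI allI impI)
  fix W Z u assume W: "W \<in> \<L>" and Z: "Z \<in> \<L>" and h: "hsec W Z \<and> u \<in> Z \<and> u \<notin> W"
  then have h: "hsec W Z" "u \<in> Z" "u \<notin> W" by auto
  obtain bs where bs: "ordered_basis W bs" using basis_of_hsec h by blast
  have b: "ordered_basis Z (bs @ [u])" using ordered_basis_snoc[OF bs h] .
  have "inc_sign \<epsilon> W Z u * inc_sign \<epsilon> W Z u = (\<epsilon> W bs * \<epsilon> W bs) * (\<epsilon> Z (bs @ [u]) * \<epsilon> Z (bs @ [u]))"
    by (simp add: inc_sign_eq[OF W Z h bs] ac_simps)
  also have "\<dots> = 1" using orientation_cases(2)[OF orient[OF W] bs bs] orientation_cases(2)[OF orient[OF Z] b b] by simp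
  finally show "(of_int (inc_sign \<epsilon> W Z u) :: 'k) * of_int (inc_sign \<epsilon> W Z u) = 1"
    by (metis of_int_1 of_int_mult)
  have mu: "- u \<in> Z" "- u \<notin> W"
    using h hsec_subspace[OF h(1)] by (auto dest: subspace_neg)
  have b': "ordered_basis Z (bs @ [- u])" using ordered_basis_snoc[OF bs h(1) mu] .
  have "Determinant.det (change_of_basis (bs @ [u]) (bs @ [- u])) = - 1"
    using det_change_of_basis_snoc[OF bs bs h, of 0 "- 1"] hsec_subspace(2)[OF h(1)]
    by (simp add: subspace_0 change_of_basis_self[OF bs])
  then have "\<epsilon> Z (bs @ [u]) * \<epsilon> Z (bs @ [- u]) = - 1" using orientation_cases(1)[OF orient[OF Z] b b'] by simp
  then have "\<epsilon> Z (bs @ [- u]) = \<epsilon> Z (bs @ [u]) * - 1"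
    by (rule sign_cancel[OF orientation_cases(2)[OF orient[OF Z] b b]])
  then show "of_int (inc_sign \<epsilon> W Z (- u)) = - (of_int (inc_sign \<epsilon> W Z u) :: 'k)"
    by (simp add: inc_sign_eq[OF W Z h bs] inc_sign_eq[OF W Z h(1) mu bs])
  fix c :: real and w assume c: "c > 0" "w \<in> W"
  have "c *\<^sub>R u + w \<in> Z" using h c hsec_subset[OF h(1)] hsec_subspace(1)[OF h(1)] by (auto intro!: subspace_add subspace_scale)
  moreover have "c *\<^sub>R u + w \<notin> W"
  proof
    assume "c *\<^sub>R u + w \<in> W"
    then have "(1 / c) *\<^sub>R (c *\<^sub>R u + w - w) \<in> W" using c hsec_subspace(2)[OF h(1)] by (intro subspace_scale subspace_diff)
    then show False using c h by simp
  qed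
  ultimately show "of_int (inc_sign \<epsilon> W Z (c *\<^sub>R u + w)) = (of_int (inc_sign \<epsilon> W Z u) :: 'k)"
    using inc_sign_compare[OF W Z h bs bs refl c(2,1)]
      inc_sign_eq[OF W Z h bs] inc_sign_eq[OF W Z h(1) _ _ bs] by metis
next
  fix W Z Z' X u v assume L: "W \<in> \<L>" "Z \<in> \<L>" "Z' \<in> \<L>" "X \<in> \<L>"
    and "hsec W Z \<and> hsec W Z' \<and> hsec Z X \<and> hsec Z' X \<and> Z \<noteq> Z' \<and> u \<in> Z \<and> u \<notin> W \<and> v \<in> Z' \<and> v \<notin> W"
  then have h: "hsec W Z" "hsec W Z'" "hsec Z X" "hsec Z' X" "Z \<noteq> Z'" "u \<in> Z" "u \<notin> W" "v \<in> Z'" "v \<notin> W" by auto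
  have cap: "Z \<inter> Z' = W"
  proof -
    have "Z \<inter> Z' = W \<or> Z \<inter> Z' = Z"
      using hsec_subset[OF h(1)] hsec_subset[OF h(2)] hsec_subspace(1)[OF h(1)] hsec_subspace(1)[OF h(2)]
      by (intro hsec_maximal[OF h(1)] subspace_inter) auto
    moreover have "Z \<inter> Z' \<noteq> Z"
    proof
      assume "Z \<inter> Z' = Z"
      then have "Z' = Z \<or> Z' = X"
        using hsec_subspace(1)[OF h(2)] hsec_subset[OF h(4)] by (intro hsec_maximal[OF h(3)]) auto
      then show False using h(5) hsec_subset[OF h(4)] by blast
    qed
    ultimately show ?thesis by blast
  qed
  have uv: "u \<in> X" "u \<notin> Z'" "v \<in> X" "v \<notin> Z"
    using h cap hsec_subset[OF h(3)] hsec_subset[OF h(4)] by blast+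
  obtain bs where bs: "ordered_basis W bs" using basis_of_hsec h by blast
  have b: "ordered_basis Z (bs @ [u])" "ordered_basis Z' (bs @ [v])"
    using ordered_basis_snoc[OF bs] h by auto
  have b2: "ordered_basis X (bs @ [u, v])" "ordered_basis X (bs @ [v, u])"
    using ordered_basis_snoc[OF b(1) h(3) uv(3,4)] ordered_basis_snoc[OF b(2) h(4) uv(1,2)] by simp_all
  \<comment> \<open>Through \<open>Z\<close> the vectors are attached in the order
    \<open>u, v\<close>, through \<open>Z'\<close> in the order \<open>v, u\<close>; this exchange
    is the source of the minus sign.\<close>
  have "\<epsilon> X (bs @ [u, v]) * \<epsilon> X (bs @ [v, u]) = - 1"
    using orientation_cases(1)[OF orient[OF L(4)] b2] det_change_of_basis_swap[OF b2(1)] by simp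
  then have sw: "\<epsilon> X (bs @ [v, u]) = \<epsilon> X (bs @ [u, v]) * - 1"
    by (rule sign_cancel[OF orientation_cases(2)[OF orient[OF L(4)] b2(1,1)]])
  have s: "\<epsilon> Z (bs @ [u]) * (\<epsilon> Z (bs @ [u]) * t) = t" "\<epsilon> Z' (bs @ [v]) * (\<epsilon> Z' (bs @ [v]) * t) = t" for t
    using orientation_cases(2)[OF orient[OF L(2)] b(1,1)] orientation_cases(2)[OF orient[OF L(3)] b(2,2)]
    by (simp_all flip: mult.assoc)
  have "inc_sign \<epsilon> W Z u * inc_sign \<epsilon> Z X v = - (inc_sign \<epsilon> W Z' v * inc_sign \<epsilon> Z' X u)"
    using inc_sign_eq[OF L(1,2) h(1,6,7) bs] inc_sign_eq[OF L(1,3) h(2,8,9) bs]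
      inc_sign_eq[OF L(2,4) h(3) uv(3,4) b(1)] inc_sign_eq[OF L(3,4) h(4) uv(1,2) b(2)] sw by (simp add: s mult.assoc)
  then show "of_int (inc_sign \<epsilon> W Z u) * of_int (inc_sign \<epsilon> Z X v) =
      - (of_int (inc_sign \<epsilon> W Z' v) * of_int (inc_sign \<epsilon> Z' X u) :: 'k)"
    by (metis of_int_minus of_int_mult)
qed

lemma inc_sign_values:
  assumes W: "W \<in> \<L>" and Z: "Z \<in> \<L>" "hsec W Z" "u \<in> Z" "u \<notin> W" and c: "c > 0" "w \<in> W" "u' = c *\<^sub>R u + w"
    and bs: "ordered_basis W bs"
  shows "\<epsilon> W bs * \<epsilon> Z (bs @ [u']) = inc_sign \<epsilon> W Z u"
  using inc_sign_compare[OF W Z bs bs c(3,2,1)] inc_sign_eq[OF W Z bs] by simp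

end

locale oriented_arrangement = hyperplane_arrangement A + oriented_space "intersection_lattice A" \<epsilon>
  for A :: "'v::real_inner set set" and \<epsilon> :: "'v set \<Rightarrow> 'v list \<Rightarrow> int"
begin

lemma same_side:
  assumes Z: "Z \<in> lat" "hsec (flat_of A w) Z" and z: "flat_of A z = Z" "pt_le A w z" and z': "z' \<in> face_of A z"
  obtains c v where "c > 0" "v \<in> flat_of A w" "z' = c *\<^sub>R z + v"
proof -
  \<comment> \<open>Only geometric facts of that locale are wanted here, so any coefficient field
    would serve.\<close>
  interpret r: incidence_arrangement A "\<lambda>W Z u. of_int (inc_sign \<epsilon> W Z u) :: real"
    by unfold_locales (rule inc_sign_system)
  let ?W = "flat_of A w"
  have m: "z \<in> Z" "z \<notin> ?W" using r.not_mem_of_flat[OF Z(2) z(1)] by auto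
  have fz': "flat_of A z' = Z" using flat_of_face_of[OF z'] z by simp
  have m': "z' \<in> Z" "z' \<notin> ?W" using r.not_mem_of_flat[OF Z(2) fz'] by auto
  obtain c v where cv: "v \<in> ?W" "z' = c *\<^sub>R z + v" using hsec_decomp[OF Z(2) m m'(1)] .
  have "c > 0"
  proof (rule ccontr)
    assume "\<not> c > 0"
    moreover have "c \<noteq> 0" using cv m' by auto
    ultimately have c: "- c > 0" by simp
    have mu: "- z \<in> Z" "- z \<notin> ?W" using m lattice_subspace[OF Z(1)] subspace_flat_of[of w] by (auto dest: subspace_neg)
    have e: "z' = (- c) *\<^sub>R (- z) + v" using cv by simp
    have le: "pt_le A w z'" using z(2) face_of_eq[OF z'] by (metis face_le_face_of)
    have "face_of A z' = face_of A (near A w (- z))" by (rule face_of_above[OF Z le e cv(1) c])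
    moreover have "face_of A z = face_of A (near A w z)" by (rule r.face_eq_near[OF Z z(2)])
    ultimately show False using two_faces_above(2)[OF Z m] face_of_eq[OF z'] by simp
  qed
  then show thesis using that cv by blast
qed

text \<open>All vectors of \<open>x\<close> lie on one side of the support of \<open>y\<close>
  (\<open>same_side\<close>), so the common value that \<open>incidence\<close> asks for
  exists.\<close>

lemma incidence_eq:
  assumes y: "y \<in> F" and x: "x \<in> F" and h: "hsec (supp A y) (supp A x)" and le: "face_le A y x" and v: "v \<in> x"
  shows "incidence A \<epsilon> y x = inc_sign \<epsilon> (supp A y) (supp A x) v"
proof -
  obtain w where w: "y = face_of A w" using y by (auto simp: faces_eq)
  have xv: "x = face_of A v" by (rule faces_point[OF x v])
  have Y: "supp A y \<in> lat" and X: "supp A x \<in> lat" using supp_lat x y by auto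
  have hs: "hsec (flat_of A w) (supp A x)" using h w by simp
  have vX: "v \<in> supp A x" "v \<notin> supp A y"
    using flat_of_self[of v] flat_of_subset[OF Y, of v] hsec_subset[OF h] xv by auto
  have *: "\<epsilon> (supp A y) bs * \<epsilon> (supp A x) (bs @ [v']) = inc_sign \<epsilon> (supp A y) (supp A x) v"
    if bs: "ordered_basis (supp A y) bs" and v': "v' \<in> x" for bs v'
  proof -
    obtain c t where "c > 0" "t \<in> flat_of A w" "v' = c *\<^sub>R v + t"
      using same_side[OF X hs, of v v'] le xv w v' by (auto simp: supp_face_of)
    then show ?thesis using inc_sign_values[OF Y X h vX _ _ _ bs] w by simp
  qed
  obtain bs where bs: "ordered_basis (supp A y) bs" using ordered_basis_exists[OF finite_dim lattice_subspace[OF Y]] .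
  show ?thesis
    unfolding incidence_def
  proof (rule the_equality)
    show "\<forall>bs v'. ordered_basis (supp A y) bs \<and> v' \<in> x \<longrightarrow>
        inc_sign \<epsilon> (supp A y) (supp A x) v = \<epsilon> (supp A y) bs * \<epsilon> (supp A x) (bs @ [v'])"
      using * by simp
    fix s assume "\<forall>bs v. ordered_basis (supp A y) bs \<and> v \<in> x \<longrightarrow> s = \<epsilon> (supp A y) bs * \<epsilon> (supp A x) (bs @ [v])"
    then show "s = inc_sign \<epsilon> (supp A y) (supp A x) v" using bs v * by metis
  qed
qed

end

section \<open>Symmetries of the arrangement\<close>

locale arrangement_symmetry = hyperplane_arrangement A for A :: "'v::real_inner set set" +
  fixes w :: "'v \<Rightarrow> 'v"
  assumes orth: "orthogonal_transformation w" and bij: "bij w" and perm: "(`) w ` A = A"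
begin

lemma lin: "linear w" using orth by (simp add: orthogonal_transformation_def)

lemma inner_w: "inner (w a) (w b) = inner a b" using orth by (simp add: orthogonal_transformation_def)

lemma inj_w: "inj w" using bij by (simp add: bij_def)

lemma w_in_image: "w v \<in> w ` H \<longleftrightarrow> v \<in> H" using inj_w by (auto dest: injD)

lemma image_A: "H \<in> A \<Longrightarrow> w ` H \<in> A" using perm by blast

lemma A_image: "K \<in> A \<Longrightarrow> \<exists>H\<in>A. K = w ` H" using perm by blast

text \<open>The labels of the half spaces come from arbitrary normal vectors, so \<open>w\<close>
  may exchange them. A non-zero factor for each hyperplane is still enough to compare faces.\<close>

lemma hsgn_image:
  assumes "H \<in> A"
  shows "\<exists>s. s \<noteq> 0 \<and> (\<forall>v. hsgn (w ` H) (w v) = s * hsgn H v)"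
proof (intro exI conjI allI)
  define n where "n = normal_vector H"
  define s where "s = hsgn (w ` H) (w n)"
  have n0: "n \<noteq> 0" using normal(1)[OF assms] n_def by simp
  have nH: "v \<in> H \<longleftrightarrow> inner n v = 0" for v using normal(2)[OF assms] n_def by blast
  have "n \<notin> H" using nH n0 by simp
  then show "hsgn (w ` H) (w n) \<noteq> 0" using hsgn_0_iff[OF image_A[OF assms]] w_in_image by blast
  fix v
  define c where "c = inner n v / inner n n"
  have h: "v - c *\<^sub>R n \<in> H" using nH n0 by (simp add: c_def inner_diff_right)
  have v: "v = c *\<^sub>R n + (v - c *\<^sub>R n)" by simp
  have "w v = c *\<^sub>R w n + w (v - c *\<^sub>R n)"
    by (subst v) (simp only: linear_add[OF lin] linear_scale[OF lin])
  then have "hsgn (w ` H) (w v) = sgn c * s"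
    using hsgn_lin[OF image_A[OF assms], of "w (v - c *\<^sub>R n)" c "w n"] h by (simp add: s_def)
  moreover have "hsgn H v = sgn c * hsgn H n" using hsgn_lin[OF assms h, of c n] v by simp
  moreover have "hsgn H n = 1" using n0 by (simp add: hsgn_def n_def[symmetric])
  ultimately show "hsgn (w ` H) (w v) = hsgn (w ` H) (w n) * hsgn H v" by (simp add: s_def)
qed

lemma face_eq_image: "face_of A (w u) = face_of A (w v) \<longleftrightarrow> face_of A u = face_of A v"
proof -
  have "hsgn (w ` H) (w u) = hsgn (w ` H) (w v) \<longleftrightarrow> hsgn H u = hsgn H v" if "H \<in> A" for H
    using hsgn_image[OF that] by auto
  moreover have "(\<forall>K\<in>A. hsgn K (w u) = hsgn K (w v)) \<longleftrightarrow> (\<forall>H\<in>A. hsgn (w ` H) (w u) = hsgn (w ` H) (w v))"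
    using image_A A_image by metis
  ultimately show ?thesis by (simp add: face_of_eq_iff)
qed

lemma face_of_image: "w ` face_of A v = face_of A (w v)"
proof -
  have mem: "u \<in> face_of A v \<longleftrightarrow> face_of A u = face_of A v" for u v
    using face_of_eq[of u v] face_of_self[of u] by blast
  have *: "u \<in> face_of A v \<longleftrightarrow> w u \<in> face_of A (w v)" for u
    by (simp only: mem face_eq_image)
  show ?thesis
  proof (intro equalityI subsetI)
    fix x assume x: "x \<in> face_of A (w v)"
    obtain u where "x = w u" using bij by (metis bij_pointE)
    then show "x \<in> w ` face_of A v" using x * by blast
  qed (use * in blast)
qed

lemma near_image: "face_of A (near A (w v) (w u)) = face_of A (w (near A v u))"
  unfolding face_of_eq_iff
proof
  fix K assume "K \<in> A"
  then obtain H where H: "H \<in> A" "K = w ` H" using A_image by blast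
  obtain s where "s \<noteq> 0" "\<And>v. hsgn (w ` H) (w v) = s * hsgn H v" using hsgn_image[OF H(1)] by blast
  then show "hsgn K (near A (w v) (w u)) = hsgn K (w (near A v u))"
    using image_A[OF H(1)] H by (simp add: near_hsgn)
qed

lemma flat_image: "w ` flat_of A v = flat_of A (w v)"
proof -
  have *: "u \<in> flat_of A v \<longleftrightarrow> w u \<in> flat_of A (w v)" for u
  proof
    assume u: "u \<in> flat_of A v"
    show "w u \<in> flat_of A (w v)"
      unfolding mem_flat_of
    proof (intro ballI impI)
      fix K assume K: "K \<in> A" "w v \<in> K"
      obtain H where H: "H \<in> A" "K = w ` H" using A_image[OF K(1)] by blast
      have "v \<in> H" using K(2) unfolding H(2) w_in_image .
      then have "u \<in> H" using u[unfolded mem_flat_of] H(1) by blast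
      then show "w u \<in> K" unfolding H(2) by (rule imageI)
    qed
  next
    assume u: "w u \<in> flat_of A (w v)"
    show "u \<in> flat_of A v"
      unfolding mem_flat_of
    proof (intro ballI impI)
      fix H assume H: "H \<in> A" "v \<in> H"
      then have "w u \<in> w ` H" using u[unfolded mem_flat_of] image_A[OF H(1)] by blast
      then show "u \<in> H" by (simp only: w_in_image)
    qed
  qed
  show ?thesis
  proof (intro equalityI subsetI)
    fix x assume x: "x \<in> flat_of A (w v)"
    obtain u where "x = w u" using bij by (metis bij_pointE)
    then show "x \<in> w ` flat_of A v" using x * by blast
  qed (use * in blast)
qed

lemma faces_image: "x \<in> F \<Longrightarrow> w ` x \<in> F" by (auto simp: faces_eq face_of_image)

lemma supp_image: "x \<in> F \<Longrightarrow> supp A (w ` x) = w ` supp A x"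
  by (elim facesE) (simp add: face_of_image flat_image)

lemma fmult_image: "x \<in> F \<Longrightarrow> y \<in> F \<Longrightarrow> fmult (w ` x) (w ` y) = w ` fmult x y"
  by (elim facesE) (simp add: face_of_image near_image)

lemma lat_image: "X \<in> lat \<Longrightarrow> w ` X \<in> lat" by (auto simp: lattice_eq flat_image)

lemma inj_image: "inj_on ((`) w) S" using inj_w by (simp add: inj_on_def inj_image_eq_iff)

lemma image_onto: assumes "finite S" "(`) w ` S \<subseteq> S" shows "(`) w ` S = S"
  by (rule endo_inj_surj[OF assms inj_image])

lemma lat_onto: "(`) w ` lat = lat" by (rule image_onto[OF finite_lattice]) (use lat_image in auto)

lemma faces_onto: "(`) w ` F = F" by (rule image_onto[OF finite_faces]) (use faces_image in auto)

lemma faces_on_image: assumes "X \<in> lat" shows "(`) w ` faces_on A X = faces_on A (w ` X)"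
proof (intro equalityI subsetI)
  fix x assume "x \<in> (`) w ` faces_on A X"
  then show "x \<in> faces_on A (w ` X)" by (auto simp: faces_on_def faces_image supp_image)
next
  fix x assume x: "x \<in> faces_on A (w ` X)"
  then have "x \<in> (`) w ` F" unfolding faces_onto by (simp add: faces_on_def)
  then obtain y where y: "y \<in> F" "x = w ` y" by blast
  then have "w ` supp A y = w ` X" using x supp_image by (simp add: faces_on_def)
  then have "supp A y = X" using inj_w by (simp add: inj_image_eq_iff)
  then show "x \<in> (`) w ` faces_on A X" using y by (auto simp: faces_on_def)
qed

lemma hsec_image: "hsec Y X \<Longrightarrow> hsec (w ` Y) (w ` X)"
proof -
  assume h: "hsec Y X"
  then obtain a where a: "subspace X" "Y \<noteq> X" "Y = {v \<in> X. inner a v = 0}" by (auto simp: hsec_def)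
  have "w ` Y = {v \<in> w ` X. inner (w a) v = 0}" using a(3) by (auto simp: inner_w)
  moreover have "w ` Y \<noteq> w ` X" using a(2) inj_w by (simp add: inj_image_eq_iff)
  moreover have "subspace (w ` X)" by (rule linear_subspace_image[OF lin a(1)])
  ultimately show ?thesis unfolding hsec_def by blast
qed

text \<open>The action of \<open>w\<close> as a linear map on all functions;
  \<open>face_action\<close>, which sums over the support of its argument, agrees with it on the
  carrier.\<close>

definition tr :: "('v set \<Rightarrow> 'k::field) \<Rightarrow> 'v set \<Rightarrow> 'k" where
  "tr f = (\<Sum>x\<in>F. smul (f x) (\<delta> (w ` x)))"

lemma face_action_eq: "f \<in> carrier (face_algebra A) \<Longrightarrow> face_action w f = tr f"
  unfolding face_action_def tr_def
  by (rule linear_extension_eq[OF finite_faces]) (simp add: face_algebra_def fa.carrier_R)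

lemma tr_add: "tr (f + g) = tr f + tr g"
  by (simp only: tr_def plus_fun_apply smul_add_left sum.distrib)

lemma tr_smul: "tr (smul c f) = smul c (tr f)"
  by (simp only: tr_def smul_apply smul_sum smul_smul)

lemma tr_0: "tr 0 = 0" by (simp only: tr_def zero_fun_apply smul_0 sum.neutral_const)

lemma tr_sum: "tr (\<Sum>i\<in>S. f i) = (\<Sum>i\<in>S. tr (f i))"
proof (induction S rule: infinite_finite_induct)
  case (insert x S)
  then show ?case by (simp only: sum.insert[OF insert(1,2)] tr_add)
qed (simp_all only: sum.infinite sum.empty tr_0 simp_thms)

lemma tr_diff: "tr (f - g) = tr f - tr g"
proof -
  have "tr (f - g) + tr g = tr f" by (simp only: tr_add[symmetric] diff_add_cancel)
  then show ?thesis by (simp only: eq_diff_eq)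
qed

lemma tr_apply: assumes "x \<in> F" shows "tr f (w ` x) = f x"
proof -
  have "tr f (w ` x) = (\<Sum>y\<in>F. if x = y then f y else 0)"
    unfolding tr_def sum_fun_apply
    by (intro sum.cong refl) (use inj_w in \<open>auto simp: smul_apply basis_elem_def inj_image_eq_iff\<close>)
  then show ?thesis using assms finite_faces by simp
qed

lemma tr_delta: "x \<in> F \<Longrightarrow> tr (\<delta> x) = \<delta> (w ` x)"
proof -
  assume x: "x \<in> F"
  have "tr (\<delta> x) = (\<Sum>y\<in>F. if y = x then \<delta> (w ` y) else 0)"
    unfolding tr_def by (intro sum.cong refl) (auto simp: basis_elem_def)
  then show ?thesis using x finite_faces by simp
qed

lemma tr_fm:
  assumes "f \<in> carrier (face_algebra A)" "g \<in> carrier (face_algebra A)"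
  shows "tr (fm f g) = fm (tr f) (tr g)"
proof -
  have f: "f = (\<Sum>x\<in>F. smul (f x) (\<delta> x))" and g: "g = (\<Sum>x\<in>F. smul (g x) (\<delta> x))"
    using assms by (auto intro!: fa.expansion simp: face_algebra_def)
  have "fm f g = (\<Sum>y\<in>F. \<Sum>x\<in>F. smul (g y) (smul (f x) (\<delta> (fmult x y))))"
    by (subst f, subst g) (simp only: bprod_sum_left bprod_sum_right bprod_smul_left bprod_smul_right fm_delta smul_sum cong: sum.cong)
  then have "tr (fm f g) = (\<Sum>y\<in>F. \<Sum>x\<in>F. smul (g y) (smul (f x) (tr (\<delta> (fmult x y)))))"
    by (simp only: tr_sum tr_smul)
  also have "\<dots> = (\<Sum>y\<in>F. \<Sum>x\<in>F. smul (g y) (smul (f x) (fm (\<delta> (w ` x)) (\<delta> (w ` y)))))"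
    by (intro sum.cong refl) (simp add: tr_delta fmult_closed fm_delta faces_image fmult_image)
  also have "\<dots> = fm (tr f) (tr g)"
    by (simp only: tr_def bprod_sum_left bprod_sum_right bprod_smul_left bprod_smul_right smul_sum)
  finally show ?thesis .
qed

end

text \<open>\<open>w\<close> carries the expansion of a vector in \<open>bs\<close> to one in
  \<open>map w bs\<close>, and expansions in a basis are unique.\<close>

lemma change_of_basis_map:
  assumes w: "linear w" "inj w" and bs: "ordered_basis X bs" and cs: "ordered_basis X cs"
  shows "change_of_basis (map w bs) (map w cs) = change_of_basis bs cs"
proof (rule eq_matI)
  let ?B = "set bs"
  have b: "independent ?B" "span ?B = X" "span (set cs) = X" using bs cs by (auto simp: ordered_basis_def)
  have len: "length cs = length bs" by (rule ordered_basis_length[OF cs bs])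
  have iB: "independent (w ` ?B)"
    using b(1) w real_vector.linear_independent_injective_image
    by (metis inj_on_subset linear_independent_injective_image subset_UNIV)
  fix i j assume "i < dim_row (change_of_basis bs cs)" "j < dim_col (change_of_basis bs cs)"
  then have ij: "i < length bs" "j < length bs" by (auto simp: change_of_basis_def)
  let ?v = "cs ! j"
  have v: "?v \<in> span ?B" using ij len b span_base[of ?v "set cs"] by simp
  define f where "f x = (if x \<in> w ` ?B then representation ?B ?v (inv_into UNIV w x) else 0)" for x
  have fw: "f (w x) = representation ?B ?v x" for x
    using w(2) real_vector.representation_ne_zero[of ?B ?v x] by (auto simp: f_def inj_image_mem_iff)
  have "representation (w ` ?B) (w ?v) = f"
  proof (rule real_vector.representation_eqI[OF iB])
    show "w ?v \<in> span (w ` ?B)" using v linear_span_image[OF w(1), of ?B] by blast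
    show "f x \<noteq> 0 \<Longrightarrow> x \<in> w ` ?B" for x by (auto simp: f_def split: if_splits)
    then show "finite {x. f x \<noteq> 0}" by (auto intro: finite_subset[of _ "w ` ?B"])
    have "{x. f x \<noteq> 0} = w ` {x. representation ?B ?v x \<noteq> 0}"
    proof (intro equalityI subsetI)
      fix x assume x: "x \<in> {x. f x \<noteq> 0}"
      then obtain y where "x = w y" by (auto simp: f_def split: if_splits)
      then show "x \<in> w ` {x. representation ?B ?v x \<noteq> 0}" using x fw[of y] by simp
    next
      fix x assume "x \<in> w ` {x. representation ?B ?v x \<noteq> 0}"
      then show "x \<in> {x. f x \<noteq> 0}" using fw by auto
    qed
    then have "(\<Sum>x | f x \<noteq> 0. f x *\<^sub>R x) = (\<Sum>x | representation ?B ?v x \<noteq> 0. representation ?B ?v x *\<^sub>R w x)"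
      using w(2) by (simp add: sum.reindex inj_on_subset[OF w(2)] fw)
    also have "\<dots> = w (\<Sum>x | representation ?B ?v x \<noteq> 0. representation ?B ?v x *\<^sub>R x)"
      by (simp add: linear_sum[OF w(1)] linear_scale[OF w(1)])
    also have "\<dots> = w ?v" using real_vector.sum_nonzero_representation_eq[OF b(1) v] by simp
    finally show "(\<Sum>x | f x \<noteq> 0. f x *\<^sub>R x) = w ?v" .
  qed
  then have "representation (w ` ?B) (w ?v) (w (bs ! i)) = representation ?B ?v (bs ! i)" by (simp add: fw)
  then show "change_of_basis (map w bs) (map w cs) $$ (i, j) = change_of_basis bs cs $$ (i, j)"
    using ij len by (simp add: change_of_basis_def)
qed (auto simp: change_of_basis_def)

lemma ordered_basis_map:
  assumes w: "linear w" "inj w" and bs: "ordered_basis X bs"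
  shows "ordered_basis (w ` X) (map w bs)"
  using bs w linear_independent_injective_image[OF w(1), of "set bs"] linear_span_image[OF w(1), of "set bs"]
  by (auto simp: ordered_basis_def distinct_map intro: inj_on_subset)

lemma (in oriented_space) orientation_sign_eq:
  assumes w: "linear w" "inj w" and X: "X \<in> \<L>" "w ` X \<in> \<L>" and bs: "ordered_basis X bs"
  shows "orientation_sign \<epsilon> X w = \<epsilon> X bs * \<epsilon> (w ` X) (map w bs)"
proof -
  have *: "\<epsilon> X cs * \<epsilon> (w ` X) (map w cs) = \<epsilon> X bs * \<epsilon> (w ` X) (map w bs)" if cs: "ordered_basis X cs" for cs
  proof -
    have m: "ordered_basis (w ` X) (map w bs)" "ordered_basis (w ` X) (map w cs)"
      using ordered_basis_map[OF w] bs cs by auto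
    have "\<epsilon> (w ` X) (map w bs) * \<epsilon> (w ` X) (map w cs) = \<epsilon> X bs * \<epsilon> X cs"
      unfolding orientation_cases(1)[OF orient[OF X(1)] bs cs] orientation_cases(1)[OF orient[OF X(2)] m]
        change_of_basis_map[OF w bs cs] ..
    then have "\<epsilon> (w ` X) (map w cs) = \<epsilon> (w ` X) (map w bs) * (\<epsilon> X bs * \<epsilon> X cs)"
      by (rule sign_cancel[OF orientation_cases(2)[OF orient[OF X(2)] m(1,1)]])
    then have "\<epsilon> X cs * \<epsilon> (w ` X) (map w cs) = (\<epsilon> X cs * \<epsilon> X cs) * (\<epsilon> X bs * \<epsilon> (w ` X) (map w bs))"
      by (simp add: ac_simps)
    then show ?thesis using orientation_cases(2)[OF orient[OF X(1)] cs cs] by simp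
  qed
  show ?thesis
    unfolding orientation_sign_def
  proof (rule the_equality)
    show "\<forall>cs. ordered_basis X cs \<longrightarrow> \<epsilon> X bs * \<epsilon> (w ` X) (map w bs) = \<epsilon> X cs * \<epsilon> (w ` X) (map w cs)"
      using * by simp
    fix s assume "\<forall>bs. ordered_basis X bs \<longrightarrow> s = \<epsilon> X bs * \<epsilon> (w ` X) (map w bs)"
    then show "s = \<epsilon> X bs * \<epsilon> (w ` X) (map w bs)" using bs by blast
  qed
qed

locale oriented_quiver = oriented_arrangement A \<epsilon> + face_idempotents A l e
  for A :: "'v::real_inner set set" and \<epsilon> :: "'v set \<Rightarrow> 'v list \<Rightarrow> int"
    and l e :: "'v set \<Rightarrow> 'v set \<Rightarrow> 'k::field"
begin

sublocale face_quiver A "\<lambda>W Z u. of_int (inc_sign \<epsilon> W Z u) :: 'k" l e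
  by unfold_locales (rule inc_sign_system)

end

section \<open>Incidence signs and path images under a symmetry\<close>

locale quiver_symmetry = oriented_quiver A \<epsilon> l e + arrangement_symmetry A w
  for A :: "'v::real_inner set set" and \<epsilon> :: "'v set \<Rightarrow> 'v list \<Rightarrow> int"
    and l e :: "'v set \<Rightarrow> 'v set \<Rightarrow> 'k::field" and w +
  assumes l_image: "\<And>X. X \<in> lat \<Longrightarrow> face_action w (l X) = l (w ` X)"
begin

abbreviation "\<sigma> X \<equiv> orientation_sign \<epsilon> X w"

lemma lattice_basis: assumes "X \<in> lat" obtains bs where "ordered_basis X bs"
  using ordered_basis_exists[OF finite_dim lattice_subspace[OF assms]] .

lemma \<sigma>_eq: "X \<in> lat \<Longrightarrow> ordered_basis X bs \<Longrightarrow> \<sigma> X = \<epsilon> X bs * \<epsilon> (w ` X) (map w bs)"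
  by (rule orientation_sign_eq[OF lin inj_w]) (auto simp: lat_image)

lemma \<sigma>_sq: assumes "X \<in> lat" shows "\<sigma> X * \<sigma> X = 1"
proof -
  obtain bs where bs: "ordered_basis X bs" using lattice_basis[OF assms] .
  have m: "ordered_basis (w ` X) (map w bs)" by (rule ordered_basis_map[OF lin inj_w bs])
  have "\<sigma> X * \<sigma> X = (\<epsilon> X bs * \<epsilon> X bs) * (\<epsilon> (w ` X) (map w bs) * \<epsilon> (w ` X) (map w bs))"
    by (simp add: \<sigma>_eq[OF assms bs] ac_simps)
  then show ?thesis
    using orientation_cases(2)[OF orient[OF assms] bs bs] orientation_cases(2)[OF orient[OF lat_image[OF assms]] m m] by simp
qed

text \<open>In the product on the right the orientations of the two image spaces occur twice and
  square to 1.\<close>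

lemma inc_sign_image:
  assumes Z: "Z \<in> lat" "X \<in> lat" "hsec Z X" and u: "u \<in> X" "u \<notin> Z"
  shows "inc_sign \<epsilon> Z X u = \<sigma> Z * \<sigma> X * inc_sign \<epsilon> (w ` Z) (w ` X) (w u)"
proof -
  obtain bs where bs: "ordered_basis Z bs" using lattice_basis[OF Z(1)] .
  have m: "ordered_basis (w ` Z) (map w bs)" by (rule ordered_basis_map[OF lin inj_w bs])
  have b: "ordered_basis X (bs @ [u])" by (rule ordered_basis_snoc[OF bs Z(3) u])
  have mb: "ordered_basis (w ` X) (map w (bs @ [u]))" by (rule ordered_basis_map[OF lin inj_w b])
  have i: "inc_sign \<epsilon> (w ` Z) (w ` X) (w u) = \<epsilon> (w ` Z) (map w bs) * \<epsilon> (w ` X) (map w (bs @ [u]))"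
    using inc_sign_eq[OF lat_image[OF Z(1)] lat_image[OF Z(2)] hsec_image[OF Z(3)] _ _ m, of "w u"] u
    by (simp add: w_in_image)
  have "\<sigma> Z * \<sigma> X * inc_sign \<epsilon> (w ` Z) (w ` X) (w u) = (\<epsilon> (w ` Z) (map w bs) * \<epsilon> (w ` Z) (map w bs)) *
      (\<epsilon> (w ` X) (map w (bs @ [u])) * \<epsilon> (w ` X) (map w (bs @ [u]))) * (\<epsilon> Z bs * \<epsilon> X (bs @ [u]))"
    unfolding i \<sigma>_eq[OF Z(1) bs] \<sigma>_eq[OF Z(2) b] by (simp only: ac_simps)
  also have "\<dots> = inc_sign \<epsilon> Z X u"
    using orientation_cases(2)[OF orient[OF lat_image[OF Z(1)]] m m]
      orientation_cases(2)[OF orient[OF lat_image[OF Z(2)]] mb mb] inc_sign_eq[OF Z u bs] by simp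
  finally show ?thesis ..
qed

lemma l_carrier: "X \<in> lat \<Longrightarrow> l X \<in> carrier (face_algebra A)"
  using l_supp by (auto simp: face_algebra_def fa.carrier_R)

lemma tr_l: "X \<in> lat \<Longrightarrow> tr (l X) = l (w ` X)"
  using l_image face_action_eq l_carrier by metis

lemma tr_e: assumes "X \<in> lat" shows "tr (e X) = e (w ` X)"
  using finite_lattice assms
proof (induction X rule: psubset_induct_down)
  case (step X)
  have im: "{Y \<in> lat. w ` X \<subset> Y} = (`) w ` {Y \<in> lat. X \<subset> Y}"
  proof (intro equalityI subsetI)
    fix Y assume Y: "Y \<in> {Y \<in> lat. w ` X \<subset> Y}"
    then have "Y \<in> (`) w ` lat" unfolding lat_onto by simp
    then obtain Z where Z: "Z \<in> lat" "Y = w ` Z" by blast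
    then have "X \<subset> Z" using Y inj_image_subset_iff[OF inj_w] by (auto simp: psubset_eq)
    then show "Y \<in> (`) w ` {Y \<in> lat. X \<subset> Y}" using Z by blast
  next
    fix Y assume "Y \<in> (`) w ` {Y \<in> lat. X \<subset> Y}"
    then show "Y \<in> {Y \<in> lat. w ` X \<subset> Y}"
      using lat_image inj_image_subset_iff[OF inj_w] inj_image_eq_iff[OF inj_w] by (auto simp: psubset_eq)
  qed
  have "tr (e X) = l (w ` X) - (\<Sum>Y\<in>{Y \<in> lat. X \<subset> Y}. tr (fm (l X) (e Y)))"
    unfolding e_eq[OF step(1)] by (simp only: tr_diff tr_sum tr_l[OF step(1)])
  also have "(\<Sum>Y\<in>{Y \<in> lat. X \<subset> Y}. tr (fm (l X) (e Y))) = (\<Sum>Y\<in>{Y \<in> lat. X \<subset> Y}. fm (l (w ` X)) (e (w ` Y)))"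
    by (intro sum.cong refl) (simp add: tr_fm l_carrier e_carrier step tr_l)
  also have "\<dots> = (\<Sum>Y\<in>{Y \<in> lat. w ` X \<subset> Y}. fm (l (w ` X)) (e Y))"
    unfolding im by (simp add: sum.reindex[OF inj_image])
  finally show ?case using e_eq[OF lat_image[OF step(1)]] by (simp only:)
qed

lemma tr_face_bdry:
  assumes Z: "Z \<in> lat" "X \<in> lat" "hsec Z X" and z: "z \<in> faces_on A Z"
  shows "tr (face_bdry X z) = smul (of_int (\<sigma> Z * \<sigma> X)) (face_bdry (w ` X) (w ` z))"
proof -
  obtain q where q: "z = face_of A q" "flat_of A q = Z" using z by (auto simp: faces_on_def faces_eq)
  obtain u where u: "u \<in> X" "u \<notin> Z" using hsec_subset[OF Z(3)] by blast
  have wm: "w (- u) = - w u" using lin by (rule linear_neg)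
  have fq: "flat_of A (w q) = w ` Z" using flat_image[of q] q by simp
  have 1: "face_bdry X z = smul (of_int (inc_sign \<epsilon> Z X u)) (\<delta> (face_of A (near A q u)) - \<delta> (face_of A (near A q (- u))))"
    using face_bdry_two[OF Z(2), of q u] Z u q by simp
  have 2: "face_bdry (w ` X) (w ` z) = smul (of_int (inc_sign \<epsilon> (w ` Z) (w ` X) (w u)))
      (\<delta> (face_of A (near A (w q) (w u))) - \<delta> (face_of A (near A (w q) (- w u))))"
    using face_bdry_two[OF lat_image[OF Z(2)], of "w q" "w u"] hsec_image[OF Z(3)] u fq q
    by (simp add: w_in_image face_of_image)
  show ?thesis
    unfolding 1 2 tr_smul tr_diff using near_image[of q u] near_image[of q "- u"]
    by (simp add: tr_delta face_of_image wm inc_sign_image[OF Z u])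
qed

lemma tr_bdry:
  assumes Z: "Z \<in> lat" "X \<in> lat" "hsec Z X"
  shows "tr (bdry Z X m) = smul (of_int (\<sigma> Z * \<sigma> X)) (bdry (w ` Z) (w ` X) (tr m))"
proof -
  have "bdry (w ` Z) (w ` X) (tr m) = (\<Sum>z\<in>faces_on A Z. smul (tr m (w ` z)) (face_bdry (w ` X) (w ` z)))"
    unfolding bdry_def faces_on_image[OF Z(1), symmetric] by (simp add: sum.reindex[OF inj_image])
  also have "\<dots> = (\<Sum>z\<in>faces_on A Z. smul (m z) (face_bdry (w ` X) (w ` z)))"
    by (intro sum.cong refl) (simp add: tr_apply faces_on_def)
  finally have r: "bdry (w ` Z) (w ` X) (tr m) = (\<Sum>z\<in>faces_on A Z. smul (m z) (face_bdry (w ` X) (w ` z)))" .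
  have "tr (bdry Z X m) = (\<Sum>z\<in>faces_on A Z. smul (m z) (tr (face_bdry X z)))"
    by (simp only: bdry_def tr_sum tr_smul)
  also have "\<dots> = (\<Sum>z\<in>faces_on A Z. smul (of_int (\<sigma> Z * \<sigma> X)) (smul (m z) (face_bdry (w ` X) (w ` z))))"
    by (intro sum.cong refl) (simp only: tr_face_bdry[OF Z] smul_smul mult.commute)
  also have "\<dots> = smul (of_int (\<sigma> Z * \<sigma> X)) (bdry (w ` Z) (w ` X) (tr m))"
    by (simp only: r smul_sum)
  finally show ?thesis .
qed

lemma bdry_smul: "bdry Z X (smul c m) = smul c (bdry Z X m)"
  by (simp only: bdry_def smul_sum smul_apply smul_smul)

text \<open>Every step of the path contributes the signs of its two ends. The sign of an inner
  vertex occurs twice and cancels, which leaves the signs of the first and the last vertex.\<close>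

lemma tr_pathel:
  "p \<in> P \<Longrightarrow> tr (pathel p) = smul (of_int (\<sigma> (hd p) * \<sigma> (last p))) (pathel (map ((`) w) p))"
proof (induction p rule: path_induct)
  case (single X)
  then show ?case by (simp add: tr_l \<sigma>_sq)
next
  case (Cons X Z p)
  let ?Y = "last (Z # p)"
  have "tr (pathel (X # Z # p)) = smul (of_int (\<sigma> Z * \<sigma> X)) (smul (of_int (\<sigma> Z * \<sigma> ?Y))
      (bdry (w ` Z) (w ` X) (pathel (map ((`) w) (Z # p)))))"
    using Cons(5) unfolding pathel.simps tr_bdry[OF Cons(3,1,2)] by (simp only: bdry_smul list.sel)
  also have "\<dots> = smul (of_int (\<sigma> X * \<sigma> ?Y)) (pathel (map ((`) w) (X # Z # p)))"
  proof -
    have "\<sigma> Z * \<sigma> X * (\<sigma> Z * \<sigma> ?Y) = (\<sigma> Z * \<sigma> Z) * (\<sigma> X * \<sigma> ?Y)" by (simp only: ac_simps)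
    also have "\<dots> = \<sigma> X * \<sigma> ?Y" using \<sigma>_sq[OF Cons(3)] by simp
    finally have "(of_int (\<sigma> Z * \<sigma> X) :: 'k) * of_int (\<sigma> Z * \<sigma> ?Y) = of_int (\<sigma> X * \<sigma> ?Y)"
      by (simp only: of_int_mult[symmetric])
    then show ?thesis by (simp only: smul_smul list.map pathel.simps)
  qed
  finally show ?case by simp
qed

lemma path_image: "p \<in> P \<Longrightarrow> map ((`) w) p \<in> P"
proof (induction p rule: path_induct)
  case (single X)
  then show ?case by (simp add: path_single lat_image)
next
  case (Cons X Z p)
  then show ?case by (simp add: path_Cons lat_image hsec_image)
qed

lemma tr_pathim:
  assumes p: "p \<in> P"
  shows "tr (pathim p) = smul (of_int (\<sigma> (hd p) * \<sigma> (last p))) (pathim (map ((`) w) p))"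
proof -
  have "pathel p \<in> carrier (face_algebra A)"
    using pathel_on[OF p] on_subset by (auto simp: face_algebra_def fa.carrier_R)
  then have "tr (pathim p) = fm (tr (pathel p)) (tr (e (hd p)))"
    unfolding pathim_def by (rule tr_fm) (rule e_carrier[OF hd_lat[OF p]])
  also have "tr (e (hd p)) = e (w ` hd p)" by (rule tr_e[OF hd_lat[OF p]])
  also have "w ` hd p = hd (map ((`) w) p)" using path_lat[OF p] by (simp add: hd_map)
  finally show ?thesis by (simp only: tr_pathel[OF p] bprod_smul_left pathim_def)
qed

end

section \<open>The presentation\<close>

text \<open>A basis of \<open>S\<close> together with \<open>a\<close> is independent, so the
  functional that is 1 on \<open>a\<close> and 0 on the basis extends linearly.\<close>

lemma separating_functional:
  fixes S :: "('b \<Rightarrow> 'k::field) set"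
  assumes 0: "0 \<in> S" and add: "\<And>f g. f \<in> S \<Longrightarrow> g \<in> S \<Longrightarrow> f + g \<in> S"
    and smul: "\<And>c f. f \<in> S \<Longrightarrow> smul c f \<in> S" and a: "a \<notin> S"
  obtains \<mu> :: "('b \<Rightarrow> 'k) \<Rightarrow> 'k" where "\<And>f g. \<mu> (f + g) = \<mu> f + \<mu> g" "\<And>c f. \<mu> (smul c f) = c * \<mu> f"
    "\<And>f. f \<in> S \<Longrightarrow> \<mu> f = 0" "\<mu> a = 1"
proof -
  interpret v: vector_space "smul :: 'k \<Rightarrow> ('b \<Rightarrow> 'k) \<Rightarrow> _"
    by unfold_locales (simp_all only: smul_add smul_add_left smul_smul smul_1)
  interpret p: vector_space_pair "smul :: 'k \<Rightarrow> ('b \<Rightarrow> 'k) \<Rightarrow> _" "(*) :: 'k \<Rightarrow> 'k \<Rightarrow> 'k"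
    by unfold_locales (simp_all add: algebra_simps)
  have S: "v.subspace S" by (rule v.subspaceI[OF 0 add smul])
  obtain B where B: "B \<subseteq> S" "v.independent B" "S \<subseteq> v.span B" using v.maximal_independent_subset .
  have "v.span B \<subseteq> S" by (rule v.span_minimal[OF B(1) S])
  then have aB: "a \<notin> v.span B" using a by blast
  then have i: "v.independent (insert a B)" using B(2) v.independent_insertI by blast
  obtain g where g: "Vector_Spaces.linear smul (*) g" "\<forall>x\<in>insert a B. g x = (if x = a then 1 else 0 :: 'k)"
    using p.linear_independent_extend[OF i, of "\<lambda>x. if x = a then 1 else 0"] by blast
  have "g x = 0" if "x \<in> B" for x using g(2) that aB v.span_base by auto
  then have "g f = 0" if "f \<in> S" for f
    using p.linear_eq_0_on_span[OF g(1), of B f] that B(3) by blast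
  then show thesis
    using that[of g] p.linear_add[OF g(1)] p.linear_scale[OF g(1)] g(2) by simp
qed

section \<open>The homomorphism from the path algebra\<close>

context oriented_quiver
begin

abbreviation "kQ \<equiv> path_algebra lat :: ('k, 'v set list \<Rightarrow> 'k) module"
abbreviation "kF \<equiv> face_algebra A :: ('k, 'v set \<Rightarrow> 'k) module"

lemma path_mult_assoc:
  assumes "a \<in> P" "b \<in> P" "c \<in> P"
  shows "Option.bind (path_mult a b) (\<lambda>d. path_mult d c) = Option.bind (path_mult b c) (path_mult a)"
proof -
  have n: "a \<noteq> []" "b \<noteq> []" "c \<noteq> []" using assms path_lat by blast+
  have l: "last (c @ tl b) = last b" if "last c = hd b"
    using n that by (cases b) auto
  have "hd (b @ tl a) = hd b" "tl (b @ tl a) = tl b @ tl a" using n by simp_all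
  then show ?thesis using l by (simp add: path_mult_def)
qed

sublocale pa: finite_basis_algebra P path_mult "{[X] | X. X \<in> lat}"
proof (unfold_locales, goal_cases)
  case 1
  then show ?case by (rule finite_P)
next
  case (2 a b c)
  then have "last b = hd a" "c = b @ tl a" by (auto simp: path_mult_def split: if_splits)
  then show ?case using path_append[OF 2(2,1)] by simp
next
  case (3 a b c)
  then show ?case by (rule path_mult_assoc)
next
  case 4
  then show ?case by (auto simp: path_single)
next
  case (5 b)
  have some: "path_mult [last b] b = Some b" by (simp add: path_mult_def)
  have none: "path_mult u b = None" if u: "u \<in> {[X] | X. X \<in> lat}" "u \<noteq> [last b]" for u
  proof -
    obtain X where X: "u = [X]" using u(1) by blast
    then have ne: "X \<noteq> last b" using u(2) by blast
    have "last b \<noteq> hd u" using ne unfolding X list.sel by blast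
    then show ?thesis by (simp only: path_mult_def if_False)
  qed
  have "[last b] \<in> {[X] | X. X \<in> lat}" using last_lat[OF 5] by blast
  show ?case
    by (rule bexI[of _ "[last b]"], rule conjI, rule some, intro ballI impI, rule none, assumption+) fact
next
  case (6 b)
  have "b \<noteq> []" using path_lat[OF 6] by simp
  then have some: "path_mult b [hd b] = Some b" by (simp add: path_mult_def)
  have none: "path_mult b u = None" if u: "u \<in> {[X] | X. X \<in> lat}" "u \<noteq> [hd b]" for u
  proof -
    obtain X where X: "u = [X]" using u(1) by blast
    then have ne: "X \<noteq> hd b" using u(2) by blast
    have "last u \<noteq> hd b" using ne unfolding X last.simps if_P[OF refl] by blast
    then show ?thesis by (simp only: path_mult_def if_False)
  qed
  have "[hd b] \<in> {[X] | X. X \<in> lat}" using hd_lat[OF 6] by blast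
  show ?case
    by (rule bexI[of _ "[hd b]"], rule conjI, rule some, intro ballI impI, rule none, assumption+) fact
qed

abbreviation pm :: "('v set list \<Rightarrow> 'k) \<Rightarrow> ('v set list \<Rightarrow> 'k) \<Rightarrow> 'v set list \<Rightarrow> 'k" where
  "pm \<equiv> bprod P path_mult"

lemma kQ_eq: "kQ = basis_algebra P path_mult {[X] | X. X \<in> lat}" by (simp add: path_algebra_def)

lemma kF_eq: "kF = basis_algebra F (\<lambda>x y. Some (fmult x y)) {\<Inter>A}" by (simp add: face_algebra_def)

lemma ring_kQ: "ring kQ" unfolding kQ_eq by (rule pa.ring_R)

lemma ring_kF: "ring kF" unfolding kF_eq by (rule fa.ring_R)

lemma pm_delta: "p \<in> P \<Longrightarrow> q \<in> P \<Longrightarrow> pm (\<delta> p) (\<delta> q) = (if last q = hd p then \<delta> (q @ tl p) else 0)"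
  by (simp add: pa.bprod_basis_elem path_mult_def)

definition pres :: "('v set list \<Rightarrow> 'k) \<Rightarrow> 'v set \<Rightarrow> 'k" where
  "pres a = (\<Sum>p\<in>P. smul (a p) (pathim p))"

lemma pres_add: "pres (a + b) = pres a + pres b"
  by (simp only: pres_def plus_fun_apply smul_add_left sum.distrib)

lemma pres_smul: "pres (smul c a) = smul c (pres a)"
  by (simp only: pres_def smul_apply smul_sum smul_smul)

lemma pres_0: "pres 0 = 0" by (simp only: pres_def zero_fun_apply smul_0 sum.neutral_const)

lemma pres_sum: "pres (\<Sum>i\<in>S. f i) = (\<Sum>i\<in>S. pres (f i))"
proof (induction S rule: infinite_finite_induct)
  case (insert x S)
  then show ?case by (simp only: sum.insert[OF insert(1,2)] pres_add)
qed (simp_all only: sum.infinite sum.empty pres_0 simp_thms)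

lemma pres_delta: "p \<in> P \<Longrightarrow> pres (\<delta> p) = pathim p"
proof -
  assume p: "p \<in> P"
  have "pres (\<delta> p) = (\<Sum>q\<in>P. if q = p then pathim q else 0)"
    unfolding pres_def by (intro sum.cong refl) (auto simp: basis_elem_def)
  then show ?thesis using p finite_P by simp
qed

lemma pres_carrier: "pres a \<in> carrier kF"
  unfolding pres_def kF_eq using pathim_carrier
  by (intro fa.carrier_sum fa.carrier_smul) (simp add: face_algebra_def)

lemma pres_mult:
  assumes "a \<in> carrier kQ" "b \<in> carrier kQ"
  shows "pres (pm a b) = fm (pres a) (pres b)"
proof -
  have a: "a = (\<Sum>p\<in>P. smul (a p) (\<delta> p))" and b: "b = (\<Sum>p\<in>P. smul (b p) (\<delta> p))"
    using assms unfolding kQ_eq by (auto intro!: pa.expansion)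
  have "pm a b = (\<Sum>q\<in>P. \<Sum>p\<in>P. smul (b q) (smul (a p) (pm (\<delta> p) (\<delta> q))))"
    by (subst a, subst b) (simp only: bprod_sum_left bprod_sum_right bprod_smul_left bprod_smul_right smul_sum)
  then have "pres (pm a b) = (\<Sum>q\<in>P. \<Sum>p\<in>P. smul (b q) (smul (a p) (pres (pm (\<delta> p) (\<delta> q)))))"
    by (simp only: pres_sum pres_smul)
  also have "\<dots> = (\<Sum>q\<in>P. \<Sum>p\<in>P. smul (b q) (smul (a p) (fm (pathim p) (pathim q))))"
  proof (intro sum.cong refl)
    fix q p assume "q \<in> P" "p \<in> P"
    then have "pres (pm (\<delta> p) (\<delta> q)) = fm (pathim p) (pathim q)"
      by (cases "last q = hd p") (simp_all only: pm_delta pathim_mult pres_delta path_append pres_0 simp_thms if_True if_False)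
    then show "smul (b q) (smul (a p) (pres (pm (\<delta> p) (\<delta> q)))) = smul (b q) (smul (a p) (fm (pathim p) (pathim q)))"
      by (simp only:)
  qed
  also have "\<dots> = fm (pres a) (pres b)"
    by (simp only: pres_def bprod_sum_left bprod_sum_right bprod_smul_left bprod_smul_right smul_sum)
  finally show ?thesis .
qed

lemma pres_one: "pres (\<Sum>u\<in>{[X] | X. X \<in> lat}. \<delta> u) = \<delta> (\<Inter>A)"
proof -
  have "{[X] | X. X \<in> lat} = (\<lambda>X. [X]) ` lat" by auto
  then have "pres (\<Sum>u\<in>{[X] | X. X \<in> lat}. \<delta> u) = (\<Sum>X\<in>lat. pres (\<delta> [X]))"
    by (simp add: pres_sum sum.reindex inj_on_def)
  also have "\<dots> = (\<Sum>X\<in>lat. e X)"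
    by (intro sum.cong refl) (simp add: pres_delta path_single pathim_single)
  finally show ?thesis using e_sum by simp
qed

lemma pres_hom: "pres \<in> algebra_hom kQ kF"
  unfolding algebra_hom_def
proof (intro CollectI conjI allI ballI)
  show "pres \<in> Ring.ring_hom kQ kF"
  proof (rule ring_hom_memI)
    show "pres x \<in> carrier kF" for x by (rule pres_carrier)
    show "pres (x \<otimes>\<^bsub>kQ\<^esub> y) = pres x \<otimes>\<^bsub>kF\<^esub> pres y" if "x \<in> carrier kQ" "y \<in> carrier kQ" for x y
      using pres_mult[OF that] pa.mult_R[OF that[unfolded kQ_eq]]
        fa.mult_R[OF pres_carrier[unfolded kF_eq] pres_carrier[unfolded kF_eq], of x y]
      unfolding kQ_eq kF_eq by (simp only:)
    show "pres (x \<oplus>\<^bsub>kQ\<^esub> y) = pres x \<oplus>\<^bsub>kF\<^esub> pres y" for x y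
      unfolding kQ_eq kF_eq pa.add_R fa.add_R by (rule pres_add)
    show "pres \<one>\<^bsub>kQ\<^esub> = \<one>\<^bsub>kF\<^esub>"
      unfolding kQ_eq kF_eq pa.one_R fa.one_R pres_one by simp
  qed
  show "pres (c \<odot>\<^bsub>kQ\<^esub> a) = c \<odot>\<^bsub>kF\<^esub> pres a" for c a
    unfolding kQ_eq kF_eq pa.smult_R fa.smult_R by (rule pres_smul)
qed

text \<open>Since \<open>z y = z\<close> for faces of equal support, multiplying the boundary of a
  single face \<open>y\<close> by \<open>l Y\<close> gives the boundary of \<open>l Y\<close>. This
  is why any face \<open>y\<close> may be used in the prescription.\<close>

lemma pres_arrow:
  assumes c: "Y \<in> lat" "X \<in> lat" "hsec Y X" and y: "y \<in> F" "supp A y = Y" "x \<noteq> x'"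
    and two: "{z \<in> F. supp A z = X \<and> face_le A y z} = {x, x'}"
  shows "pathim [X, Y] = fm (fm (l Y) (smul (of_int (incidence A \<epsilon> y x)) (\<delta> x) +
    smul (of_int (incidence A \<epsilon> y x')) (\<delta> x'))) (e X)"
proof -
  have m: "x \<in> F" "supp A x = X" "face_le A y x" "x' \<in> F" "supp A x' = X" "face_le A y x'"
    using two by blast+
  have "incidence A \<epsilon> y z = inc_sign \<epsilon> Y X (rep z)" if "z \<in> F" "supp A z = X" "face_le A y z" for z
  proof -
    have "rep z \<in> z" using rep_face_of[of "rep z"] rep_face[OF that(1)] by simp
    then show ?thesis using incidence_eq[OF y(1) that(1) _ that(3)] c y that by simp
  qed
  then have "face_bdry X y = smul (of_int (incidence A \<epsilon> y x)) (\<delta> x) + smul (of_int (incidence A \<epsilon> y x')) (\<delta> x')"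
    unfolding face_bdry_def faces_on_def mem_Collect_eq conj_assoc two using y m by simp
  moreover have "fm (l Y) (face_bdry X y) = bdry Y X (l Y)"
  proof -
    have "fm (l Y) (face_bdry X y) = (\<Sum>z\<in>faces_on A Y. smul (l Y z) (fm (\<delta> z) (face_bdry X y)))" by (rule fm_l[OF c(1)])
    also have "\<dots> = (\<Sum>z\<in>faces_on A Y. smul (l Y z) (face_bdry X z))"
    proof (intro sum.cong refl)
      fix z assume "z \<in> faces_on A Y"
      then have z: "z \<in> F" "supp A z = Y" by (auto simp: faces_on_def)
      have "fm (\<delta> z) (face_bdry X y) = face_bdry X (fmult z y)"
        using act_face_bdry[OF c(2,3), of y z] y z by (simp add: faces_on_def)
      also have "fmult z y = z" using fmult_absorb[OF z(1) y(1)] z y by simp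
      finally show "smul (l Y z) (fm (\<delta> z) (face_bdry X y)) = smul (l Y z) (face_bdry X z)" by simp
    qed
    finally show ?thesis by (simp only: bdry_def)
  qed
  ultimately show ?thesis by (simp add: pathim_def)
qed

lemma pres_prescribed: "prescribed_values A \<epsilon> l e pres"
  unfolding prescribed_values_def Let_def
proof (intro conjI ballI allI impI)
  show "pres (\<delta> [X]) = e X" if "X \<in> lat" for X
    using that by (simp add: pres_delta path_single pathim_single)
  fix X Y y x x'
  assume "covered_by lat Y X \<and> y \<in> F \<and> supp A y = Y \<and> x \<noteq> x' \<and> {z \<in> F. supp A z = X \<and> face_le A y z} = {x, x'}"
  then have c: "Y \<in> lat" "X \<in> lat" "hsec Y X" and y: "y \<in> F" "supp A y = Y" "x \<noteq> x'"
    and two: "{z \<in> F. supp A z = X \<and> face_le A y z} = {x, x'}" by (auto simp: covered_by_iff)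
  have m: "x \<in> F" "x' \<in> F" using two by blast+
  have p: "[X, Y] \<in> P" using c by (simp add: path_Cons path_single)
  let ?s = "smul (of_int (incidence A \<epsilon> y x)) (\<delta> x) + smul (of_int (incidence A \<epsilon> y x')) (\<delta> x') :: 'v set \<Rightarrow> 'k"
  have lc: "l Y \<in> carrier fa.R" using l_supp c by (auto simp: fa.carrier_R)
  have sc: "?s \<in> carrier fa.R" by (intro fa.carrier_add fa.carrier_smul fa.carrier_basis_elem m)
  have ec: "e X \<in> carrier fa.R" using e_carrier[OF c(2)] by (simp add: face_algebra_def)
  show "pres (\<delta> [X, Y]) = l Y \<otimes>\<^bsub>kF\<^esub> (of_int (incidence A \<epsilon> y x) \<odot>\<^bsub>kF\<^esub> \<delta> x \<oplus>\<^bsub>kF\<^esub>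
      of_int (incidence A \<epsilon> y x') \<odot>\<^bsub>kF\<^esub> \<delta> x') \<otimes>\<^bsub>kF\<^esub> e X"
    unfolding kF_eq fa.add_R fa.smult_R fa.mult_R[OF lc sc] fa.mult_R[OF fa.bprod_closed ec] pres_delta[OF p]
    by (rule pres_arrow[OF c y two])
qed

text \<open>Vertices and arrows generate the path algebra: a longer path is the product of its first
  arrow and the rest.\<close>

lemma pres_unique:
  assumes h: "\<psi> \<in> algebra_hom kQ kF" and pv: "prescribed_values A \<epsilon> l e \<psi>" and a: "a \<in> carrier kQ"
  shows "\<psi> a = pres a"
proof -
  have hom: "\<psi> \<in> Ring.ring_hom kQ kF" and sm: "\<And>c a. a \<in> carrier kQ \<Longrightarrow> \<psi> (c \<odot>\<^bsub>kQ\<^esub> a) = c \<odot>\<^bsub>kF\<^esub> \<psi> a"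
    using h by (auto simp: algebra_hom_def)
  have C: "f \<in> carrier pa.R \<Longrightarrow> f \<in> carrier kQ" for f :: "'v set list \<Rightarrow> 'k" by (simp add: kQ_eq)
  have add: "\<psi> (f + g) = \<psi> f + \<psi> g" if "f \<in> carrier pa.R" "g \<in> carrier pa.R" for f g
    using ring_hom_add[OF hom C[OF that(1)] C[OF that(2)]] unfolding kQ_eq kF_eq pa.add_R fa.add_R .
  have smu: "\<psi> (smul c f) = smul c (\<psi> f)" if "f \<in> carrier pa.R" for c f
    using sm[OF C[OF that]] unfolding kQ_eq kF_eq pa.smult_R fa.smult_R .
  have mul: "\<psi> (pm f g) = fm (\<psi> f) (\<psi> g)" if fg: "f \<in> carrier pa.R" "g \<in> carrier pa.R" for f g
  proof -
    have "\<psi> f \<in> carrier fa.R" "\<psi> g \<in> carrier fa.R"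
      using ring_hom_closed[OF hom C[OF fg(1)]] ring_hom_closed[OF hom C[OF fg(2)]]
      by (simp_all only: kF_eq)
    then show ?thesis
      using ring_hom_mult[OF hom C[OF fg(1)] C[OF fg(2)]]
      unfolding kQ_eq kF_eq pa.mult_R[OF fg] by (simp only: fa.mult_R)
  qed
  have \<delta>: "\<psi> (\<delta> p) = pathim p" if "p \<in> P" for p
    using that
  proof (induction p rule: path_induct)
    case (single X)
    then show ?case using pv by (simp add: prescribed_values_def Let_def pathim_single)
  next
    case (Cons X Z p)
    have XZ: "[X, Z] \<in> P" using Cons by (simp add: path_Cons path_single)
    \<comment> \<open>The prescription for an arrow speaks about faces, so actual \<open>y\<close>,
      \<open>x\<close> and \<open>x'\<close> must be exhibited before it determines a value.\<close>
    obtain w where w: "Z = flat_of A w" using Cons(3) by (auto simp: lattice_eq)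
    obtain u where u: "u \<in> X" "u \<notin> Z" using hsec_subset[OF Cons(2)] by blast
    note two = two_faces_above[OF Cons(1) Cons(2)[unfolded w] u[unfolded w]]
    have "covered_by lat Z X" using Cons by (simp add: covered_by_iff)
    then have pre: "covered_by lat Z X \<and> face_of A w \<in> F \<and> supp A (face_of A w) = Z \<and>
        face_of A (near A w u) \<noteq> face_of A (near A w (- u)) \<and>
        {z \<in> F. supp A z = X \<and> face_le A (face_of A w) z} = {face_of A (near A w u), face_of A (near A w (- u))}"
      using two w by simp
    have "\<psi> (\<delta> [X, Z]) = pres (\<delta> [X, Z])"
      using pv[unfolded prescribed_values_def Let_def, THEN conjunct2, rule_format, OF pre]
        pres_prescribed[unfolded prescribed_values_def Let_def, THEN conjunct2, rule_format, OF pre] by simp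
    then have 1: "\<psi> (\<delta> [X, Z]) = pathim [X, Z]" using pres_delta[OF XZ] by simp
    have 2: "\<delta> (X # Z # p) = pm (\<delta> (Z # p)) (\<delta> [X, Z])" using pm_delta[OF Cons(4) XZ] by simp
    have "\<psi> (\<delta> (X # Z # p)) = fm (pathim (Z # p)) (pathim [X, Z])"
      unfolding 2 using mul[of "\<delta> (Z # p)" "\<delta> [X, Z]"] Cons XZ 1 by simp
    also have "\<dots> = pathim (X # Z # p)" using pathim_mult[OF Cons(4) XZ] by simp
    finally show ?case .
  qed
  have \<psi>0: "\<psi> 0 = 0"
  proof -
    have "\<psi> (smul 0 0) = smul 0 (\<psi> 0)" by (rule smu[OF pa.carrier_0])
    then show ?thesis by (simp only: smul_0)
  qed
  have *: "\<psi> (\<Sum>p\<in>S. smul (a p) (\<delta> p)) = (\<Sum>p\<in>S. smul (a p) (pathim p))" if "S \<subseteq> P" for S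
  proof -
    have "finite S" using that finite_P finite_subset by blast
    then show ?thesis
      using that
    proof (induction S)
      case empty
      show ?case by (simp only: sum.empty \<psi>0)
    next
      case (insert p S)
      then have p: "p \<in> P" and S: "S \<subseteq> P" by auto
      have c: "smul (a p) (\<delta> p) \<in> carrier pa.R" "(\<Sum>p\<in>S. smul (a p) (\<delta> p)) \<in> carrier pa.R"
        using p S by (auto intro!: pa.carrier_sum pa.carrier_smul)
      show ?case
        using insert.IH[OF S] smu[of "\<delta> p" "a p"] \<delta>[OF p] p
        by (simp only: sum.insert[OF insert.hyps] add[OF c] pa.carrier_basis_elem)
    qed
  qed
  have "a = (\<Sum>p\<in>P. smul (a p) (\<delta> p))" using a unfolding kQ_eq by (rule pa.expansion)
  then have "\<psi> a = \<psi> (\<Sum>p\<in>P. smul (a p) (\<delta> p))" by (rule arg_cong)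
  then show ?thesis unfolding *[OF order_refl] pres_def .
qed

section \<open>Surjectivity\<close>

lemma fm_sum_e: assumes "b \<in> carrier kF" shows "b = (\<Sum>X\<in>lat. fm b (e X))"
proof -
  have "b = fm b (\<delta> (\<Inter>A))" using fa.bprod_unit(2)[of b] assms by (simp add: face_algebra_def)
  then show ?thesis by (simp only: e_sum[symmetric] bprod_sum_right)
qed

text \<open>A functional that kills the image kills every \<open>x e_X\<close> with \<open>x\<close>
  of support \<open>X\<close> by \<open>pairing_zero\<close>. These elements span, because the
  idempotents sum to 1 and faces with smaller support can be pushed up to \<open>X\<close>.\<close>

lemma pres_surj: "pres ` carrier kQ = carrier kF"
proof (intro equalityI subsetI)
  fix b assume "b \<in> pres ` carrier kQ"
  then show "b \<in> carrier kF" using pres_carrier by blast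
next
  fix b assume b: "b \<in> carrier kF"
  show "b \<in> pres ` carrier kQ"
  proof (rule ccontr)
    assume nb: "b \<notin> pres ` carrier kQ"
    obtain \<mu> :: "('v set \<Rightarrow> 'k) \<Rightarrow> 'k" where \<mu>: "\<And>f g. \<mu> (f + g) = \<mu> f + \<mu> g" "\<And>c f. \<mu> (smul c f) = c * \<mu> f"
      "\<And>f. f \<in> pres ` carrier kQ \<Longrightarrow> \<mu> f = 0" "\<mu> b = 1"
    proof (rule separating_functional[OF _ _ _ nb])
      show "0 \<in> pres ` carrier kQ" unfolding kQ_eq by (rule image_eqI[of _ _ 0]) (simp_all only: pres_0 pa.carrier_0)
      show "f + g \<in> pres ` carrier kQ" if fg: "f \<in> pres ` carrier kQ" "g \<in> pres ` carrier kQ" for f g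
      proof -
        obtain a c where ac: "a \<in> carrier kQ" "c \<in> carrier kQ" "f = pres a" "g = pres c" using fg by blast
        have "a + c \<in> carrier kQ" using ac(1,2) unfolding kQ_eq by (rule pa.carrier_add)
        then show ?thesis unfolding ac(3,4) pres_add[symmetric] by (rule imageI)
      qed
      show "smul c f \<in> pres ` carrier kQ" if f: "f \<in> pres ` carrier kQ" for c f
      proof -
        obtain a where a: "a \<in> carrier kQ" "f = pres a" using f by blast
        have "smul c a \<in> carrier kQ" using a(1) unfolding kQ_eq by (rule pa.carrier_smul)
        then show ?thesis unfolding a(2) pres_smul[symmetric] by (rule imageI)
      qed
    qed blast
    have \<mu>_0: "\<mu> 0 = 0" using \<mu>(2)[of 0 0] by (simp only: smul_0 mult_zero_left)
    have \<mu>_sum: "\<mu> (\<Sum>i\<in>S. f i) = (\<Sum>i\<in>S. \<mu> (f i))" if "finite S" for S :: "'i set" and f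
      using that
    proof (induction S)
      case (insert x S)
      then show ?case by (simp only: sum.insert[OF insert(1,2)] \<mu>(1))
    qed (simp only: sum.empty \<mu>_0)
    have top: "\<mu> (fm (\<delta> x) (e X)) = 0" if X: "X \<in> lat" and x: "x \<in> faces_on A X" for X x
    proof (rule pairing_zero[OF X _ x, of "\<lambda>x. \<mu> (fm (\<delta> x) (e X))"])
      fix p assume p: "p \<in> P" "hd p = X"
      have on: "pathel p y \<noteq> 0 \<Longrightarrow> y \<in> faces_on A X" for y using pathel_on[OF p(1)] p(2) by blast
      have "pathim p = (\<Sum>x\<in>faces_on A X. smul (pathel p x) (fm (\<delta> x) (e X)))"
        unfolding pathim_def p(2) by (rule fm_on[OF on_subset on])
      then have "\<mu> (pathim p) = (\<Sum>x\<in>faces_on A X. pathel p x * \<mu> (fm (\<delta> x) (e X)))"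
        by (simp only: \<mu>_sum[OF finite_on] \<mu>(2))
      moreover have "pathim p \<in> pres ` carrier kQ"
        unfolding pres_delta[OF p(1), symmetric] kQ_eq by (rule imageI[OF pa.carrier_basis_elem[OF p(1)]])
      ultimately show "(\<Sum>x\<in>faces_on A X. pathel p x * \<mu> (fm (\<delta> x) (e X))) = 0" using \<mu>(3) by simp
    qed
    have "\<mu> (fm b (e X)) = 0" if X: "X \<in> lat" for X
    proof -
      have "\<mu> (fm (\<delta> y) (e X)) = 0" if y: "y \<in> {y \<in> F. supp A y \<subseteq> X}" for y
      proof -
        have yF: "y \<in> F" "supp A y \<subseteq> X" using y by auto
        \<comment> \<open>Since \<open>e X = l X e X\<close>, a face \<open>y\<close> with support
          in \<open>X\<close> may be replaced by the products \<open>y x\<close>, which have support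
          \<open>X\<close>.\<close>
        have "fm (\<delta> y) (e X) = (\<Sum>x\<in>faces_on A X. smul (l X x) (fm (\<delta> y) (fm (\<delta> x) (e X))))"
        proof -
          have "e X = (\<Sum>x\<in>faces_on A X. smul (l X x) (fm (\<delta> x) (e X)))" using fm_l[OF X, of "e X"] l_e[OF X] by simp
          then have "fm (\<delta> y) (e X) = fm (\<delta> y) (\<Sum>x\<in>faces_on A X. smul (l X x) (fm (\<delta> x) (e X)))" by (rule arg_cong)
          then show ?thesis by (simp only: bprod_sum_right bprod_smul_right)
        qed
        then have "\<mu> (fm (\<delta> y) (e X)) = (\<Sum>x\<in>faces_on A X. l X x * \<mu> (fm (\<delta> y) (fm (\<delta> x) (e X))))"
          by (simp only: \<mu>_sum[OF finite_on] \<mu>(2))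
        also have "\<dots> = 0"
        proof (rule sum.neutral, rule ballI)
          fix x assume "x \<in> faces_on A X"
          then have x: "x \<in> F" "supp A x = X" by (auto simp: faces_on_def)
          have "fmult y x \<in> faces_on A X"
            using fmult_closed[OF yF(1) x(1)] supp_fmult_eq[OF yF(1) x(1)] yF x by (simp add: faces_on_def)
          then show "l X x * \<mu> (fm (\<delta> y) (fm (\<delta> x) (e X))) = 0"
            using top[OF X] by (simp add: fm_delta_act[OF yF(1) x(1)])
        qed
        finally show ?thesis .
      qed
      moreover have "finite {y \<in> F. supp A y \<subseteq> X}" using finite_faces by simp
      ultimately show ?thesis unfolding fm_e[OF X b] \<mu>_sum[OF \<open>finite {y \<in> F. supp A y \<subseteq> X}\<close>] \<mu>(2)
        by (intro sum.neutral) simp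
    qed
    then have "\<mu> (\<Sum>X\<in>lat. fm b (e X)) = 0" by (simp add: \<mu>_sum[OF finite_lattice])
    then show False using fm_sum_e[OF b] \<mu>(4) by simp
  qed
qed

section \<open>The kernel\<close>

definition relator :: "'v set list \<Rightarrow> 'k" where
  "relator = (\<Sum>p\<in>{p \<in> P. length p = 3}. \<delta> p)"

text \<open>A path of length two has three vertices, hence the 3; it is given by its ends and a flat
  between them.\<close>

lemma length_3_paths:
  "{p \<in> P. length p = 3} = (\<lambda>((X, W), Z). [X, Z, W]) ` (SIGMA XW:lat \<times> lat. mid A (snd XW) (fst XW))"
proof (intro equalityI subsetI)
  fix p assume p: "p \<in> {p \<in> P. length p = 3}"
  then obtain X Z W where "p = [X, Z, W]" by (auto simp: numeral_3_eq_3 length_Suc_conv)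
  then show "p \<in> (\<lambda>((X, W), Z). [X, Z, W]) ` (SIGMA XW:lat \<times> lat. mid A (snd XW) (fst XW))"
    using p path_lat[of p] by (intro image_eqI[of _ _ "((X, W), Z)"]) (auto simp: path_Cons path_single mid_def)
next
  fix p assume "p \<in> (\<lambda>((X, W), Z). [X, Z, W]) ` (SIGMA XW:lat \<times> lat. mid A (snd XW) (fst XW))"
  then show "p \<in> {p \<in> P. length p = 3}" by (auto simp: path_Cons path_single mid_def)
qed

text \<open>The transpose of \<open>cob_cob\<close>: the coefficient at \<open>x\<close> is the
  pairing with the indicator function of \<open>x\<close>.\<close>

lemma pathel_relation:
  assumes X: "X \<in> lat" "W \<in> lat"
  shows "(\<Sum>Z\<in>mid A W X. pathel [X, Z, W]) = 0"
proof
  fix x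
  show "(\<Sum>Z\<in>mid A W X. pathel [X, Z, W]) x = 0 x"
  proof (cases "x \<in> faces_on A X")
    case True
    define g where "g y = (if y = x then 1 else 0 :: 'k)" for y
    have "pathel [X, Z, W] x = (\<Sum>w\<in>faces_on A W. l W w * cob A (\<lambda>W Z u. of_int (inc_sign \<epsilon> W Z u)) Z
        (cob A (\<lambda>W Z u. of_int (inc_sign \<epsilon> W Z u)) X g) w)" for Z
    proof -
      have "pathel [X, Z, W] x = (\<Sum>y\<in>faces_on A X. bdry Z X (bdry W Z (l W)) y * g y)"
      proof -
        have "(\<Sum>y\<in>faces_on A X. bdry Z X (bdry W Z (l W)) y * g y) =
            (\<Sum>y\<in>faces_on A X. if y = x then bdry Z X (bdry W Z (l W)) y else 0)"
          by (intro sum.cong refl) (simp add: g_def)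
        then show ?thesis using True finite_on by simp
      qed
      then show ?thesis by (simp only: bdry_cob)
    qed
    then have "(\<Sum>Z\<in>mid A W X. pathel [X, Z, W]) x = (\<Sum>Z\<in>mid A W X. \<Sum>w\<in>faces_on A W. l W w *
        cob A (\<lambda>W Z u. of_int (inc_sign \<epsilon> W Z u)) Z (cob A (\<lambda>W Z u. of_int (inc_sign \<epsilon> W Z u)) X g) w)"
      by (simp only: sum_fun_apply)
    also have "\<dots> = (\<Sum>w\<in>faces_on A W. l W w * (\<Sum>Z\<in>mid A W X.
        cob A (\<lambda>W Z u. of_int (inc_sign \<epsilon> W Z u)) Z (cob A (\<lambda>W Z u. of_int (inc_sign \<epsilon> W Z u)) X g) w))"
      unfolding sum_distrib_left by (rule sum.swap)
    also have "\<dots> = 0"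
      by (rule sum.neutral) (use cob_cob in \<open>auto simp: faces_on_def\<close>)
    finally show ?thesis by simp
  next
    case False
    then have "pathel [X, Z, W] x = 0" for Z using bdry_on[of Z X _ x] by auto
    then show ?thesis by (simp add: sum_fun_apply)
  qed
qed

lemma pres_relator: "pres relator = 0"
proof -
  let ?S = "SIGMA XW:lat \<times> lat. mid A (snd XW) (fst XW)"
  have inj: "inj_on (\<lambda>((X, W), Z). [X, Z, W]) ?S" by (auto simp: inj_on_def)
  have "pres relator = (\<Sum>p\<in>{p \<in> P. length p = 3}. pathim p)"
    unfolding relator_def pres_sum by (intro sum.cong refl) (simp add: pres_delta)
  also have "\<dots> = (\<Sum>(XW, Z)\<in>?S. pathim [fst XW, Z, snd XW])"
    unfolding length_3_paths sum.reindex[OF inj] by (intro sum.cong refl) auto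
  also have "\<dots> = (\<Sum>XW\<in>lat \<times> lat. \<Sum>Z\<in>mid A (snd XW) (fst XW). pathim [fst XW, Z, snd XW])"
    by (rule sum.Sigma[symmetric]) (auto simp: finite_lattice finite_mid)
  also have "\<dots> = (\<Sum>XW\<in>lat \<times> lat. 0)"
  proof (intro sum.cong refl)
    fix XW assume "XW \<in> lat \<times> lat"
    then have "fst XW \<in> lat" "snd XW \<in> lat" by auto
    then have "fm (\<Sum>Z\<in>mid A (snd XW) (fst XW). pathel [fst XW, Z, snd XW]) (e (fst XW)) = 0"
      by (simp only: pathel_relation bprod_0)
    then show "(\<Sum>Z\<in>mid A (snd XW) (fst XW). pathim [fst XW, Z, snd XW]) = 0"
      by (simp only: pathim_def bprod_sum_left list.sel)
  qed
  also have "\<dots> = 0" by (simp only: sum.neutral_const)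
  finally show ?thesis .
qed

lemma relator_carrier: "relator \<in> carrier kQ"
  unfolding relator_def kQ_eq by (rule pa.carrier_sum) simp

text \<open>The single generator sums over all pairs of ends. Multiplication by paths on both sides
  keeps only the terms from \<open>last q\<close> to \<open>hd p\<close>, which recovers each
  relation with fixed ends.\<close>

lemma relator_sandwich:
  assumes p: "p \<in> P" and q: "q \<in> P"
  shows "pm (pm (\<delta> p) relator) (\<delta> q) = (\<Sum>Z\<in>mid A (hd p) (last q). \<delta> (q @ Z # p))"
proof -
  let ?T = "{t \<in> P. length t = 3}"
  have T: "finite ?T" using finite_P by simp
  have pn: "p \<noteq> []" using p path_lat by blast
  have "pm (pm (\<delta> p) relator) (\<delta> q) = (\<Sum>t\<in>?T. pm (pm (\<delta> p) (\<delta> t)) (\<delta> q))"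
    by (simp only: relator_def bprod_sum_left bprod_sum_right)
  also have "\<dots> = (\<Sum>t\<in>{t\<in>?T. hd t = last q \<and> last t = hd p}. pm (pm (\<delta> p) (\<delta> t)) (\<delta> q))"
  proof (rule sum.mono_neutral_right[OF T])
    show "\<forall>t\<in>?T - {t\<in>?T. hd t = last q \<and> last t = hd p}. pm (pm (\<delta> p) (\<delta> t)) (\<delta> q) = 0"
    proof
      fix t assume t: "t \<in> ?T - {t\<in>?T. hd t = last q \<and> last t = hd p}"
      then have tP: "t \<in> P" "t \<noteq> []" by auto
      show "pm (pm (\<delta> p) (\<delta> t)) (\<delta> q) = 0"
      proof (cases "last t = hd p")
        case True
        then have "hd t \<noteq> last q" using t by auto
        then have "last q \<noteq> hd (t @ tl p)" using tP by simp
        then show ?thesis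
          using True pm_delta[OF p tP(1)] pm_delta[OF path_append[OF tP(1) p True] q] by (simp only: simp_thms if_True if_False)
      next
        case False
        then show ?thesis using pm_delta[OF p tP(1)] by (simp only: if_False bprod_0)
      qed
    qed
  qed auto
  also have "{t\<in>?T. hd t = last q \<and> last t = hd p} = (\<lambda>Z. [last q, Z, hd p]) ` mid A (hd p) (last q)"
  proof (intro equalityI subsetI)
    fix t assume "t \<in> {t\<in>?T. hd t = last q \<and> last t = hd p}"
    then obtain Z where "t = [last q, Z, hd p]" "t \<in> P" by (auto simp: numeral_3_eq_3 length_Suc_conv)
    then show "t \<in> (\<lambda>Z. [last q, Z, hd p]) ` mid A (hd p) (last q)"
      using path_lat[of t] by (auto simp: path_Cons mid_def)
  next
    fix t assume "t \<in> (\<lambda>Z. [last q, Z, hd p]) ` mid A (hd p) (last q)"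
    then show "t \<in> {t\<in>?T. hd t = last q \<and> last t = hd p}"
      using last_lat[OF q] hd_lat[OF p] by (auto simp: path_Cons path_single mid_def)
  qed
  also have "(\<Sum>t\<in>(\<lambda>Z. [last q, Z, hd p]) ` mid A (hd p) (last q). pm (pm (\<delta> p) (\<delta> t)) (\<delta> q)) =
      (\<Sum>Z\<in>mid A (hd p) (last q). pm (pm (\<delta> p) (\<delta> [last q, Z, hd p])) (\<delta> q))"
    by (subst sum.reindex) (auto simp: inj_on_def)
  also have "\<dots> = (\<Sum>Z\<in>mid A (hd p) (last q). \<delta> (q @ Z # p))"
  proof (intro sum.cong refl)
    fix Z assume Z: "Z \<in> mid A (hd p) (last q)"
    have t: "[last q, Z, hd p] \<in> P"
      using Z last_lat[OF q] hd_lat[OF p] by (auto simp: path_Cons path_single mid_def)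
    have tp: "[last q, Z, hd p] @ tl p = last q # Z # p" using pn by simp
    have "last q # Z # p \<in> P" using path_append[OF t p] tp by simp
    then show "pm (pm (\<delta> p) (\<delta> [last q, Z, hd p])) (\<delta> q) = \<delta> (q @ Z # p)"
      using pm_delta[OF p t] pm_delta[of "last q # Z # p" q] q tp by simp
  qed
  finally show ?thesis .
qed

text \<open>The factor \<open>e X\<close> selects the paths that start at \<open>X\<close>, and
  triangularity reads off their coordinates.\<close>

lemma pres_top:
  assumes X: "X \<in> lat" and x: "x \<in> faces_on A X"
  shows "fm (pres a) (e X) x = (\<Sum>p\<in>{p \<in> P. hd p = X}. a p * pathel p x)"
proof -
  have "fm (pres a) (e X) = (\<Sum>p\<in>P. smul (a p) (fm (pathim p) (e X)))"
    by (simp only: pres_def bprod_sum_left bprod_smul_left)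
  then have "fm (pres a) (e X) x = (\<Sum>p\<in>P. a p * fm (pathim p) (e X) x)"
    by (simp add: sum_fun_apply smul_apply)
  also have "\<dots> = (\<Sum>p\<in>{p \<in> P. hd p = X}. a p * pathel p x)"
    by (rule sum.mono_neutral_cong_right[OF finite_P]) (use pathim_e[OF _ X] pathim_top x in auto)
  finally show ?thesis .
qed

text \<open>For \<open>a\<close> in the kernel but not in the ideal there would be a functional that
  kills the ideal and is 1 at \<open>a\<close>. On paths it is the pairing with functions
  \<open>g X\<close> (\<open>pairing_exists\<close>), so its value at \<open>a\<close> is a pairing
  with the coordinates of \<open>pres a\<close>, which are all 0.\<close>

lemma pres_kernel: "a_kernel kQ kF pres = Idl\<^bsub>kQ\<^esub> {relator}"
proof -
  interpret Q: ring kQ by (rule ring_kQ)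
  interpret hom: ring_hom_ring kQ kF pres
    by (rule ring_hom_ringI2[OF ring_kQ ring_kF]) (use pres_hom in \<open>simp add: algebra_hom_def\<close>)
  have ker: "a_kernel kQ kF pres = {a \<in> carrier kQ. pres a = 0}"
    unfolding a_kernel_def' kF_eq fa.zero_R ..
  let ?J = "Idl\<^bsub>kQ\<^esub> {relator}"
  have J: "ideal ?J kQ" by (rule Q.genideal_ideal) (simp add: relator_carrier)
  have rJ: "relator \<in> ?J" by (rule Q.genideal_self'[OF relator_carrier])
  interpret J: ideal ?J kQ by (rule J)
  have JC: "?J \<subseteq> carrier kQ" using J.a_subset .
  show ?thesis
  proof (intro equalityI)
    show "?J \<subseteq> a_kernel kQ kF pres"
      by (rule Q.genideal_minimal[OF hom.kernel_is_ideal]) (simp add: ker relator_carrier pres_relator)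
    show "a_kernel kQ kF pres \<subseteq> ?J"
    proof
      fix a assume "a \<in> a_kernel kQ kF pres"
      then have a: "a \<in> carrier kQ" "pres a = 0" by (simp_all add: ker)
      have mulJ: "pm (pm f j) g \<in> ?J" if "f \<in> carrier kQ" "g \<in> carrier kQ" "j \<in> ?J" for f g j
      proof -
        have j: "j \<in> carrier kQ" using that JC by blast
        have "f \<otimes>\<^bsub>kQ\<^esub> j \<otimes>\<^bsub>kQ\<^esub> g \<in> ?J" using that J.I_l_closed J.I_r_closed by simp
        moreover have "f \<otimes>\<^bsub>kQ\<^esub> j = pm f j" using that j unfolding kQ_eq by (intro pa.mult_R)
        moreover have "pm f j \<otimes>\<^bsub>kQ\<^esub> g = pm (pm f j) g"
          using that unfolding kQ_eq by (intro pa.mult_R pa.bprod_closed)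
        ultimately show ?thesis by simp
      qed
      \<comment> \<open>A ring ideal is closed under scalars because a scalar acts as multiplication
        by a multiple of the unit.\<close>
      have smulJ: "smul c j \<in> ?J" if j: "j \<in> ?J" for c j
      proof -
        have jc: "j \<in> carrier kQ" using j JC by blast
        have "c \<odot>\<^bsub>kQ\<^esub> \<one>\<^bsub>kQ\<^esub> \<in> carrier kQ" unfolding kQ_eq pa.smult_R pa.one_R by (intro pa.carrier_smul pa.one_closed)
        then have "(c \<odot>\<^bsub>kQ\<^esub> \<one>\<^bsub>kQ\<^esub>) \<otimes>\<^bsub>kQ\<^esub> j \<in> ?J" using j J.I_l_closed by blast
        moreover have "(c \<odot>\<^bsub>kQ\<^esub> \<one>\<^bsub>kQ\<^esub>) \<otimes>\<^bsub>kQ\<^esub> j = smul c j"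
          unfolding kQ_eq pa.smult_R pa.one_R
          using pa.mult_R[OF pa.carrier_smul[OF pa.one_closed] jc[unfolded kQ_eq]] pa.bprod_unit(1)[OF jc[unfolded kQ_eq]]
          by (simp only: bprod_smul_left)
        ultimately show ?thesis by simp
      qed
      show "a \<in> ?J"
      proof (rule ccontr)
        assume na: "a \<notin> ?J"
        obtain \<mu> :: "('v set list \<Rightarrow> 'k) \<Rightarrow> 'k" where \<mu>: "\<And>f g. \<mu> (f + g) = \<mu> f + \<mu> g"
          "\<And>c f. \<mu> (smul c f) = c * \<mu> f" "\<And>f. f \<in> ?J \<Longrightarrow> \<mu> f = 0" "\<mu> a = 1"
        proof (rule separating_functional[OF _ _ _ na])
          show "0 \<in> ?J" using J.zero_closed unfolding kQ_eq pa.zero_R .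
          show "f + g \<in> ?J" if "f \<in> ?J" "g \<in> ?J" for f g
            using J.a_closed[OF that] unfolding kQ_eq pa.add_R .
          show "smul c f \<in> ?J" if "f \<in> ?J" for c f by (rule smulJ[OF that])
        qed blast
        have \<mu>_0: "\<mu> 0 = 0" using \<mu>(2)[of 0 0] by (simp only: smul_0 mult_zero_left)
        have \<mu>_sum: "\<mu> (\<Sum>i\<in>S. f i) = (\<Sum>i\<in>S. \<mu> (f i))" if "finite S" for S :: "'i set" and f
          using that
        proof (induction S)
          case (insert x S)
          then show ?case by (simp only: sum.insert[OF insert(1,2)] \<mu>(1))
        qed (simp only: sum.empty \<mu>_0)
        have rel: "(\<Sum>Z\<in>mid A (hd p) (last q). \<mu> (\<delta> (q @ Z # p))) = 0" if "q \<in> P" "p \<in> P" for q p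
        proof -
          have "pm (pm (\<delta> p) relator) (\<delta> q) \<in> ?J"
            by (rule mulJ[OF _ _ rJ]) (simp_all add: kQ_eq that)
          then have "\<mu> (\<Sum>Z\<in>mid A (hd p) (last q). \<delta> (q @ Z # p)) = 0"
            using \<mu>(3) relator_sandwich[OF that(2,1)] by simp
          then show ?thesis by (simp only: \<mu>_sum[OF finite_mid])
        qed
        have "\<exists>g. \<forall>p\<in>P. hd p = X \<longrightarrow> (\<Sum>x\<in>faces_on A X. pathel p x * g x) = \<mu> (\<delta> p)" if "X \<in> lat" for X
          by (rule pairing_exists[OF that, of "\<lambda>p. \<mu> (\<delta> p)"]) (rule rel)
        then have "\<forall>X\<in>lat. \<exists>g. \<forall>p\<in>P. hd p = X \<longrightarrow> (\<Sum>x\<in>faces_on A X. pathel p x * g x) = \<mu> (\<delta> p)"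
          by blast
        then obtain g where "\<forall>X\<in>lat. \<forall>p\<in>P. hd p = X \<longrightarrow>
            (\<Sum>x\<in>faces_on A X. pathel p x * g X x) = \<mu> (\<delta> p)"
          by (rule bchoice[THEN exE])
        then have g: "(\<Sum>x\<in>faces_on A X. pathel p x * g X x) = \<mu> (\<delta> p)"
          if "X \<in> lat" "p \<in> P" "hd p = X" for X p
          using that by blast
        have "a = (\<Sum>p\<in>P. smul (a p) (\<delta> p))" using a(1) unfolding kQ_eq by (rule pa.expansion)
        then have "\<mu> a = \<mu> (\<Sum>p\<in>P. smul (a p) (\<delta> p))" by (rule arg_cong)
        also have "\<dots> = (\<Sum>p\<in>P. a p * \<mu> (\<delta> p))" by (simp only: \<mu>_sum[OF finite_P] \<mu>(2))
        also have "\<dots> = (\<Sum>X\<in>lat. \<Sum>p\<in>{p \<in> P. hd p = X}. a p * \<mu> (\<delta> p))"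
          by (rule sum.group[symmetric]) (use finite_P finite_lattice hd_lat in auto)
        also have "\<dots> = (\<Sum>X\<in>lat. 0)"
        proof (intro sum.cong refl)
          fix X assume X: "X \<in> lat"
          have "(\<Sum>p\<in>{p \<in> P. hd p = X}. a p * \<mu> (\<delta> p)) =
              (\<Sum>p\<in>{p \<in> P. hd p = X}. \<Sum>x\<in>faces_on A X. a p * pathel p x * g X x)"
            by (intro sum.cong refl) (simp add: g[OF X, symmetric] sum_distrib_left mult.assoc)
          also have "\<dots> = (\<Sum>x\<in>faces_on A X. \<Sum>p\<in>{p \<in> P. hd p = X}. a p * pathel p x * g X x)"
            by (rule sum.swap)
          also have "\<dots> = (\<Sum>x\<in>faces_on A X. fm (pres a) (e X) x * g X x)"
            by (intro sum.cong refl) (simp add: pres_top[OF X] sum_distrib_right)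
          also have "\<dots> = 0" unfolding a(2) bprod_0 by simp
          finally show "(\<Sum>p\<in>{p \<in> P. hd p = X}. a p * \<mu> (\<delta> p)) = 0" .
        qed
        finally show False using \<mu>(4) by simp
      qed
    qed
  qed
qed

end

section \<open>The action of the group\<close>

text \<open>The orientation of the intermediate image enters both factors and squares to 1.\<close>

lemma (in oriented_space) orientation_sign_comp:
  assumes v: "linear v" "inj v" and w: "linear w" "inj w"
    and X: "X \<in> \<L>" "w ` X \<in> \<L>" "(v \<circ> w) ` X \<in> \<L>" and bs: "ordered_basis X bs"
  shows "orientation_sign \<epsilon> X (v \<circ> w) = orientation_sign \<epsilon> X w * orientation_sign \<epsilon> (w ` X) v"
proof -
  have m: "ordered_basis (w ` X) (map w bs)" by (rule ordered_basis_map[OF w bs])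
  have vw: "linear (v \<circ> w)" "inj (v \<circ> w)" using v w by (auto intro: linear_compose inj_compose)
  have 1: "orientation_sign \<epsilon> X (v \<circ> w) = \<epsilon> X bs * \<epsilon> ((v \<circ> w) ` X) (map (v \<circ> w) bs)"
    by (rule orientation_sign_eq[OF vw X(1,3) bs])
  have 2: "orientation_sign \<epsilon> X w = \<epsilon> X bs * \<epsilon> (w ` X) (map w bs)"
    by (rule orientation_sign_eq[OF w X(1,2) bs])
  have "v ` w ` X \<in> \<L>" using X(3) by (simp add: image_comp)
  then have 3: "orientation_sign \<epsilon> (w ` X) v = \<epsilon> (w ` X) (map w bs) * \<epsilon> ((v \<circ> w) ` X) (map (v \<circ> w) bs)"
    using orientation_sign_eq[OF v X(2) _ m] by (simp add: image_comp)
  have "orientation_sign \<epsilon> X w * orientation_sign \<epsilon> (w ` X) v =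
      (\<epsilon> (w ` X) (map w bs) * \<epsilon> (w ` X) (map w bs)) * (\<epsilon> X bs * \<epsilon> ((v \<circ> w) ` X) (map (v \<circ> w) bs))"
    unfolding 2 3 by (simp only: ac_simps)
  then show ?thesis unfolding 1 using orientation_cases(2)[OF orient[OF X(2)] m m] by simp
qed

lemma (in oriented_space) orientation_sign_id:
  assumes X: "X \<in> \<L>" and bs: "ordered_basis X bs"
  shows "orientation_sign \<epsilon> X id = 1"
  using orientation_sign_eq[OF linear_id inj_on_id X _ bs] X orientation_cases(2)[OF orient[OF X] bs bs] by simp

context oriented_quiver
begin

definition qact :: "('v \<Rightarrow> 'v) \<Rightarrow> ('v set list \<Rightarrow> 'k) \<Rightarrow> 'v set list \<Rightarrow> 'k" where
  "qact w a = (\<Sum>p\<in>P. smul (a p) (smul (of_int (orientation_sign \<epsilon> (hd p) w * orientation_sign \<epsilon> (last p) w))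
     (\<delta> (map ((`) w) p))))"

lemma path_action_eq: "a \<in> carrier kQ \<Longrightarrow> path_action \<epsilon> w a = qact w a"
proof -
  assume "a \<in> carrier kQ"
  then have "\<And>p. a p \<noteq> 0 \<Longrightarrow> p \<in> P" by (simp add: kQ_eq pa.carrier_R)
  note * = linear_extension_eq[OF finite_P this, where g = "\<lambda>p. smul (of_int (orientation_sign \<epsilon> (hd p) w *
      orientation_sign \<epsilon> (last p) w)) (\<delta> (map ((`) w) p))"]
  show ?thesis
    unfolding path_action_def qact_def using * by (simp add: smul_def)
qed

lemma qact_add: "qact w (a + b) = qact w a + qact w b"
  by (simp only: qact_def plus_fun_apply smul_add_left sum.distrib)

lemma qact_smul: "qact w (smul c a) = smul c (qact w a)"
  by (simp only: qact_def smul_apply smul_sum smul_smul mult.assoc)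

lemma qact_0: "qact w 0 = 0" by (simp only: qact_def zero_fun_apply smul_0 sum.neutral_const)

lemma qact_sum: "qact w (\<Sum>i\<in>S. f i) = (\<Sum>i\<in>S. qact w (f i))"
proof (induction S rule: infinite_finite_induct)
  case (insert x S)
  then show ?case by (simp only: sum.insert[OF insert(1,2)] qact_add)
qed (simp_all only: sum.infinite sum.empty qact_0 simp_thms)

lemma qact_delta: "p \<in> P \<Longrightarrow> qact w (\<delta> p) =
    smul (of_int (orientation_sign \<epsilon> (hd p) w * orientation_sign \<epsilon> (last p) w)) (\<delta> (map ((`) w) p))"
proof -
  assume p: "p \<in> P"
  have "qact w (\<delta> p) = (\<Sum>q\<in>P. if q = p then
      smul (of_int (orientation_sign \<epsilon> (hd q) w * orientation_sign \<epsilon> (last q) w)) (\<delta> (map ((`) w) q)) else 0)"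
    unfolding qact_def by (intro sum.cong refl) (auto simp: basis_elem_def)
  then show ?thesis using p finite_P by simp
qed

lemma qact_expand: assumes "a \<in> carrier kQ" shows "qact w a = (\<Sum>p\<in>P. smul (a p) (qact w (\<delta> p)))"
proof -
  have "a = (\<Sum>p\<in>P. smul (a p) (\<delta> p))" using assms unfolding kQ_eq by (rule pa.expansion)
  then have "qact w a = qact w (\<Sum>p\<in>P. smul (a p) (\<delta> p))" by (rule arg_cong)
  then show ?thesis by (simp only: qact_sum qact_smul)
qed

end

section \<open>The group action on the path algebra and equivariance\<close>

locale quiver_group = oriented_quiver A \<epsilon> l e
  for A :: "'v::real_inner set set" and \<epsilon> :: "'v set \<Rightarrow> 'v list \<Rightarrow> int"
    and l e :: "'v set \<Rightarrow> 'v set \<Rightarrow> 'k::field" +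
  fixes W :: "('v \<Rightarrow> 'v) set"
  assumes subgrp: "subgroup W (BijGroup UNIV)"
    and sym: "\<And>w. w \<in> W \<Longrightarrow> quiver_symmetry A \<epsilon> l e w"
begin

lemma basis_lat: assumes "X \<in> lat" obtains bs where "ordered_basis X bs"
  using ordered_basis_exists[OF finite_dim lattice_subspace[OF assms]] .

lemma W_mult: assumes "v \<in> W" "w \<in> W" shows "v \<otimes>\<^bsub>BijGroup UNIV\<^esub> w = v \<circ> w"
  using subgroup.subset[OF subgrp] assms by (auto simp: BijGroup_def compose_def fun_eq_iff)

lemma W_inv: assumes "w \<in> W" obtains v where "v \<in> W" "v \<circ> w = id" "w \<circ> v = id"
proof -
  let ?v = "m_inv (BijGroup UNIV) w"
  have v: "?v \<in> W" by (rule subgroup.m_inv_closed[OF subgrp assms])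
  have c: "w \<in> carrier (BijGroup UNIV)" using subgroup.subset[OF subgrp] assms by blast
  have one: "\<one>\<^bsub>BijGroup UNIV\<^esub> = (id :: 'v \<Rightarrow> 'v)" by (auto simp: BijGroup_def fun_eq_iff)
  show thesis
    using that[OF v] group.l_inv[OF group_BijGroup c] group.r_inv[OF group_BijGroup c]
      W_mult[OF v assms] W_mult[OF assms v] one by simp
qed

lemma qact_carrier: assumes "w \<in> W" shows "qact w a \<in> carrier kQ"
proof -
  interpret s: quiver_symmetry A \<epsilon> l e w by (rule sym[OF assms])
  show ?thesis
    unfolding qact_def kQ_eq
    by (intro pa.carrier_sum pa.carrier_smul pa.carrier_basis_elem s.path_image)
qed

lemma qact_comp:
  assumes v: "v \<in> W" and w: "w \<in> W" and a: "a \<in> carrier kQ"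
  shows "qact (v \<circ> w) a = qact v (qact w a)"
proof -
  interpret sv: quiver_symmetry A \<epsilon> l e v by (rule sym[OF v])
  interpret sw: quiver_symmetry A \<epsilon> l e w by (rule sym[OF w])
  have \<sigma>: "orientation_sign \<epsilon> X (v \<circ> w) = orientation_sign \<epsilon> X w * orientation_sign \<epsilon> (w ` X) v"
    if X: "X \<in> lat" for X
  proof -
    obtain bs where bs: "ordered_basis X bs" using basis_lat[OF X] .
    have "(v \<circ> w) ` X \<in> lat" using sv.lat_image[OF sw.lat_image[OF X]] by (simp add: image_comp)
    then show ?thesis
      by (rule orientation_sign_comp[OF sv.lin sv.inj_w sw.lin sw.inj_w X sw.lat_image[OF X] _ bs])
  qed
  have "qact (v \<circ> w) (\<delta> p) = qact v (qact w (\<delta> p))" if p: "p \<in> P" for p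
  proof -
    have pn: "p \<noteq> []" using path_lat[OF p] by simp
    let ?h = "hd p" and ?l = "last p"
    have "qact v (qact w (\<delta> p)) = smul (of_int (orientation_sign \<epsilon> ?h w * orientation_sign \<epsilon> ?l w) *
        of_int (orientation_sign \<epsilon> (w ` ?h) v * orientation_sign \<epsilon> (w ` ?l) v)) (\<delta> (map ((`) v) (map ((`) w) p)))"
      using qact_delta[OF sw.path_image[OF p], of v] pn
      by (simp only: qact_delta[OF p] qact_smul smul_smul hd_map last_map simp_thms)
    also have "map ((`) v) (map ((`) w) p) = map ((`) (v \<circ> w)) p" by (simp add: image_comp comp_def)
    also have "(of_int (orientation_sign \<epsilon> ?h w * orientation_sign \<epsilon> ?l w) *
        of_int (orientation_sign \<epsilon> (w ` ?h) v * orientation_sign \<epsilon> (w ` ?l) v) :: 'k) =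
        of_int (orientation_sign \<epsilon> ?h (v \<circ> w) * orientation_sign \<epsilon> ?l (v \<circ> w))"
      unfolding \<sigma>[OF hd_lat[OF p]] \<sigma>[OF last_lat[OF p]] of_int_mult[symmetric] by (simp only: ac_simps)
    finally show ?thesis unfolding qact_delta[OF p] ..
  qed
  then have "(\<Sum>p\<in>P. smul (a p) (qact (v \<circ> w) (\<delta> p))) = (\<Sum>p\<in>P. smul (a p) (qact v (qact w (\<delta> p))))"
    by (intro sum.cong refl) (simp only:)
  then show ?thesis by (simp only: qact_expand[OF a] qact_sum qact_smul)
qed

lemma qact_id: assumes "a \<in> carrier kQ" shows "qact id a = a"
proof -
  have "qact id (\<delta> p) = \<delta> p" if p: "p \<in> P" for p
  proof -
    have s: "orientation_sign \<epsilon> X id = 1" if "X \<in> lat" for X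
      by (rule basis_lat[OF that]) (rule orientation_sign_id[OF that])
    have "map ((`) id) p = p" by (simp add: map_idI)
    then show ?thesis unfolding qact_delta[OF p] s[OF hd_lat[OF p]] s[OF last_lat[OF p]] by simp
  qed
  then have "qact id a = (\<Sum>p\<in>P. smul (a p) (\<delta> p))" unfolding qact_expand[OF assms] by (intro sum.cong refl) (simp only:)
  also have "\<dots> = a" using assms unfolding kQ_eq by (rule pa.expansion[symmetric])
  finally show ?thesis .
qed

text \<open>Bijectivity of each map comes from the inverse group element, so it rests on
  \<open>qact_comp\<close> just as the homomorphism property does.\<close>

lemma path_group_action:
  "group_action (BijGroup UNIV\<lparr>carrier := W\<rparr>) (carrier kQ) (\<lambda>w. restrict (path_action \<epsilon> w) (carrier kQ))"
proof -
  let ?r = "\<lambda>w. restrict (path_action \<epsilon> w) (carrier kQ)"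
  have r: "?r w a = qact w a" if "a \<in> carrier kQ" for w a using that by (simp add: path_action_eq)
  have B: "?r w \<in> Bij (carrier kQ)" if w: "w \<in> W" for w
  proof -
    obtain v where v: "v \<in> W" "v \<circ> w = id" "w \<circ> v = id" using W_inv[OF w] .
    have "bij_betw (?r w) (carrier kQ) (carrier kQ)"
    proof (rule bij_betwI[where g = "?r v"])
      show "?r w \<in> carrier kQ \<rightarrow> carrier kQ" using qact_carrier[OF w] by (simp add: path_action_eq)
      show "?r v \<in> carrier kQ \<rightarrow> carrier kQ" using qact_carrier[OF v(1)] by (simp add: path_action_eq)
      show "?r v (?r w a) = a" if a: "a \<in> carrier kQ" for a
        using r[OF a] r[OF qact_carrier[OF w]] qact_comp[OF v(1) w a] v(2) qact_id[OF a] by simp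
      show "?r w (?r v a) = a" if a: "a \<in> carrier kQ" for a
        using r[OF a] r[OF qact_carrier[OF v(1)]] qact_comp[OF w v(1) a] v(3) qact_id[OF a] by simp
    qed
    then show ?thesis by (simp add: Bij_def)
  qed
  have "?r \<in> hom (BijGroup UNIV\<lparr>carrier := W\<rparr>) (BijGroup (carrier kQ))"
  proof (rule homI)
    show "?r w \<in> carrier (BijGroup (carrier kQ))" if "w \<in> carrier (BijGroup UNIV\<lparr>carrier := W\<rparr>)" for w
      using B that by (simp add: BijGroup_def)
    fix v w assume "v \<in> carrier (BijGroup UNIV\<lparr>carrier := W\<rparr>)" "w \<in> carrier (BijGroup UNIV\<lparr>carrier := W\<rparr>)"
    then have vw: "v \<in> W" "w \<in> W" by simp_all
    have "?r (v \<circ> w) = compose (carrier kQ) (?r v) (?r w)"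
    proof
      fix a
      show "?r (v \<circ> w) a = compose (carrier kQ) (?r v) (?r w) a"
      proof (cases "a \<in> carrier kQ")
        case True
        then show ?thesis
          using r[OF True] r[OF qact_carrier[OF vw(2)]] qact_comp[OF vw True] qact_carrier[OF vw(2)]
          by (simp add: compose_def)
      qed (simp add: compose_def)
    qed
    then show "?r (v \<otimes>\<^bsub>BijGroup UNIV\<lparr>carrier := W\<rparr>\<^esub> w) = ?r v \<otimes>\<^bsub>BijGroup (carrier kQ)\<^esub> ?r w"
      using B[OF vw(1)] B[OF vw(2)] W_mult[OF vw] by (simp add: BijGroup_def)
  qed
  moreover have "Group.group (BijGroup UNIV\<lparr>carrier := W\<rparr>)"
    by (rule subgroup.subgroup_is_group[OF subgrp group_BijGroup])
  ultimately show ?thesis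
    unfolding group_action_def group_hom_def group_hom_axioms_def using group_BijGroup by blast
qed

lemma pres_equivariant:
  assumes w: "w \<in> W" and a: "a \<in> carrier kQ"
  shows "pres (path_action \<epsilon> w a) = face_action w (pres a)"
proof -
  interpret s: quiver_symmetry A \<epsilon> l e w by (rule sym[OF w])
  have "pres (qact w a) = (\<Sum>p\<in>P. smul (a p) (pres (qact w (\<delta> p))))"
    by (simp only: qact_expand[OF a] pres_sum pres_smul)
  also have "\<dots> = (\<Sum>p\<in>P. smul (a p) (s.tr (pathim p)))"
    by (intro sum.cong refl) (simp only: qact_delta pres_smul pres_delta s.path_image s.tr_pathim)
  also have "\<dots> = s.tr (pres a)" by (simp only: pres_def s.tr_sum s.tr_smul)
  finally show ?thesis using path_action_eq[OF a] s.face_action_eq[OF pres_carrier] by simp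
qed

end

section \<open>Reflection groups\<close>

lemma reflection_fixed:
  assumes "a \<noteq> (0::'v::real_inner)"
  shows "{v. v - (2 * inner a v / inner a a) *\<^sub>R a = v} = {v. inner a v = 0}"
  using assms by auto

lemma reflection_arrangement_hyperplane:
  assumes "finite_reflection_group W"
  shows "hyperplane_arrangement (reflection_arrangement W)"
proof
  have "finite {{v. s v = v} |s. s \<in> W \<and> reflection s}"
    using assms by (auto simp: finite_reflection_group_def)
  then show "finite (reflection_arrangement W)" by (simp add: reflection_arrangement_def)
  fix H assume "H \<in> reflection_arrangement W"
  then obtain s where "reflection s" "H = {v. s v = v}" by (auto simp: reflection_arrangement_def)
  then show "\<exists>a. a \<noteq> 0 \<and> H = {v. inner a v = 0}" using reflection_fixed by (auto simp: reflection_def)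
qed

text \<open>Conjugating the reflection along \<open>a\<close> by \<open>w\<close> gives the
  reflection along \<open>w a\<close>.\<close>

lemma reflection_group_image:
  fixes w :: "'v::real_inner \<Rightarrow> 'v"
  assumes W: "subgroup W (BijGroup UNIV)" and w: "w \<in> W" "orthogonal_transformation w"
    and H: "H \<in> reflection_arrangement W"
  shows "w ` H \<in> reflection_arrangement W"
proof -
  obtain s where s: "s \<in> W" "reflection s" "H = {v. s v = v}" using H by (auto simp: reflection_arrangement_def)
  obtain a where a: "a \<noteq> 0" "s = (\<lambda>v. v - (2 * inner a v / inner a a) *\<^sub>R a)" using s(2) by (auto simp: reflection_def)
  have c: "W \<subseteq> carrier (BijGroup UNIV)" by (rule subgroup.subset[OF W])
  have mult: "x \<otimes>\<^bsub>BijGroup UNIV\<^esub> y = x \<circ> y" if "x \<in> W" "y \<in> W" for x y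
    using c that by (auto simp: BijGroup_def compose_def fun_eq_iff)
  let ?v = "m_inv (BijGroup UNIV) w"
  have v: "?v \<in> W" by (rule subgroup.m_inv_closed[OF W w(1)])
  have "\<one>\<^bsub>BijGroup UNIV\<^esub> = (id :: 'v \<Rightarrow> 'v)" by (auto simp: BijGroup_def fun_eq_iff)
  then have "w \<circ> ?v = id"
    using group.r_inv[OF group_BijGroup, of w UNIV] c w(1) mult[OF w(1) v] by (auto simp del: group.r_inv)
  then have wv: "w (?v x) = x" for x by (metis comp_apply id_apply)
  have ws: "w \<circ> s \<in> W" using subgroup.m_closed[OF W w(1) s(1)] mult[OF w(1) s(1)] by simp
  have t: "w \<circ> s \<circ> ?v \<in> W" using subgroup.m_closed[OF W ws v] mult[OF ws v] by simp
  have lin: "linear w" and inn: "inner (w x) (w y) = inner x y" for x y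
    using w(2) by (auto simp: orthogonal_transformation_def)
  have t_eq: "w \<circ> s \<circ> ?v = (\<lambda>x. x - (2 * inner (w a) x / inner (w a) (w a)) *\<^sub>R w a)"
  proof
    fix x
    have "inner a (?v x) = inner (w a) x" using inn[of a "?v x"] wv by simp
    then show "(w \<circ> s \<circ> ?v) x = x - (2 * inner (w a) x / inner (w a) (w a)) *\<^sub>R w a"
      by (simp add: a(2) linear_diff[OF lin] linear_scale[OF lin] wv inn)
  qed
  have wa: "w a \<noteq> 0" using inn[of a a] a(1) by auto
  then have "reflection (w \<circ> s \<circ> ?v)" unfolding reflection_def t_eq by blast
  moreover have "w ` H = {x. (w \<circ> s \<circ> ?v) x = x}"
  proof -
    have "H = {v. inner a v = 0}" using s(3) reflection_fixed[OF a(1)] a(2) by simp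
    moreover have "{x. (w \<circ> s \<circ> ?v) x = x} = {x. inner (w a) x = 0}" unfolding t_eq by (rule reflection_fixed[OF wa])
    moreover have "w ` {v. inner a v = 0} = {x. inner (w a) x = 0}"
    proof (intro equalityI subsetI)
      fix x assume x: "x \<in> {x. inner (w a) x = 0}"
      then have "inner a (?v x) = 0" using inn[of a "?v x"] wv by simp
      then show "x \<in> w ` {v. inner a v = 0}" using wv by (metis (mono_tags, lifting) imageI mem_Collect_eq)
    qed (auto simp: inn)
    ultimately show ?thesis by simp
  qed
  ultimately show ?thesis using t unfolding reflection_arrangement_def by blast
qed

lemma reflection_group_symmetry:
  assumes W: "finite_reflection_group W" and w: "w \<in> W"
  shows "arrangement_symmetry (reflection_arrangement W) w"
proof -
  interpret hyperplane_arrangement "reflection_arrangement W" by (rule reflection_arrangement_hyperplane[OF W])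
  have sub: "subgroup W (BijGroup UNIV)" and orth: "orthogonal_transformation w"
    using W w by (auto simp: finite_reflection_group_def)
  have bij: "bij w" using subgroup.subset[OF sub] w by (auto simp: BijGroup_def Bij_def)
  have "(`) w ` reflection_arrangement W = reflection_arrangement W"
    by (rule endo_inj_surj[OF fin])
      (use reflection_group_image[OF sub w orth] bij in \<open>auto simp: inj_on_def inj_image_eq_iff bij_def\<close>)
  then show ?thesis by unfold_locales (use orth bij in auto)
qed

text \<open>The operations of the algebra are understood only on its carrier, and the recursion does
  not say that \<open>e Y\<close> lies there. A downward induction supplies this, and then the
  products can be replaced by \<open>fm\<close>.\<close>

lemma (in hyperplane_arrangement) recursive_idempotents:
  fixes l e :: "'v set \<Rightarrow> 'v set \<Rightarrow> 'k::field"
  assumes l: "\<And>X x. X \<in> lat \<Longrightarrow> l X x \<noteq> 0 \<Longrightarrow> x \<in> F \<and> supp A x = X"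
    and e: "\<And>X. X \<in> lat \<Longrightarrow> e X = l X \<ominus>\<^bsub>face_algebra A\<^esub>
      (\<Oplus>\<^bsub>face_algebra A\<^esub>Y\<in>{Y \<in> lat. X \<subset> Y}. l X \<otimes>\<^bsub>face_algebra A\<^esub> e Y)"
    and X: "X \<in> lat"
  shows "e X = l X - (\<Sum>Y\<in>{Y \<in> lat. X \<subset> Y}. fm (l X) (e Y))"
proof -
  have kF: "face_algebra A = (fa.R :: ('k, 'v set \<Rightarrow> 'k) module)" by (simp add: face_algebra_def)
  have lc: "l X \<in> carrier fa.R" if "X \<in> lat" for X using l[OF that] by (auto simp: fa.carrier_R)
  have formula: "e X = l X - (\<Sum>Y\<in>{Y \<in> lat. X \<subset> Y}. fm (l X) (e Y))"
    if X: "X \<in> lat" and c: "\<And>Y. Y \<in> lat \<Longrightarrow> X \<subset> Y \<Longrightarrow> e Y \<in> carrier fa.R" for X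
  proof -
    have m: "l X \<otimes>\<^bsub>fa.R\<^esub> e Y = fm (l X) (e Y)" if "Y \<in> {Y \<in> lat. X \<subset> Y}" for Y
      using fa.mult_R[OF lc[OF X] c] that by blast
    have "(\<Oplus>\<^bsub>fa.R\<^esub>Y\<in>{Y \<in> lat. X \<subset> Y}. l X \<otimes>\<^bsub>fa.R\<^esub> e Y) =
        (\<Sum>Y\<in>{Y \<in> lat. X \<subset> Y}. l X \<otimes>\<^bsub>fa.R\<^esub> e Y)"
      by (rule fa.finsum_R) (simp only: m fa.bprod_closed)
    also have "\<dots> = (\<Sum>Y\<in>{Y \<in> lat. X \<subset> Y}. fm (l X) (e Y))" by (intro sum.cong refl m)
    finally have "e X = l X \<ominus>\<^bsub>fa.R\<^esub> (\<Sum>Y\<in>{Y \<in> lat. X \<subset> Y}. fm (l X) (e Y))"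
      using e[OF X] unfolding kF by simp
    also have "\<dots> = l X - (\<Sum>Y\<in>{Y \<in> lat. X \<subset> Y}. fm (l X) (e Y))"
      by (rule fa.minus_R[OF lc[OF X] fa.carrier_sum[OF fa.bprod_closed]])
    finally show ?thesis .
  qed
  have "e X \<in> carrier fa.R" if "X \<in> lat" for X
    using finite_lattice that
  proof (induction X rule: psubset_induct_down)
    case (step X)
    show ?case
    proof -
      have "l X - (\<Sum>Y\<in>{Y \<in> lat. X \<subset> Y}. fm (l X) (e Y)) \<in> carrier fa.R"
        by (intro fa.carrier_diff lc step(1) fa.carrier_sum fa.bprod_closed)
      moreover have "e X = l X - (\<Sum>Y\<in>{Y \<in> lat. X \<subset> Y}. fm (l X) (e Y))"
        by (rule formula[OF step(1)]) (rule step(2))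
      ultimately show ?thesis by (simp only:)
    qed
  qed
  then show ?thesis using formula[OF X] by blast
qed

theorem theorem6p2:
  fixes W :: "('v::real_inner \<Rightarrow> 'v) set"
    and A L :: "'v set set"
    and kF :: "('k::field, 'v set \<Rightarrow> 'k) module"
    and kQ :: "('k, 'v set list \<Rightarrow> 'k) module"
    and l e :: "'v set \<Rightarrow> 'v set \<Rightarrow> 'k"
    and \<epsilon> :: "'v set \<Rightarrow> 'v list \<Rightarrow> int"
  assumes finite_dim: "\<exists>B :: 'v set. finite B \<and> span B = UNIV"
    and W: "finite_reflection_group W"
    and char: "\<not> CHAR('k) dvd card W"
    and A: "A = reflection_arrangement W"
    and L: "L = intersection_lattice A"
    and kF: "kF = face_algebra A"
    and kQ: "kQ = path_algebra L"
    and l_supp: "\<And>X x. X \<in> L \<Longrightarrow> l X x \<noteq> 0 \<Longrightarrow> x \<in> faces A \<and> supp A x = X"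
    and l_sum: "\<And>X. X \<in> L \<Longrightarrow> (\<Sum>x\<in>{x \<in> faces A. supp A x = X}. l X x) = 1"
    and l_equivariant: "\<And>w X. w \<in> W \<Longrightarrow> X \<in> L \<Longrightarrow> face_action w (l X) = l (w ` X)"
    and e: "\<And>X. X \<in> L \<Longrightarrow>
              e X = l X \<ominus>\<^bsub>kF\<^esub> (\<Oplus>\<^bsub>kF\<^esub>Y\<in>{Y \<in> L. X \<subset> Y}. l X \<otimes>\<^bsub>kF\<^esub> e Y)"
    and \<epsilon>: "\<And>X. X \<in> L \<Longrightarrow> orientation X (\<epsilon> X)"
  shows "complete_primitive_orthogonal_idempotents kF L e \<and>
    (\<exists>\<phi>. \<phi> \<in> algebra_hom kQ kF \<and> prescribed_values A \<epsilon> l e \<phi> \<and>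
      (\<forall>\<psi>. \<psi> \<in> algebra_hom kQ kF \<and> prescribed_values A \<epsilon> l e \<psi> \<longrightarrow>
        (\<forall>a\<in>carrier kQ. \<psi> a = \<phi> a)) \<and>
      \<phi> ` carrier kQ = carrier kF \<and>
      a_kernel kQ kF \<phi> =
        Idl\<^bsub>kQ\<^esub> {\<Oplus>\<^bsub>kQ\<^esub>p\<in>{p \<in> quiver_paths L. length p = 3}. basis_elem p} \<and>
      group_action (BijGroup UNIV\<lparr>carrier := W\<rparr>) (carrier kQ)
        (\<lambda>w. restrict (path_action \<epsilon> w) (carrier kQ)) \<and>
      (\<forall>w\<in>W. \<forall>a\<in>carrier kQ. \<phi> (path_action \<epsilon> w a) = face_action w (\<phi> a)))"
proof -
  interpret hyperplane_arrangement A unfolding A by (rule reflection_arrangement_hyperplane[OF W])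
  interpret q: oriented_quiver A \<epsilon> l e
  proof unfold_locales
    show "x \<in> F \<and> supp A x = X" if "X \<in> lat" "l X x \<noteq> 0" for X x using l_supp that L by simp
    show "(\<Sum>x\<in>faces_on A X. l X x) = 1" if "X \<in> lat" for X using l_sum that L by (simp add: faces_on_def)
    show "e X = l X - (\<Sum>Y\<in>{Y \<in> lat. X \<subset> Y}. fm (l X) (e Y))" if "X \<in> lat" for X
      by (rule recursive_idempotents[OF _ _ that]) (use l_supp e L kF in auto)
    show "orientation X (\<epsilon> X)" if "X \<in> lat" for X using \<epsilon> that L by simp
  qed (rule finite_dim)
  interpret g: quiver_group A \<epsilon> l e W
  proof (rule quiver_group.intro, rule q.oriented_quiver_axioms, rule quiver_group_axioms.intro)
    show "subgroup W (BijGroup UNIV)" using W by (simp add: finite_reflection_group_def)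
    fix w assume w: "w \<in> W"
    interpret s: arrangement_symmetry A w unfolding A by (rule reflection_group_symmetry[OF W w])
    show "quiver_symmetry A \<epsilon> l e w"
      by unfold_locales (use l_equivariant[OF w] L in simp)
  qed
  have Q: "kQ = q.kQ" using kQ L by simp
  have r: "(\<Oplus>\<^bsub>kQ\<^esub>p\<in>{p \<in> quiver_paths L. length p = 3}. basis_elem p) = q.relator"
    unfolding Q L q.kQ_eq q.relator_def by (rule q.pa.finsum_R) simp
  show ?thesis
    unfolding r unfolding Q kF L
    using q.complete_idempotents q.pres_hom q.pres_prescribed q.pres_unique q.pres_surj q.pres_kernel
      g.path_group_action g.pres_equivariant by (intro conjI exI[of _ q.pres]) blast+
qed

end
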